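(* Let $E$ be a finite directed graph without sinks or sources in which every cycle has an exit, and let $\mathcal J$ be an admissible set of pairs of paths, with unitary $u=u_{\mathcal J}\in L_{\mathbb Z}(E)$, such that the coding graph $E_{\mathcal J}$ has only non-negative edges, contains no non-positive cycles, and $(E_{\mathcal J},\mathcal E)$ is left-synchronizing. Let $\psi_u\colon E^\infty\to E^\infty$ be the induced homeomorphism. Then there exists a transducer $T$ with input and output alphabet $E^1$ such that for all $\alpha\in E^\infty$ we have $\alpha[T]\psi_u(\alpha)$.
   Context: Graphs and algebras. $E=(E^0,E^1,r,s)$ is a finite directed graph (multiple edges allowed) with range and source maps $r,s$; no sinks (every vertex emits an edge), no sources (every vertex receives an edge). A path $\mu=\mu_1\cdots\mu_k$ is a sequence of edges with $r(\mu_j)=s(\mu_{j+1})$, of length $|\mu|=k$; vertices are paths of length $0$; $E^*$ is the set of finite paths, $E^\infty$ the space of one-sided infinite paths (product topology). A cycle is a path of length $\ge1$ with equal source and range; it has an exit if the source of one of its edges emits at least two distinct edges. $L_{\mathbb Z}(E)$ is the universal $\mathbb Z$-algebra generated by pairwise orthogonal idempotents $P_v$ ($v\in E^0$) and elements $S_e,S_e^*$ ($e\in E^1$) subject to $S_e^*S_f=0$ for $e\ne f$, $S_e^*S_e=P_{r(e)}$, $P_{s(e)}S_e=S_e=S_eP_{r(e)}$, $S_e^*P_{s(e)}=S_e^*=P_{r(e)}S_e^*$, and $P_v=\sum_{s(e)=v}S_eS_e^*$; it is a unital $*$-algebra. $S_\mu=S_{\mu_1}\cdots S_{\mu_k}$,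 $S_v=P_v$ for $v\in E^0$, $P_\mu=S_\mu S_\mu^*$. $C^*(E)$ is the universal $C^*$-algebra generated by mutually orthogonal projections $p_v$ and partial isometries $s_e$ with $s_e^*s_e=p_{r(e)}$ and $p_v=\sum_{s(e)=v}s_es_e^*$; $s_\mu$, $p_\mu=s_\mu s_\mu^*$ are defined similarly and $\mathcal D_{C^*(E)}$ is the closed linear span of $\{p_\mu:\mu\in E^*\}$. $L_{\mathbb Z}(E)$ embeds in $C^*(E)$ via $S_e\mapsto s_e$, $P_v\mapsto p_v$. Admissible sets and endomorphisms. An admissible set is a finite $\mathcal J\subseteq E^*\times E^*$ such that $s(\mu)=s(\nu)$, $r(\mu)=r(\nu)$, $|\nu|\ge 1$ for all $(\mu,\nu)\in\mathcal J$ and $u_{\mathcal J}=\sum_{(\mu,\nu)\in\mathcal J}S_\mu S_\nu^*$ is unitary in $L_{\mathbb Z}(E)$ (equivalently: distinct pairs have distinct first components and distinct second components, and the $P_\mu$ over first components sum to $1$, as do the $P_\nu$ over second components). Elements of $\mathcal J$ are written $(\mu,e\nu)$ with $e\in E^1$, $\nu\in E^*$ ($\nu=r(e)$ if the second component is a single edge). $\lambda_u$ is the unital $*$-endomorphism of $C^*(E)$ with $\lambda_u(s_e)=us_e$, $\lambda_u(p_v)=p_v$. Coding graph. $E_{\mathcal J}$ has vertex set $\mathcal J$, and exactly one edge $[(\mu_1,e_1\nu_1),(\mu_2,e_2\nu_2)]$ from $(\mu_1,e_1\nu_1)$ to $(\mu_2,e_2\nu_2)$ whenever $S_{\nu_1}^*S_{\mu_2}\neq0$;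 its label is $\mathcal L_{\mathcal J}=S_{\nu_1}^*S_{\mu_2}$, which is of the form $S_\alpha$ ($|\alpha|\geq 1$), $P_v$, or $S_\alpha^*$ ($|\alpha|\ge1$). The degree of the edge is $|\alpha|$, $0$, $-|\alpha|$ respectively. An edge is non-negative if its degree is $\ge0$; a path (in particular a cycle) in $E_{\mathcal J}$ is non-positive if all its edges have degree $\le0$. For a path $\omega$ in $E_{\mathcal J}$ visiting successively the vertices $(\mu_1,e_1\nu_1),\dots,(\mu_k,e_k\nu_k)$, $\mathcal E(\omega)=e_1e_2\cdots e_k\in E^*$. $(E_{\mathcal J},\mathcal E)$ is left-synchronizing if there is $m\in\mathbb N$ (the delay) such that for any two paths $\omega_1,\omega_2$ of length $m$ in $E_{\mathcal J}$, $\mathcal E(\omega_1)=\mathcal E(\omega_2)$ implies $s(\omega_1)=s(\omega_2)$. The homeomorphism $\psi_u$. Under the hypotheses of the claim $\lambda_u$ restricts to an automorphism of $\mathcal D_{C^*(E)}$. Identify $\mathcal D_{C^*(E)}\cong C(E^\infty)$ by sending $p_\mu$ to the indicator function of $\{\gamma\in E^\infty:\mu\text{ is an initial segment of }\gamma\}$. Let $\lambda_u^*$ be the homeomorphism of $E^\infty$ with $\lambda_u(f)=f\circ\lambda_u^*$ for $f\in C(E^\infty)$, and $\psi_u=(\lambda_u^* )^{-1}$. Transducers. A transducer is a tuple $T=(A,B,Q,q_0,\tau)$ with finite input and output alphabets $A,B$, a finite set of states $Q$, an initial state $q_0\in Q$ and a transition function $\tau\colon Q\times A\to Q\times B^*$,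 where $B^*$ is the set of finite words (possibly empty). For $\alpha=\alpha_1\alpha_2\cdots\in A^\infty$ define recursively $(q_i,\beta_i)=\tau(q_{i-1},\alpha_i)$, $i\ge1$; the output is the concatenation $\beta=\beta_1\beta_2\cdots$, and one writes $\alpha[T]\beta$. *)

theory Defs
  imports "HOL-Analysis.Analysis" "HOL-Algebra.Ring" "Graph_Theory.Graph_Theory"
begin

section \<open>Paths\<close>

text \<open>
  The source map of a directed graph is \<open>tail\<close>, its range map is \<open>head\<close>.  A finite path is
  encoded as the pair of its source and its list of edges, so that \<open>(v, [])\<close> is the path of length
  zero at the vertex \<open>v\<close>.
\<close>

type_synonym ('v, 'e) gpath = "'v \<times> 'e list"

definition paths :: "('v, 'e) pre_digraph \<Rightarrow> ('v, 'e) gpath set" where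
  "paths G = {(v, es). \<exists>w. pre_digraph.awalk G v es w}"

definition psrc :: "('v, 'e) gpath \<Rightarrow> 'v" where
  "psrc \<mu> = fst \<mu>"

definition prng :: "('v, 'e) pre_digraph \<Rightarrow> ('v, 'e) gpath \<Rightarrow> 'v" where
  "prng G \<mu> = last (pre_digraph.awalk_verts G (fst \<mu>) (snd \<mu>))"

definition plen :: "('v, 'e) gpath \<Rightarrow> nat" where
  "plen \<mu> = length (snd \<mu>)"

definition inf_paths :: "('v, 'e) pre_digraph \<Rightarrow> (nat \<Rightarrow> 'e) set" where
  "inf_paths G = {\<gamma>. \<forall>i. \<gamma> i \<in> arcs G \<and> head G (\<gamma> i) = tail G (\<gamma> (Suc i))}"

definition inf_path_topology :: "('v, 'e) pre_digraph \<Rightarrow> (nat \<Rightarrow> 'e) topology" where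
  "inf_path_topology G =
     subtopology (product_topology (\<lambda>_. discrete_topology (arcs G)) UNIV) (inf_paths G)"

definition cylinder :: "('v, 'e) pre_digraph \<Rightarrow> ('v, 'e) gpath \<Rightarrow> (nat \<Rightarrow> 'e) set" where
  "cylinder G \<mu> =
     {\<gamma> \<in> inf_paths G. tail G (\<gamma> 0) = psrc \<mu> \<and> (\<forall>i < plen \<mu>. \<gamma> i = snd \<mu> ! i)}"

definition no_sinks :: "('v, 'e) pre_digraph \<Rightarrow> bool" where
  "no_sinks G \<longleftrightarrow> (\<forall>v \<in> verts G. \<exists>e \<in> arcs G. tail G e = v)"

definition no_sources :: "('v, 'e) pre_digraph \<Rightarrow> bool" where
  "no_sources G \<longleftrightarrow> (\<forall>v \<in> verts G. \<exists>e \<in> arcs G. head G e = v)"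

text \<open>
  Cycles are closed walks of positive length; they may revisit vertices, so the relevant library
  notion is \<open>closed_w\<close> and not the stricter \<open>cycle\<close>.
\<close>

definition every_cycle_has_exit :: "('v, 'e) pre_digraph \<Rightarrow> bool" where
  "every_cycle_has_exit G \<longleftrightarrow>
     (\<forall>\<omega>. wf_digraph.closed_w G \<omega> \<longrightarrow>
        (\<exists>e \<in> set \<omega>. \<exists>f \<in> arcs G. \<exists>g \<in> arcs G. f \<noteq> g \<and> tail G f = tail G e \<and> tail G g = tail G e))"


section \<open>Rings with involution and C*-algebras\<close>

record 'a star_ring = "'a ring" +
  adj :: "'a \<Rightarrow> 'a"

record 'a star_alg = "'a star_ring" +
  cscale :: "complex \<Rightarrow> 'a \<Rightarrow> 'a"

record 'a cstar = "'a star_alg" +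
  cnorm :: "'a \<Rightarrow> real"

text \<open>C*-algebras are not assumed to be unital: the field \<open>one\<close> is left unconstrained here.\<close>

locale cstar_algebra = abelian_group A for A :: "('a, 'm) cstar_scheme" (structure) +
  assumes mult_closed: "\<lbrakk>x \<in> carrier A; y \<in> carrier A\<rbrakk> \<Longrightarrow> x \<otimes> y \<in> carrier A"
    and mult_assoc: "\<lbrakk>x \<in> carrier A; y \<in> carrier A; z \<in> carrier A\<rbrakk> \<Longrightarrow> (x \<otimes> y) \<otimes> z = x \<otimes> (y \<otimes> z)"
    and distrib_right: "\<lbrakk>x \<in> carrier A; y \<in> carrier A; z \<in> carrier A\<rbrakk> \<Longrightarrow> (x \<oplus> y) \<otimes> z = x \<otimes> z \<oplus> y \<otimes> z"
    and distrib_left: "\<lbrakk>x \<in> carrier A; y \<in> carrier A; z \<in> carrier A\<rbrakk> \<Longrightarrow> z \<otimes> (x \<oplus> y) = z \<otimes> x \<oplus> z \<otimes> y"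
    and scale_closed: "x \<in> carrier A \<Longrightarrow> cscale A a x \<in> carrier A"
    and scale_add_left: "x \<in> carrier A \<Longrightarrow> cscale A (a + b) x = cscale A a x \<oplus> cscale A b x"
    and scale_add_right: "\<lbrakk>x \<in> carrier A; y \<in> carrier A\<rbrakk> \<Longrightarrow> cscale A a (x \<oplus> y) = cscale A a x \<oplus> cscale A a y"
    and scale_scale: "x \<in> carrier A \<Longrightarrow> cscale A a (cscale A b x) = cscale A (a * b) x"
    and scale_one: "x \<in> carrier A \<Longrightarrow> cscale A 1 x = x"
    and scale_mult_left: "\<lbrakk>x \<in> carrier A; y \<in> carrier A\<rbrakk> \<Longrightarrow> cscale A a x \<otimes> y = cscale A a (x \<otimes> y)"
    and scale_mult_right: "\<lbrakk>x \<in> carrier A; y \<in> carrier A\<rbrakk> \<Longrightarrow> x \<otimes> cscale A a y = cscale A a (x \<otimes> y)"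
    and adj_closed: "x \<in> carrier A \<Longrightarrow> adj A x \<in> carrier A"
    and adj_adj: "x \<in> carrier A \<Longrightarrow> adj A (adj A x) = x"
    and adj_add: "\<lbrakk>x \<in> carrier A; y \<in> carrier A\<rbrakk> \<Longrightarrow> adj A (x \<oplus> y) = adj A x \<oplus> adj A y"
    and adj_mult: "\<lbrakk>x \<in> carrier A; y \<in> carrier A\<rbrakk> \<Longrightarrow> adj A (x \<otimes> y) = adj A y \<otimes> adj A x"
    and adj_scale: "x \<in> carrier A \<Longrightarrow> adj A (cscale A a x) = cscale A (cnj a) (adj A x)"
    and norm_eq_zero: "x \<in> carrier A \<Longrightarrow> cnorm A x = 0 \<longleftrightarrow> x = \<zero>"
    and norm_triangle: "\<lbrakk>x \<in> carrier A; y \<in> carrier A\<rbrakk> \<Longrightarrow> cnorm A (x \<oplus> y) \<le> cnorm A x + cnorm A y"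
    and norm_scale: "x \<in> carrier A \<Longrightarrow> cnorm A (cscale A a x) = cmod a * cnorm A x"
    and norm_mult: "\<lbrakk>x \<in> carrier A; y \<in> carrier A\<rbrakk> \<Longrightarrow> cnorm A (x \<otimes> y) \<le> cnorm A x * cnorm A y"
    and cstar_identity: "x \<in> carrier A \<Longrightarrow> cnorm A (adj A x \<otimes> x) = (cnorm A x)\<^sup>2"
    and norm_complete:
      "\<lbrakk>\<And>n. X n \<in> carrier A; \<And>\<epsilon>. \<epsilon> > 0 \<Longrightarrow> \<exists>N. \<forall>m \<ge> N. \<forall>n \<ge> N. cnorm A (X m \<ominus> X n) < \<epsilon>\<rbrakk>
        \<Longrightarrow> \<exists>x \<in> carrier A. (\<lambda>n. cnorm A (X n \<ominus> x)) \<longlonglongrightarrow> 0"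

definition star_hom ::
    "('a, 'm) star_alg_scheme \<Rightarrow> ('b, 'n) star_alg_scheme \<Rightarrow> ('a \<Rightarrow> 'b) \<Rightarrow> bool" where
  "star_hom A B h \<longleftrightarrow>
     h \<in> carrier A \<rightarrow> carrier B \<and>
     (\<forall>x \<in> carrier A. \<forall>y \<in> carrier A. h (x \<oplus>\<^bsub>A\<^esub> y) = h x \<oplus>\<^bsub>B\<^esub> h y) \<and>
     (\<forall>x \<in> carrier A. \<forall>y \<in> carrier A. h (x \<otimes>\<^bsub>A\<^esub> y) = h x \<otimes>\<^bsub>B\<^esub> h y) \<and>
     (\<forall>x \<in> carrier A. \<forall>a. h (cscale A a x) = cscale B a (h x)) \<and>
     (\<forall>x \<in> carrier A. h (adj A x) = adj B (h x))"

definition star_iso ::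
    "('a, 'm) star_alg_scheme \<Rightarrow> ('b, 'n) star_alg_scheme \<Rightarrow> ('a \<Rightarrow> 'b) \<Rightarrow> bool" where
  "star_iso A B h \<longleftrightarrow> star_hom A B h \<and> bij_betw h (carrier A) (carrier B)"

definition norm_closure :: "('a, 'm) cstar_scheme \<Rightarrow> 'a set \<Rightarrow> 'a set" where
  "norm_closure A X = {x \<in> carrier A. \<forall>\<epsilon> > 0. \<exists>y \<in> X. cnorm A (x \<ominus>\<^bsub>A\<^esub> y) < \<epsilon>}"

inductive_set lin_span :: "('a, 'm) cstar_scheme \<Rightarrow> 'a set \<Rightarrow> 'a set" for A and X where
  lin_span_zero: "\<zero>\<^bsub>A\<^esub> \<in> lin_span A X"
| lin_span_step: "\<lbrakk>x \<in> X; y \<in> lin_span A X\<rbrakk> \<Longrightarrow> cscale A a x \<oplus>\<^bsub>A\<^esub> y \<in> lin_span A X"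

definition closed_star_subalgebra :: "('a, 'm) cstar_scheme \<Rightarrow> 'a set \<Rightarrow> bool" where
  "closed_star_subalgebra A C \<longleftrightarrow>
     C \<subseteq> carrier A \<and> \<zero>\<^bsub>A\<^esub> \<in> C \<and> norm_closure A C = C \<and>
     (\<forall>x \<in> C. \<forall>y \<in> C. x \<oplus>\<^bsub>A\<^esub> y \<in> C \<and> x \<otimes>\<^bsub>A\<^esub> y \<in> C) \<and>
     (\<forall>x \<in> C. adj A x \<in> C \<and> (\<forall>a. cscale A a x \<in> C))"

text \<open>
  The *-algebra of continuous complex functions on a space; functions are made extensional, so that
  equality on the space is equality.
\<close>

definition cont_functions :: "'x topology \<Rightarrow> ('x \<Rightarrow> complex) star_alg" where
  "cont_functions X =
     \<lparr>carrier = {f \<in> extensional (topspace X). continuous_map X euclidean f},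
      mult = (\<lambda>f g. restrict (\<lambda>x. f x * g x) (topspace X)),
      one = restrict (\<lambda>_. 1) (topspace X),
      zero = restrict (\<lambda>_. 0) (topspace X),
      add = (\<lambda>f g. restrict (\<lambda>x. f x + g x) (topspace X)),
      adj = (\<lambda>f. restrict (\<lambda>x. cnj (f x)) (topspace X)),
      cscale = (\<lambda>a f. restrict (\<lambda>x. a * f x) (topspace X))\<rparr>"


section \<open>The Leavitt path ring over the integers\<close>

datatype ('v, 'e) lpa_term =
    Null
  | Vtx 'v
  | Edge 'e
  | Ghost 'e
  | Neg "('v, 'e) lpa_term"
  | Plus "('v, 'e) lpa_term" "('v, 'e) lpa_term"
  | Times "('v, 'e) lpa_term" "('v, 'e) lpa_term"

primrec lpa_star :: "('v, 'e) lpa_term \<Rightarrow> ('v, 'e) lpa_term" where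
  "lpa_star Null = Null"
| "lpa_star (Vtx v) = Vtx v"
| "lpa_star (Edge e) = Ghost e"
| "lpa_star (Ghost e) = Edge e"
| "lpa_star (Neg s) = Neg (lpa_star s)"
| "lpa_star (Plus s t) = Plus (lpa_star s) (lpa_star t)"
| "lpa_star (Times s t) = Times (lpa_star t) (lpa_star s)"

text \<open>
  Terms \<open>s\<close> and \<open>t\<close> are related if they have the same value in the universal (associative, not
  necessarily unital) ring on the generators subject to the defining relations: \<open>lpa_eq G\<close> is the
  least congruence containing the ring axioms and these relations.  Generators that do not come
  from \<open>G\<close> are set to zero, so that all terms may be used.
\<close>

inductive lpa_eq :: "('v, 'e) pre_digraph \<Rightarrow> ('v, 'e) lpa_term \<Rightarrow> ('v, 'e) lpa_term \<Rightarrow> bool"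
  for G where
  refl: "lpa_eq G s s"
| sym: "lpa_eq G s t \<Longrightarrow> lpa_eq G t s"
| trans: "\<lbrakk>lpa_eq G s t; lpa_eq G t u\<rbrakk> \<Longrightarrow> lpa_eq G s u"
| cong_Neg: "lpa_eq G s t \<Longrightarrow> lpa_eq G (Neg s) (Neg t)"
| cong_Plus: "\<lbrakk>lpa_eq G s s'; lpa_eq G t t'\<rbrakk> \<Longrightarrow> lpa_eq G (Plus s t) (Plus s' t')"
| cong_Times: "\<lbrakk>lpa_eq G s s'; lpa_eq G t t'\<rbrakk> \<Longrightarrow> lpa_eq G (Times s t) (Times s' t')"
| Plus_assoc: "lpa_eq G (Plus (Plus s t) u) (Plus s (Plus t u))"
| Plus_comm: "lpa_eq G (Plus s t) (Plus t s)"
| Plus_Null: "lpa_eq G (Plus Null s) s"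
| Plus_Neg: "lpa_eq G (Plus (Neg s) s) Null"
| Times_assoc: "lpa_eq G (Times (Times s t) u) (Times s (Times t u))"
| distrib_right: "lpa_eq G (Times (Plus s t) u) (Plus (Times s u) (Times t u))"
| distrib_left: "lpa_eq G (Times u (Plus s t)) (Plus (Times u s) (Times u t))"
| Vtx_idem: "v \<in> verts G \<Longrightarrow> lpa_eq G (Times (Vtx v) (Vtx v)) (Vtx v)"
| Vtx_orth: "\<lbrakk>v \<in> verts G; w \<in> verts G; v \<noteq> w\<rbrakk> \<Longrightarrow> lpa_eq G (Times (Vtx v) (Vtx w)) Null"
| Ghost_Edge_orth: "\<lbrakk>e \<in> arcs G; f \<in> arcs G; e \<noteq> f\<rbrakk> \<Longrightarrow> lpa_eq G (Times (Ghost e) (Edge f)) Null"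
| Ghost_Edge: "e \<in> arcs G \<Longrightarrow> lpa_eq G (Times (Ghost e) (Edge e)) (Vtx (head G e))"
| Vtx_Edge: "e \<in> arcs G \<Longrightarrow> lpa_eq G (Times (Vtx (tail G e)) (Edge e)) (Edge e)"
| Edge_Vtx: "e \<in> arcs G \<Longrightarrow> lpa_eq G (Times (Edge e) (Vtx (head G e))) (Edge e)"
| Ghost_Vtx: "e \<in> arcs G \<Longrightarrow> lpa_eq G (Times (Ghost e) (Vtx (tail G e))) (Ghost e)"
| Vtx_Ghost: "e \<in> arcs G \<Longrightarrow> lpa_eq G (Times (Vtx (head G e)) (Ghost e)) (Ghost e)"
| Vtx_sum: "\<lbrakk>v \<in> verts G; distinct es; set es = {e \<in> arcs G. tail G e = v}\<rbrakk>
    \<Longrightarrow> lpa_eq G (Vtx v) (foldr (\<lambda>e. Plus (Times (Edge e) (Ghost e))) es Null)"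
| foreign_Vtx: "v \<notin> verts G \<Longrightarrow> lpa_eq G (Vtx v) Null"
| foreign_Edge: "e \<notin> arcs G \<Longrightarrow> lpa_eq G (Edge e) Null"
| foreign_Ghost: "e \<notin> arcs G \<Longrightarrow> lpa_eq G (Ghost e) Null"

definition lpa_class :: "('v, 'e) pre_digraph \<Rightarrow> ('v, 'e) lpa_term \<Rightarrow> ('v, 'e) lpa_term set" where
  "lpa_class G t = {s. lpa_eq G t s}"

text \<open>The unit of the Leavitt path ring is the sum of all vertex idempotents.\<close>

definition leavitt :: "('v, 'e) pre_digraph \<Rightarrow> ('v, 'e) lpa_term set star_ring" where
  "leavitt G =
     \<lparr>carrier = range (lpa_class G),
      mult = (\<lambda>X Y. \<Union>s \<in> X. \<Union>t \<in> Y. lpa_class G (Times s t)),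
      one = (\<Union>vs \<in> {vs. distinct vs \<and> set vs = verts G}.
               lpa_class G (foldr (\<lambda>v. Plus (Vtx v)) vs Null)),
      zero = lpa_class G Null,
      add = (\<lambda>X Y. \<Union>s \<in> X. \<Union>t \<in> Y. lpa_class G (Plus s t)),
      adj = (\<lambda>X. \<Union>s \<in> X. lpa_class G (lpa_star s))\<rparr>"

definition lpa_P :: "('v, 'e) pre_digraph \<Rightarrow> 'v \<Rightarrow> ('v, 'e) lpa_term set" where
  "lpa_P G v = lpa_class G (Vtx v)"

definition lpa_S :: "('v, 'e) pre_digraph \<Rightarrow> 'e \<Rightarrow> ('v, 'e) lpa_term set" where
  "lpa_S G e = lpa_class G (Edge e)"


section \<open>Elements associated with paths, admissible sets\<close>

text \<open>
  The element of a path and the element \<open>u\<^sub>J\<close>, for a family \<open>(p, s)\<close> in an arbitrary ring with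
  involution \<open>R\<close>; used for the generators of both the Leavitt path ring and the graph C*-algebra.
\<close>

fun path_elt :: "('a, 'm) ring_scheme \<Rightarrow> ('v \<Rightarrow> 'a) \<Rightarrow> ('e \<Rightarrow> 'a) \<Rightarrow> 'v \<Rightarrow> 'e list \<Rightarrow> 'a" where
  "path_elt R p s v [] = p v"
| "path_elt R p s v [e] = s e"
| "path_elt R p s v (e # f # es) = s e \<otimes>\<^bsub>R\<^esub> path_elt R p s v (f # es)"

definition S_path :: "('a, 'm) ring_scheme \<Rightarrow> ('v \<Rightarrow> 'a) \<Rightarrow> ('e \<Rightarrow> 'a) \<Rightarrow> ('v, 'e) gpath \<Rightarrow> 'a" where
  "S_path R p s \<mu> = path_elt R p s (fst \<mu>) (snd \<mu>)"

definition u_elt ::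
    "('a, 'm) star_ring_scheme \<Rightarrow> ('v \<Rightarrow> 'a) \<Rightarrow> ('e \<Rightarrow> 'a) \<Rightarrow> (('v, 'e) gpath \<times> ('v, 'e) gpath) set \<Rightarrow> 'a" where
  "u_elt R p s J = (\<Oplus>\<^bsub>R\<^esub>x\<in>J. S_path R p s (fst x) \<otimes>\<^bsub>R\<^esub> adj R (S_path R p s (snd x)))"

definition unitary_elt :: "('a, 'm) star_ring_scheme \<Rightarrow> 'a \<Rightarrow> bool" where
  "unitary_elt R u \<longleftrightarrow>
     u \<in> carrier R \<and> u \<otimes>\<^bsub>R\<^esub> adj R u = \<one>\<^bsub>R\<^esub> \<and> adj R u \<otimes>\<^bsub>R\<^esub> u = \<one>\<^bsub>R\<^esub>"

abbreviation lpa_path :: "('v, 'e) pre_digraph \<Rightarrow> ('v, 'e) gpath \<Rightarrow> ('v, 'e) lpa_term set" where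
  "lpa_path G \<equiv> S_path (leavitt G) (lpa_P G) (lpa_S G)"

definition admissible :: "('v, 'e) pre_digraph \<Rightarrow> (('v, 'e) gpath \<times> ('v, 'e) gpath) set \<Rightarrow> bool" where
  "admissible G J \<longleftrightarrow>
     finite J \<and> J \<subseteq> paths G \<times> paths G \<and>
     (\<forall>(\<mu>, \<nu>) \<in> J. psrc \<mu> = psrc \<nu> \<and> prng G \<mu> = prng G \<nu> \<and> plen \<nu> \<ge> 1) \<and>
     unitary_elt (leavitt G) (u_elt (leavitt G) (lpa_P G) (lpa_S G) J)"


section \<open>The coding graph\<close>

text \<open>Writing a pair in \<open>J\<close> as \<open>(\<mu>, e\<nu>)\<close>, the following are \<open>e\<close> and \<open>\<nu>\<close>.\<close>

definition first_edge :: "('v, 'e) gpath \<times> ('v, 'e) gpath \<Rightarrow> 'e" where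
  "first_edge x = hd (snd (snd x))"

definition rest_path :: "('v, 'e) pre_digraph \<Rightarrow> ('v, 'e) gpath \<times> ('v, 'e) gpath \<Rightarrow> ('v, 'e) gpath" where
  "rest_path G x = (head G (first_edge x), tl (snd (snd x)))"

text \<open>There is at most one edge between two vertices, so an edge is given by its end points.\<close>

type_synonym ('v, 'e) jpair = "('v, 'e) gpath \<times> ('v, 'e) gpath"
type_synonym ('v, 'e) jedge = "('v, 'e) jpair \<times> ('v, 'e) jpair"

definition edge_label :: "('v, 'e) pre_digraph \<Rightarrow> ('v, 'e) jedge \<Rightarrow> ('v, 'e) lpa_term set" where
  "edge_label G a =
     adj (leavitt G) (lpa_path G (rest_path G (fst a))) \<otimes>\<^bsub>leavitt G\<^esub> lpa_path G (fst (snd a))"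

definition coding_graph ::
    "('v, 'e) pre_digraph \<Rightarrow> ('v, 'e) jpair set \<Rightarrow> (('v, 'e) jpair, ('v, 'e) jedge) pre_digraph" where
  "coding_graph G J =
     \<lparr>verts = J, arcs = {a \<in> J \<times> J. edge_label G a \<noteq> \<zero>\<^bsub>leavitt G\<^esub>}, tail = fst, head = snd\<rparr>"

definition edge_degree :: "('v, 'e) pre_digraph \<Rightarrow> ('v, 'e) jedge \<Rightarrow> int \<Rightarrow> bool" where
  "edge_degree G a d \<longleftrightarrow>
     (\<exists>\<alpha> \<in> paths G. plen \<alpha> \<ge> 1 \<and> edge_label G a = lpa_path G \<alpha> \<and> d = int (plen \<alpha>)) \<or>
     (\<exists>v \<in> verts G. edge_label G a = lpa_P G v \<and> d = 0) \<or>
     (\<exists>\<alpha> \<in> paths G. plen \<alpha> \<ge> 1 \<and> edge_label G a = adj (leavitt G) (lpa_path G \<alpha>) \<and> d = - int (plen \<alpha>))"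

definition nonneg_edge :: "('v, 'e) pre_digraph \<Rightarrow> ('v, 'e) jedge \<Rightarrow> bool" where
  "nonneg_edge G a \<longleftrightarrow> (\<exists>d \<ge> 0. edge_degree G a d)"

definition nonpos_path :: "('v, 'e) pre_digraph \<Rightarrow> ('v, 'e) jedge list \<Rightarrow> bool" where
  "nonpos_path G \<omega> \<longleftrightarrow> (\<forall>a \<in> set \<omega>. \<exists>d \<le> 0. edge_degree G a d)"

text \<open>A path of length \<open>m\<close> visits \<open>m + 1\<close> vertices and hence codes a word of length \<open>m + 1\<close>.\<close>

definition code_word ::
    "('v, 'e) pre_digraph \<Rightarrow> ('v, 'e) jpair set \<Rightarrow> (('v, 'e) jpair, ('v, 'e) jedge) gpath \<Rightarrow> 'e list" where
  "code_word G J \<omega> =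
     map first_edge (pre_digraph.awalk_verts (coding_graph G J) (fst \<omega>) (snd \<omega>))"

definition left_synchronizing :: "('v, 'e) pre_digraph \<Rightarrow> ('v, 'e) jpair set \<Rightarrow> bool" where
  "left_synchronizing G J \<longleftrightarrow>
     (\<exists>m. \<forall>\<omega>1 \<in> paths (coding_graph G J). \<forall>\<omega>2 \<in> paths (coding_graph G J).
        plen \<omega>1 = m \<longrightarrow> plen \<omega>2 = m \<longrightarrow> code_word G J \<omega>1 = code_word G J \<omega>2 \<longrightarrow> psrc \<omega>1 = psrc \<omega>2)"


section \<open>The graph C*-algebra and the homeomorphism of the infinite path space\<close>

definition ck_family ::
    "('v, 'e) pre_digraph \<Rightarrow> ('a, 'm) star_ring_scheme \<Rightarrow> ('v \<Rightarrow> 'a) \<Rightarrow> ('e \<Rightarrow> 'a) \<Rightarrow> bool" where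
  "ck_family G B p s \<longleftrightarrow>
     (\<forall>v \<in> verts G. p v \<in> carrier B \<and> p v \<otimes>\<^bsub>B\<^esub> p v = p v \<and> adj B (p v) = p v) \<and>
     (\<forall>v \<in> verts G. \<forall>w \<in> verts G. v \<noteq> w \<longrightarrow> p v \<otimes>\<^bsub>B\<^esub> p w = \<zero>\<^bsub>B\<^esub>) \<and>
     (\<forall>e \<in> arcs G. s e \<in> carrier B \<and> s e \<otimes>\<^bsub>B\<^esub> adj B (s e) \<otimes>\<^bsub>B\<^esub> s e = s e) \<and>
     (\<forall>e \<in> arcs G. adj B (s e) \<otimes>\<^bsub>B\<^esub> s e = p (head G e)) \<and>
     (\<forall>v \<in> verts G. p v = (\<Oplus>\<^bsub>B\<^esub>e\<in>{e \<in> arcs G. tail G e = v}. s e \<otimes>\<^bsub>B\<^esub> adj B (s e)))"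

text \<open>
  \<open>graph_cstar G A p s\<close>: the C*-algebra \<open>A\<close> with the family \<open>(p, s)\<close> is the universal C*-algebra of
  the graph.  The universal property is tested on C*-algebras whose underlying set is a subset of
  the type \<open>real\<close>.  For finite \<open>G\<close> this is no restriction: a Cuntz-Krieger family in any C*-algebra
  generates a separable C*-subalgebra, which has at most the cardinality of the continuum.
  The remaining condition fixes the field \<open>one\<close> to be the unit, which exists since \<open>G\<close> is finite.
\<close>

definition graph_cstar ::
    "('v, 'e) pre_digraph \<Rightarrow> 'a cstar \<Rightarrow> ('v \<Rightarrow> 'a) \<Rightarrow> ('e \<Rightarrow> 'a) \<Rightarrow> bool" where
  "graph_cstar G A p s \<longleftrightarrow>
     cstar_algebra A \<and> ck_family G A p s \<and>
     \<one>\<^bsub>A\<^esub> \<in> carrier A \<and> (\<forall>x \<in> carrier A. \<one>\<^bsub>A\<^esub> \<otimes>\<^bsub>A\<^esub> x = x \<and> x \<otimes>\<^bsub>A\<^esub> \<one>\<^bsub>A\<^esub> = x) \<and>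
     (\<forall>C. closed_star_subalgebra A C \<and> p ` verts G \<subseteq> C \<and> s ` arcs G \<subseteq> C \<longrightarrow> C = carrier A) \<and>
     (\<forall>(B :: real cstar) q t. cstar_algebra B \<and> ck_family G B q t \<longrightarrow>
        (\<exists>h. star_hom A B h \<and> (\<forall>v \<in> verts G. h (p v) = q v) \<and> (\<forall>e \<in> arcs G. h (s e) = t e)))"

definition proj_path :: "('a, 'm) star_ring_scheme \<Rightarrow> ('v \<Rightarrow> 'a) \<Rightarrow> ('e \<Rightarrow> 'a) \<Rightarrow> ('v, 'e) gpath \<Rightarrow> 'a" where
  "proj_path A p s \<mu> = S_path A p s \<mu> \<otimes>\<^bsub>A\<^esub> adj A (S_path A p s \<mu>)"

definition diagonal ::
    "('v, 'e) pre_digraph \<Rightarrow> 'a cstar \<Rightarrow> ('v \<Rightarrow> 'a) \<Rightarrow> ('e \<Rightarrow> 'a) \<Rightarrow> 'a cstar" where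
  "diagonal G A p s = A\<lparr>carrier := norm_closure A (lin_span A (proj_path A p s ` paths G))\<rparr>"

definition diagonal_identification ::
    "('v, 'e) pre_digraph \<Rightarrow> 'a cstar \<Rightarrow> ('v \<Rightarrow> 'a) \<Rightarrow> ('e \<Rightarrow> 'a) \<Rightarrow> ('a \<Rightarrow> (nat \<Rightarrow> 'e) \<Rightarrow> complex) \<Rightarrow> bool" where
  "diagonal_identification G A p s \<Phi> \<longleftrightarrow>
     star_iso (diagonal G A p s) (cont_functions (inf_path_topology G)) \<Phi> \<and>
     (\<forall>\<mu> \<in> paths G. \<Phi> (proj_path A p s \<mu>) = restrict (indicator (cylinder G \<mu>)) (inf_paths G))"

definition cuntz_endomorphism ::
    "('v, 'e) pre_digraph \<Rightarrow> 'a cstar \<Rightarrow> ('v \<Rightarrow> 'a) \<Rightarrow> ('e \<Rightarrow> 'a) \<Rightarrow> 'a \<Rightarrow> ('a \<Rightarrow> 'a) \<Rightarrow> bool" where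
  "cuntz_endomorphism G A p s u l \<longleftrightarrow>
     star_hom A A l \<and> l \<one>\<^bsub>A\<^esub> = \<one>\<^bsub>A\<^esub> \<and>
     (\<forall>e \<in> arcs G. l (s e) = u \<otimes>\<^bsub>A\<^esub> s e) \<and> (\<forall>v \<in> verts G. l (p v) = p v)"

text \<open>
  \<open>\<psi>\<close> is the inverse of the homeomorphism \<open>k\<close> for which the endomorphism \<open>l\<close> becomes \<open>f \<mapsto> f \<circ> k\<close>
  after identifying the diagonal with the continuous functions by means of \<open>\<Phi>\<close>.
\<close>

definition induced_homeomorphism ::
    "('v, 'e) pre_digraph \<Rightarrow> 'a cstar \<Rightarrow> ('v \<Rightarrow> 'a) \<Rightarrow> ('e \<Rightarrow> 'a) \<Rightarrow> ('a \<Rightarrow> (nat \<Rightarrow> 'e) \<Rightarrow> complex)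
      \<Rightarrow> ('a \<Rightarrow> 'a) \<Rightarrow> ((nat \<Rightarrow> 'e) \<Rightarrow> (nat \<Rightarrow> 'e)) \<Rightarrow> bool" where
  "induced_homeomorphism G A p s \<Phi> l \<psi> \<longleftrightarrow>
     (\<exists>k. homeomorphic_maps (inf_path_topology G) (inf_path_topology G) k \<psi> \<and>
          (\<forall>d \<in> carrier (diagonal G A p s).
             l d \<in> carrier (diagonal G A p s) \<and> \<Phi> (l d) = restrict (\<Phi> d \<circ> k) (inf_paths G)))"


section \<open>Transducers\<close>

record ('a, 'b, 'q) transducer =
  in_alph :: "'a set"
  out_alph :: "'b set"
  states :: "'q set"
  init :: 'q
  step :: "'q \<Rightarrow> 'a \<Rightarrow> 'q \<times> 'b list"

definition is_transducer :: "('a, 'b, 'q) transducer \<Rightarrow> bool" where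
  "is_transducer T \<longleftrightarrow>
     finite (in_alph T) \<and> finite (out_alph T) \<and> finite (states T) \<and> init T \<in> states T \<and>
     (\<forall>q \<in> states T. \<forall>a \<in> in_alph T. step T q a \<in> states T \<times> lists (out_alph T))"

text \<open>With letters indexed from 0, \<open>run T \<alpha> i\<close> is \<open>q\<^sub>i\<close>, and \<open>out_word T \<alpha> i\<close> is \<open>\<beta>\<close> with index \<open>i + 1\<close>.\<close>

primrec run :: "('a, 'b, 'q) transducer \<Rightarrow> (nat \<Rightarrow> 'a) \<Rightarrow> nat \<Rightarrow> 'q" where
  "run T \<alpha> 0 = init T"
| "run T \<alpha> (Suc i) = fst (step T (run T \<alpha> i) (\<alpha> i))"

definition out_word :: "('a, 'b, 'q) transducer \<Rightarrow> (nat \<Rightarrow> 'a) \<Rightarrow> nat \<Rightarrow> 'b list" where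
  "out_word T \<alpha> i = snd (step T (run T \<alpha> i) (\<alpha> i))"

text \<open>
  The infinite sequence \<open>\<beta>\<close> is the concatenation of the output words: all finite concatenations are
  initial segments of \<open>\<beta>\<close>, and their lengths are unbounded.
\<close>

definition transduces :: "('a, 'b, 'q) transducer \<Rightarrow> (nat \<Rightarrow> 'a) \<Rightarrow> (nat \<Rightarrow> 'b) \<Rightarrow> bool" where
  "transduces T \<alpha> \<beta> \<longleftrightarrow>
     (\<forall>n. let w = concat (map (out_word T \<alpha>) [0..<n]) in w = map \<beta> [0..<length w]) \<and>
     (\<forall>k. \<exists>n. length (concat (map (out_word T \<alpha>) [0..<n])) \<ge> k)"

end

theory Submission
  imports Defs "HOL-Library.Omega_Words_Fun"
begin

text \<open>
  If \<open>(\<mu>, e\<nu>) \<in> J\<close> then \<open>u s\<^sub>e s\<^sub>\<nu> = s\<^sub>\<mu>\<close>, and from this \<open>\<psi>(\<gamma>) = \<nu>\<eta>\<close> implies \<open>\<psi>(e\<gamma>) = \<mu>\<eta>\<close>.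
  Hence an infinite path \<open>\<alpha>\<close> determines vertices \<open>x\<^sub>n = (\<mu>\<^sub>n, \<alpha>\<^sub>n\<nu>\<^sub>n)\<close> forming a path in the coding graph,
  and since all edges are non-negative, \<open>\<mu>\<^sub>n\<^sub>+\<^sub>1 = \<nu>\<^sub>n \<beta>\<^sub>n\<close> and \<open>\<psi>(\<alpha>) = \<mu>\<^sub>0 \<beta>\<^sub>0 \<beta>\<^sub>1 \<dots>\<close>, where
  infinitely many \<open>\<beta>\<^sub>n\<close> are nonempty because there are no non-positive cycles.  By left
  synchronization \<open>x\<^sub>n\<close> is determined by \<open>\<alpha>\<^sub>n \<dots> \<alpha>\<^sub>n\<^sub>+\<^sub>m\<close>, so that a finite memory suffices to
  produce the words \<open>\<beta>\<^sub>n\<close>.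

  In a Cuntz-Krieger family the range projections of distinct edges are orthogonal because
  projections whose sum is a projection are orthogonal; in a C*-algebra given only by its axioms
  this is derived from the extremality of the unit in the unit ball.
\<close>

text \<open>Admissibility and edge degrees are statements about the Leavitt ring, whereas \<psi> is
  defined through the C*-algebra. The bridge is combinatorial: Leavitt terms act on functions of
  infinite paths, and there the unitarity of \<open>u\<close> says that the second components of
  \<open>J\<close> cut the path space into disjoint cylinders. So these components are pairwise
  incomparable as initial segments, and the Cuntz-Krieger relations then give the rule for
  \<open>u\<close> in the C*-algebra.

  The analytic obstacle is that the axioms provide a norm but no order. Suppose projections
  \<open>g i\<close> satisfy \<open>q (\<Sum> g i) q = 0\<close>. Then
  \<open>d = q g\<^sub>i q\<close> is minus the compression of the remaining summands, so both
  \<open>N q + d\<close> and \<open>N q - d\<close> have norm at most \<open>N\<close> for some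
  \<open>N\<close>. A weak law of large numbers, carried out inside the algebra, forces
  \<open>d = 0\<close>.

  The word \<beta> emitted at position n depends on two consecutive vertices of the coding walk,
  hence on \<open>m + 2\<close> letters: the \<open>m + 1\<close> remembered ones and the one being
  read.\<close>

no_notation vwalk_join (infixr \<open>\<oplus>\<close> 65)

section \<open>Projections in a unital C*-algebra\<close>

text \<open>Expectation of \<open>c\<close> at the number of heads in \<open>n\<close> fair coin tosses.\<close>

primrec coin_mean :: "nat \<Rightarrow> (nat \<Rightarrow> real) \<Rightarrow> real" where
  "coin_mean 0 c = c 0"
| "coin_mean (Suc n) c = (coin_mean n (c \<circ> Suc) + coin_mean n c) / 2"

lemma coin_mean_mono: "(\<And>k. c k \<le> c' k) \<Longrightarrow> coin_mean n c \<le> coin_mean n c'"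
proof (induction n arbitrary: c c')
  case (Suc n)
  have "coin_mean n (c \<circ> Suc) \<le> coin_mean n (c' \<circ> Suc)" "coin_mean n c \<le> coin_mean n c'"
    by (auto intro!: Suc)
  then show ?case by simp
qed simp

lemma coin_mean_affine: "coin_mean n (\<lambda>k. x + y * c k) = x + y * coin_mean n c"
proof (induction n arbitrary: c)
  case (Suc n)
  have "coin_mean n ((\<lambda>k. x + y * c k) \<circ> Suc) = x + y * coin_mean n (c \<circ> Suc)"
    using Suc[of "c \<circ> Suc"] by (simp add: o_def)
  then show ?case using Suc[of c] by (simp add: algebra_simps add_divide_distrib)
qed simp

text \<open>The centre \<open>y\<close> stays arbitrary because an additional head shifts it to
  \<open>y - 1\<close>, so the induction needs both centres.\<close>

lemma coin_variance: "coin_mean n (\<lambda>k. (real k - y)\<^sup>2) = n / 4 + (n / 2 - y)\<^sup>2"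
proof (induction n arbitrary: y)
  case (Suc n)
  have "(\<lambda>k. (real k - y)\<^sup>2) \<circ> Suc = (\<lambda>k. (real k - (y - 1))\<^sup>2)"
    by (auto simp: o_def algebra_simps)
  then show ?case using Suc[of y] Suc[of "y - 1"]
    by (simp add: power2_eq_square field_simps)
qed simp

text \<open>From \<open>(t - \<epsilon>)\<^sup>2 \<ge> 0\<close> one gets
  \<open>t \<le> \<epsilon>/2 + t\<^sup>2/(2\<epsilon>)\<close>, and the squared deviation has mean
  \<open>1/n\<close>. This replaces Cauchy-Schwarz by a bound that is affine in the square, to which
  the variance formula applies directly.\<close>

lemma coin_abs_deviation:
  assumes "n > 0" "\<epsilon> > 0"
  shows "coin_mean n (\<lambda>k. \<bar>2 * real k / n - 1\<bar>) \<le> \<epsilon> / 2 + 1 / (2 * \<epsilon> * n)"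
proof -
  have "\<bar>2 * real k / n - 1\<bar> \<le> \<epsilon> / 2 + 2 / (\<epsilon> * n\<^sup>2) * (real k - n / 2)\<^sup>2" for k
  proof -
    define t where "t = \<bar>2 * real k / n - 1\<bar>"
    have "0 \<le> (t - \<epsilon>)\<^sup>2" by simp
    then have "t * (2 * \<epsilon>) \<le> \<epsilon>\<^sup>2 + t\<^sup>2" by (simp add: power2_eq_square algebra_simps)
    then have "t \<le> (\<epsilon>\<^sup>2 + t\<^sup>2) / (2 * \<epsilon>)"
      using assms(2) by (subst pos_le_divide_eq) auto
    also have "\<dots> = \<epsilon> / 2 + t\<^sup>2 / (2 * \<epsilon>)" using assms(2) by (simp add: field_simps power2_eq_square)
    also have "t\<^sup>2 = (2 * real k / n - 1)\<^sup>2" by (simp add: t_def)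
    also have "(2 * real k / n - 1)\<^sup>2 = 4 / n\<^sup>2 * (real k - n / 2)\<^sup>2"
      using assms(1) by (simp add: power2_eq_square field_simps)
    finally show ?thesis using assms(2) by (simp add: t_def)
  qed
  then have "coin_mean n (\<lambda>k. \<bar>2 * real k / n - 1\<bar>)
    \<le> coin_mean n (\<lambda>k. \<epsilon> / 2 + 2 / (\<epsilon> * n\<^sup>2) * (real k - n / 2)\<^sup>2)"
    by (rule coin_mean_mono)
  also have "\<dots> = \<epsilon> / 2 + 2 / (\<epsilon> * n\<^sup>2) * (n / 4)"
    by (subst coin_mean_affine) (simp add: coin_variance)
  also have "\<dots> = \<epsilon> / 2 + 1 / (2 * \<epsilon> * n)"
    using assms by (simp add: power2_eq_square field_simps)
  finally show ?thesis .
qed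

section \<open>Unital C*-algebras and coin tossing in a corner\<close>

locale unital_cstar_algebra = cstar_algebra +
  assumes one_in_carrier: "\<one> \<in> carrier A"
    and one_left: "x \<in> carrier A \<Longrightarrow> \<one> \<otimes> x = x"
    and one_right: "x \<in> carrier A \<Longrightarrow> x \<otimes> \<one> = x"
begin

sublocale ring A
  by (unfold_locales)
    (auto simp: one_in_carrier one_left one_right mult_closed mult_assoc distrib_right distrib_left
      a_assoc a_comm)

lemma scale_zero: "x \<in> carrier A \<Longrightarrow> cscale A 0 x = \<zero>"
  by (metis add.r_cancel_one' add.right_cancel add_0 scale_add_left scale_closed scale_one)

lemma scale_minus_one: "x \<in> carrier A \<Longrightarrow> cscale A (-1) x = \<ominus> x"
  using scale_add_left[of x "-1" 1] by (simp add: scale_zero scale_one minus_equality scale_closed)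

lemma scale_minus: "x \<in> carrier A \<Longrightarrow> cscale A (- a) x = \<ominus> cscale A a x"
  using scale_scale[of x "-1" a] by (simp add: scale_minus_one scale_closed)

lemma scale_zero_right: "cscale A a \<zero> = \<zero>"
  using scale_scale[of \<zero> a 0] by (simp add: scale_zero)

lemma scale_cancel: "\<lbrakk>x \<in> carrier A; a \<noteq> 0; cscale A a x = \<zero>\<rbrakk> \<Longrightarrow> x = \<zero>"
  using scale_scale[of x "inverse a" a] by (simp add: scale_one scale_zero_right)

lemma norm_zero: "cnorm A \<zero> = 0"
  by (simp add: norm_eq_zero)

lemma norm_neg: "x \<in> carrier A \<Longrightarrow> cnorm A (\<ominus> x) = cnorm A x"
  using norm_scale[of x "-1"] by (simp add: scale_minus_one)

lemma norm_nonneg: "x \<in> carrier A \<Longrightarrow> 0 \<le> cnorm A x"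
  using norm_triangle[of x "\<ominus> x"] by (simp add: norm_neg r_neg norm_zero)

lemma adj_neg: "x \<in> carrier A \<Longrightarrow> adj A (\<ominus> x) = \<ominus> adj A x"
  using adj_scale[of x "-1"] by (simp add: scale_minus_one adj_closed)

lemma adj_one: "adj A \<one> = \<one>"
  by (metis adj_adj adj_closed adj_mult l_one one_closed r_one)

text \<open>\<open>n\<close> tosses of a coin, each outcome contributing a factor \<open>a\<close> or \<open>b\<close>.\<close>

primrec coin_sum :: "'a \<Rightarrow> 'a \<Rightarrow> 'a \<Rightarrow> nat \<Rightarrow> (nat \<Rightarrow> real) \<Rightarrow> 'a" where
  "coin_sum q a b 0 c = cscale A (c 0) q"
| "coin_sum q a b (Suc n) c = a \<otimes> coin_sum q a b n (c \<circ> Suc) \<oplus> b \<otimes> coin_sum q a b n c"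

lemma coin_sum_closed:
  "\<lbrakk>q \<in> carrier A; a \<in> carrier A; b \<in> carrier A\<rbrakk> \<Longrightarrow> coin_sum q a b n c \<in> carrier A"
  by (induction n arbitrary: c) (auto simp: scale_closed)

text \<open>The norm bound 1/2 on each factor takes the place of the probability of a side of the
  coin, so the triangle inequality turns the sum into an expectation.\<close>

lemma norm_coin_sum:
  assumes "q \<in> carrier A" "a \<in> carrier A" "b \<in> carrier A"
    and "cnorm A q \<le> 1" "cnorm A a \<le> 1 / 2" "cnorm A b \<le> 1 / 2"
  shows "cnorm A (coin_sum q a b n c) \<le> coin_mean n (\<lambda>k. \<bar>c k\<bar>)"
proof (induction n arbitrary: c)
  case 0
  then show ?case using assms norm_nonneg[OF assms(1)]
    by (simp add: norm_scale mult_left_le)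
next
  case (Suc n)
  let ?V = "coin_sum q a b n"
  have V: "?V c \<in> carrier A" for c by (simp add: assms coin_sum_closed)
  have half: "cnorm A (x \<otimes> ?V c) \<le> coin_mean n (\<lambda>k. \<bar>c k\<bar>) / 2"
    if "x \<in> carrier A" "cnorm A x \<le> 1 / 2" for x c
  proof -
    have "cnorm A (x \<otimes> ?V c) \<le> cnorm A x * cnorm A (?V c)" using that V by (simp add: norm_mult)
    also have "\<dots> \<le> 1 / 2 * coin_mean n (\<lambda>k. \<bar>c k\<bar>)"
      by (intro mult_mono that Suc norm_nonneg V) auto
    finally show ?thesis by simp
  qed
  have "cnorm A (coin_sum q a b (Suc n) c) \<le> cnorm A (a \<otimes> ?V (c \<circ> Suc)) + cnorm A (b \<otimes> ?V c)"
    using V assms by (simp add: norm_triangle)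
  also have "\<dots> \<le> coin_mean (Suc n) (\<lambda>k. \<bar>c k\<bar>)"
    using half[OF assms(2,5), of "c \<circ> Suc"] half[OF assms(3,6), of c] by (simp add: o_def)
  finally show ?case .
qed

text \<open>Since \<open>a + b\<close> is the unit \<open>q\<close> of the corner, tosses that do
  not influence the statistic sum up to \<open>q\<close>. The constant part leaves
  \<open>x q\<close>, and each of the \<open>n\<close> tosses contributes \<open>y a\<close> through
  its own outcome.\<close>

lemma coin_sum_affine:
  assumes "q \<in> carrier A" "a \<in> carrier A" "b \<in> carrier A"
    and "a \<oplus> b = q" "q \<otimes> a = a" "a \<otimes> q = a" "b \<otimes> q = b"
  shows "coin_sum q a b n (\<lambda>k. x + y * real k) = cscale A x q \<oplus> cscale A (real n * y) a"
proof (induction n arbitrary: x)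
  case 0
  then show ?case by (simp add: scale_zero assms scale_closed)
next
  case (Suc n)
  have [simp]: "(\<lambda>k. x + y * real k) \<circ> Suc = (\<lambda>k. (x + y) + y * real k)"
    by (auto simp: algebra_simps)
  let ?z = "complex_of_real (real n * y)"
  have c: "cscale A z v \<in> carrier A" if "v \<in> {q, a, b, a \<otimes> a, b \<otimes> a}" for z v
    using that assms by (auto intro!: scale_closed)
  have "coin_sum q a b (Suc n) (\<lambda>k. x + y * real k)
    = a \<otimes> (cscale A (x + y) q \<oplus> cscale A ?z a) \<oplus> b \<otimes> (cscale A x q \<oplus> cscale A ?z a)"
    using Suc by simp
  also have "\<dots> = (cscale A (x + y) a \<oplus> cscale A ?z (a \<otimes> a)) \<oplus> (cscale A x b \<oplus> cscale A ?z (b \<otimes> a))"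
    using assms c by (simp add: r_distr scale_mult_right)
  also have "\<dots> = (cscale A x a \<oplus> cscale A x b)
      \<oplus> (cscale A y a \<oplus> (cscale A ?z (a \<otimes> a) \<oplus> cscale A ?z (b \<otimes> a)))"
    using assms c by (simp add: scale_add_left a_ac)
  also have "cscale A x a \<oplus> cscale A x b = cscale A x q"
    using assms by (simp flip: scale_add_right)
  also have "cscale A ?z (a \<otimes> a) \<oplus> cscale A ?z (b \<otimes> a) = cscale A ?z a"
    using assms by (simp flip: scale_add_right l_distr)
  also have "cscale A y a \<oplus> cscale A ?z a = cscale A (real (Suc n) * y) a"
    using assms by (simp flip: scale_add_left add: algebra_simps)
  finally show ?case .
qed

text \<open>
  With \<open>a, b = (N q \<plusminus> d) / (2 N)\<close>
  we have \<open>a + b = q\<close> and \<open>\<parallel>a\<parallel>, \<parallel>b\<parallel> \<le> 1/2\<close>, so that writing \<open>d / N = a - b\<close> as a random walk in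
  \<open>a\<close> and \<open>b\<close> bounds its norm by the mean deviation of \<open>n\<close> coin tosses, for every \<open>n\<close>.
\<close>

lemma corner_unit_extreme:
  assumes "q \<in> carrier A" "d \<in> carrier A" "q \<otimes> q = q" "q \<otimes> d = d" "d \<otimes> q = d"
    and "N > 0" "cnorm A (cscale A (of_real N) q \<oplus> d) \<le> N" "cnorm A (cscale A (of_real N) q \<ominus> d) \<le> N"
  shows "d = \<zero>"
proof -
  define h :: complex where "h = of_real (1 / (2 * N))"
  define a where "a = cscale A h (cscale A (of_real N) q \<oplus> d)"
  define b where "b = cscale A h (cscale A (of_real N) q \<ominus> d)"
  have N: "N \<noteq> 0" using assms(6) by simp
  have hN: "h * of_real N = 1 / 2" using N by (simp add: h_def)
  have hh: "2 * h = 1 / of_real N" by (simp add: h_def)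
  have car: "a \<in> carrier A" "b \<in> carrier A" "cscale A z q \<in> carrier A" "cscale A z d \<in> carrier A" for z
    using assms(1,2) by (auto simp: a_def b_def scale_closed)
  have a': "a = cscale A (1 / 2) q \<oplus> cscale A h d"
    using assms(1,2) car by (simp add: a_def scale_add_right scale_scale hN)
  have b': "b = cscale A (1 / 2) q \<ominus> cscale A h d"
  proof -
    have "cscale A h (\<ominus> d) = \<ominus> cscale A h d"
      using assms(2) scale_scale[of d h "-1"] by (simp add: scale_minus_one scale_minus scale_one)
    then show ?thesis
      using assms(1,2) car by (simp add: b_def scale_add_right scale_scale hN minus_eq)
  qed
  have half: "cscale A (1 / 2) q \<oplus> cscale A (1 / 2) q = q"
    using assms(1) by (simp flip: scale_add_left add: scale_one)
  have sum: "a \<oplus> b = q"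
  proof -
    have "a \<oplus> b = (cscale A (1 / 2) q \<oplus> cscale A (1 / 2) q) \<oplus> (cscale A h d \<ominus> cscale A h d)"
      unfolding a' b' using car by (simp add: minus_eq a_ac)
    then show ?thesis using car assms(1) by (simp add: half minus_eq r_neg)
  qed
  have mult: "q \<otimes> a = a" "a \<otimes> q = a" "b \<otimes> q = b"
    unfolding a' b' minus_eq using assms(1-5) car
    by (simp_all add: r_distr l_distr scale_mult_left scale_mult_right r_minus l_minus)
  have "cnorm A a = cmod h * cnorm A (cscale A (of_real N) q \<oplus> d)"
    unfolding a_def using car assms by (intro norm_scale) auto
  also have "\<dots> \<le> cmod h * N" using assms(7) by (intro mult_left_mono) auto
  also have "\<dots> = 1 / 2" using assms(6) by (simp add: h_def norm_divide)
  finally have na: "cnorm A a \<le> 1 / 2" .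
  have "cnorm A b = cmod h * cnorm A (cscale A (of_real N) q \<ominus> d)"
    unfolding b_def using car assms by (intro norm_scale) auto
  also have "\<dots> \<le> cmod h * N" using assms(8) by (intro mult_left_mono) auto
  also have "\<dots> = 1 / 2" using assms(6) by (simp add: h_def norm_divide)
  finally have nb: "cnorm A b \<le> 1 / 2" .
  have nq: "cnorm A q \<le> 1"
    using norm_triangle[OF car(1,2)] na nb sum by simp
  \<comment> \<open>The statistic \<open>2k/n - 1\<close> is the average of n steps +1 or -1. Being
    affine, it has the coin sum \<open>-q + 2a = a - b = d/N\<close> for every n, while its mean
    absolute value tends to 0.\<close>
  have bound: "cnorm A (cscale A (of_real (1 / N)) d) \<le> \<epsilon> / 2 + 1 / (2 * \<epsilon> * n)"
    if "n > 0" "\<epsilon> > 0" for n :: nat and \<epsilon> :: real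
  proof -
    have "coin_sum q a b n (\<lambda>k. - 1 + (2 / n) * real k)
        = cscale A (of_real (- 1)) q \<oplus> cscale A (of_real (real n * (2 / n))) a"
      by (rule coin_sum_affine) (use assms car sum mult in auto)
    also have "of_real (real n * (2 / n)) = (2 :: complex)" using that by simp
    also have "cscale A 2 a = q \<oplus> cscale A (of_real (1 / N)) d"
      using assms(1,2) car by (simp add: a' scale_add_right scale_scale scale_one hh)
    also have "cscale A (of_real (- 1)) q = \<ominus> q" using assms(1) by (simp add: scale_minus_one)
    also have "\<ominus> q \<oplus> (q \<oplus> cscale A (of_real (1 / N)) d) = cscale A (of_real (1 / N)) d"
      using assms(1) car by (simp add: r_neg1)
    finally have "cnorm A (cscale A (of_real (1 / N)) d)
        \<le> coin_mean n (\<lambda>k. \<bar>- 1 + (2 / n) * real k\<bar>)"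
      using norm_coin_sum[OF assms(1) car(1,2) nq na nb, of n "\<lambda>k. - 1 + (2 / n) * real k"] by simp
    also have "\<dots> \<le> \<epsilon> / 2 + 1 / (2 * \<epsilon> * n)"
      using coin_abs_deviation[OF that] by (simp add: algebra_simps)
    finally show ?thesis .
  qed
  have "cnorm A (cscale A (of_real (1 / N)) d) \<le> \<epsilon>" if "\<epsilon> > 0" for \<epsilon> :: real
  proof -
    obtain n :: nat where n: "n > 1 / (\<epsilon> * \<epsilon>)" using reals_Archimedean2 by blast
    then have "n > 0" using that by (metis divide_pos_pos mult_pos_pos of_nat_0_less_iff order.strict_trans zero_less_one)
    moreover have "1 / (2 * \<epsilon> * n) \<le> \<epsilon> / 2"
      using n that \<open>n > 0\<close> by (simp add: field_simps)
    ultimately show ?thesis using bound[of n \<epsilon>] that by simp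
  qed
  then have "cnorm A (cscale A (of_real (1 / N)) d) = 0"
    by (metis field_le_epsilon add_0 car(4) norm_nonneg order_antisym)
  then have "cscale A (of_real (1 / N)) d = \<zero>" using car norm_eq_zero by blast
  then show ?thesis using assms(2) N by (intro scale_cancel[of d "of_real (1 / N)"]) auto
qed

section \<open>Compressions and orthogonality of projections\<close>

definition projection :: "'a \<Rightarrow> bool" where
  "projection q \<longleftrightarrow> q \<in> carrier A \<and> q \<otimes> q = q \<and> adj A q = q"

lemma projectionD:
  assumes "projection q"
  shows "q \<in> carrier A" "q \<otimes> q = q" "adj A q = q"
  using assms by (auto simp: projection_def)

lemma norm_projection: "projection q \<Longrightarrow> cnorm A q \<le> 1"
proof -
  assume q: "projection q"
  then have "(cnorm A q)\<^sup>2 = cnorm A q"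
    using cstar_identity[of q] by (simp add: projectionD)
  then have "cnorm A q = 0 \<or> cnorm A q = 1" by (simp add: power2_eq_square)
  then show ?thesis by auto
qed

lemma projection_complement:
  assumes "projection q"
  shows "projection (\<one> \<ominus> q)"
proof -
  note q = projectionD[OF assms]
  have "(\<one> \<ominus> q) \<otimes> (\<one> \<ominus> q) = \<one> \<ominus> q"
    using q by (simp add: minus_eq l_distr r_distr l_minus r_minus r_neg1 r_neg a_ac)
  then show ?thesis using q by (simp add: projection_def minus_eq adj_add adj_neg adj_one)
qed

lemma norm_compression:
  assumes "projection q" "projection g"
  shows "cnorm A (q \<otimes> g \<otimes> q) \<le> 1"
proof -
  note q = projectionD[OF assms(1)] and g = projectionD[OF assms(2)]
  have "cnorm A (q \<otimes> g \<otimes> q) \<le> cnorm A (q \<otimes> g) * cnorm A q"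
    using q g by (intro norm_mult) auto
  also have "\<dots> \<le> (cnorm A q * cnorm A g) * cnorm A q"
    using q g by (intro mult_right_mono norm_mult norm_nonneg) auto
  also have "\<dots> \<le> (1 * 1) * 1"
    using q g assms by (intro mult_mono norm_projection norm_nonneg mult_nonneg_nonneg) auto
  finally show ?thesis by simp
qed

text \<open>The element is the sum of the compressions of the complements
  \<open>\<one> \<ominus> g i\<close>, each of norm at most 1. This is the norm substitute for the
  order relation \<open>0 \<le> q g q \<le> q\<close>.\<close>

lemma norm_compressed_sum:
  assumes "finite I" "\<And>i. i \<in> I \<Longrightarrow> projection (g i)" "projection q"
  shows "cnorm A (cscale A (of_nat (card I)) q \<ominus> q \<otimes> (\<Oplus>i\<in>I. g i) \<otimes> q) \<le> card I"
  using assms(1,2)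
proof (induction I rule: finite_induct)
  case empty
  then show ?case using projectionD[OF assms(3)] by (simp add: scale_zero minus_eq norm_zero)
next
  case (insert i I)
  note q = projectionD[OF assms(3)]
  have gi: "projection (g i)" using insert by simp
  note gi' = projectionD[OF gi]
  have gI: "g \<in> I \<rightarrow> carrier A" using insert projectionD(1) by auto
  define S where "S = (\<Oplus>i\<in>I. g i)"
  have S: "S \<in> carrier A" unfolding S_def using gI by (rule finsum_closed)
  have eq: "(\<Oplus>j\<in>insert i I. g j) = g i \<oplus> S"
    unfolding S_def using insert gI gi' by (intro finsum_insert) auto
  have "q \<otimes> (\<one> \<ominus> g i) \<otimes> q = q \<ominus> q \<otimes> g i \<otimes> q"
    using q gi' by (simp add: minus_eq r_distr l_distr r_minus l_minus)
  then have "(q \<otimes> (\<one> \<ominus> g i) \<otimes> q) \<oplus> (cscale A (of_nat (card I)) q \<ominus> q \<otimes> S \<otimes> q)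
    = cscale A (of_nat (card (insert i I))) q \<ominus> q \<otimes> (g i \<oplus> S) \<otimes> q"
    using q gi' S insert
    by (simp add: scale_add_left scale_one r_distr l_distr minus_eq minus_add scale_closed a_ac)
  then have "cnorm A (cscale A (of_nat (card (insert i I))) q \<ominus> q \<otimes> (g i \<oplus> S) \<otimes> q)
    \<le> cnorm A (q \<otimes> (\<one> \<ominus> g i) \<otimes> q) + cnorm A (cscale A (of_nat (card I)) q \<ominus> q \<otimes> S \<otimes> q)"
    using q gi' S norm_triangle[of "q \<otimes> (\<one> \<ominus> g i) \<otimes> q" "cscale A (of_nat (card I)) q \<ominus> q \<otimes> S \<otimes> q"]
    by (simp add: scale_closed)
  also have "\<dots> \<le> 1 + real (card I)"
    using insert by (intro add_mono norm_compression projection_complement gi assms(3)) (auto simp: S_def)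
  finally show ?case using insert by (simp add: eq)
qed

text \<open>With positivity this would be immediate. Instead, the compression \<open>d\<close> of
  \<open>g i\<close> is the negative of the compression of the other summands, and the bounds for
  both descriptions of \<open>d\<close> make it satisfy the hypotheses of
  \<open>corner_unit_extreme\<close>.\<close>

lemma orthogonal_if_sum_orthogonal:
  assumes "finite I" "\<And>i. i \<in> I \<Longrightarrow> projection (g i)" "projection q"
    and "q \<otimes> (\<Oplus>i\<in>I. g i) \<otimes> q = \<zero>" "i \<in> I"
  shows "g i \<otimes> q = \<zero>"
proof -
  note q = projectionD[OF assms(3)]
  have gi: "projection (g i)" using assms by simp
  note gi' = projectionD[OF gi]
  define I' where "I' = I - {i}"
  have I: "finite I'" "i \<notin> I'" "I = insert i I'" using assms by (auto simp: I'_def)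
  have gI: "g \<in> I' \<rightarrow> carrier A" using assms projectionD(1) by (auto simp: I'_def)
  define S where "S = (\<Oplus>i\<in>I'. g i)"
  have S: "S \<in> carrier A" unfolding S_def using gI by (rule finsum_closed)
  have "(\<Oplus>j\<in>I. g j) = g i \<oplus> S"
    unfolding S_def I(3) using I gI gi' by (intro finsum_insert) auto
  then have "q \<otimes> g i \<otimes> q \<oplus> q \<otimes> S \<otimes> q = \<zero>"
    using assms(4) q gi' S by (simp add: r_distr l_distr)
  then have qSq: "q \<otimes> S \<otimes> q = \<ominus> (q \<otimes> g i \<otimes> q)"
    using q gi' S by (simp add: minus_equality[symmetric] a_comm)
  define d where "d = q \<otimes> g i \<otimes> q"
  define n where "n = card I'"
  have d: "d \<in> carrier A" using q gi' by (simp add: d_def)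
  have c: "cscale A z q \<in> carrier A" for z using q by (simp add: scale_closed)
  have qd: "q \<otimes> d = d" "d \<otimes> q = d"
    unfolding d_def using q gi' by (simp_all add: m_assoc) (simp add: m_assoc[symmetric])
  have plus: "cnorm A (cscale A (of_nat n) q \<oplus> d) \<le> n"
    using norm_compressed_sum[of I' g q] assms I q gi' d
    by (simp add: qSq minus_eq n_def flip: S_def d_def)
  have "q \<otimes> (\<one> \<ominus> g i) \<otimes> q = q \<ominus> d"
    using q gi' by (simp add: minus_eq r_distr l_distr r_minus l_minus d_def)
  then have minus: "cnorm A (q \<ominus> d) \<le> 1"
    using norm_compression[OF assms(3) projection_complement[OF gi]] by simp
  have nq: "cnorm A q \<le> 1" using assms(3) by (rule norm_projection)
  \<comment> \<open>The bounds have radius \<open>n\<close> (for plus) and 1 (for minus). Adding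
    copies of \<open>q\<close> brings both to \<open>n + 1\<close>, which is positive even if
    \<open>i\<close> is the only index.\<close>
  have split: "cscale A (of_nat n + 1) q = cscale A (of_nat n) q \<oplus> q"
    using q by (simp add: scale_add_left scale_one)
  have "cnorm A ((cscale A (of_nat n) q \<oplus> d) \<oplus> q) \<le> real n + 1"
    using norm_triangle[of "cscale A (of_nat n) q \<oplus> d" q] plus nq q d c by simp
  then have 1: "cnorm A (cscale A (of_real (real n + 1)) q \<oplus> d) \<le> real n + 1"
    using q d c by (simp add: split a_ac)
  have "cnorm A (cscale A (of_nat n) q) \<le> n"
    using q nq norm_nonneg[of q] by (simp add: norm_scale mult_left_le)
  then have "cnorm A (cscale A (of_nat n) q \<oplus> (q \<ominus> d)) \<le> real n + 1"
    using norm_triangle[of "cscale A (of_nat n) q" "q \<ominus> d"] minus q d c by simp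
  then have 2: "cnorm A (cscale A (of_real (real n + 1)) q \<ominus> d) \<le> real n + 1"
    using q d c by (simp add: split a_ac minus_eq)
  have "d = \<zero>"
    using corner_unit_extreme[OF q(1) d q(2) qd _ 1 2] by simp
  \<comment> \<open>The C*-identity reduces the vanishing of \<open>g i \<otimes> q\<close> to that
    of its square, which is \<open>d\<close>.\<close>
  moreover have "adj A (g i \<otimes> q) \<otimes> (g i \<otimes> q) = d"
  proof -
    have "adj A (g i \<otimes> q) \<otimes> (g i \<otimes> q) = q \<otimes> (g i \<otimes> g i) \<otimes> q"
      unfolding adj_mult[OF gi'(1) q(1)] using q(1,3) gi'(1,3) by (simp add: m_assoc)
    then show ?thesis using gi' by (simp add: d_def)
  qed
  ultimately have "(cnorm A (g i \<otimes> q))\<^sup>2 = 0"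
    using cstar_identity[of "g i \<otimes> q"] q gi' by (simp add: norm_zero)
  then show ?thesis using norm_eq_zero[of "g i \<otimes> q"] q gi' by simp
qed

end

section \<open>Finite and infinite paths\<close>

lemma (in pre_digraph) prng_Nil [simp]: "prng G (v, []) = v"
  by (simp add: prng_def)

lemma (in pre_digraph) prng_Cons [simp]: "prng G (v, e # es) = prng G (head G e, es)"
  by (simp add: prng_def)

lemma (in pre_digraph) Nil_in_paths_iff [simp]: "(v, []) \<in> paths G \<longleftrightarrow> v \<in> verts G"
  by (auto simp: paths_def awalk_def intro!: exI[of _ v])

lemma (in wf_digraph) Cons_in_paths_iff [simp]:
  "(v, e # es) \<in> paths G \<longleftrightarrow> e \<in> arcs G \<and> tail G e = v \<and> (head G e, es) \<in> paths G"
  by (auto simp: paths_def awalk_def)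

lemma (in wf_digraph) prng_in_verts: "(v, es) \<in> paths G \<Longrightarrow> prng G (v, es) \<in> verts G"
  by (induction es arbitrary: v) auto

lemma (in wf_digraph) append_in_paths_iff:
  "(v, es @ fs) \<in> paths G \<longleftrightarrow> (v, es) \<in> paths G \<and> (prng G (v, es), fs) \<in> paths G"
proof (induction es arbitrary: v)
  case Nil
  then show ?case by (auto simp: paths_def awalk_def)
qed auto

lemma (in pre_digraph) prng_append: "prng G (v, es @ fs) = prng G (prng G (v, es), fs)"
  by (induction es arbitrary: v) auto

lemma inf_paths_arc: "\<gamma> \<in> inf_paths G \<Longrightarrow> \<gamma> i \<in> arcs G"
  by (simp add: inf_paths_def)

lemma inf_paths_head: "\<gamma> \<in> inf_paths G \<Longrightarrow> head G (\<gamma> i) = tail G (\<gamma> (Suc i))"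
  by (simp add: inf_paths_def)

lemma suffix_in_inf_paths: "\<gamma> \<in> inf_paths G \<Longrightarrow> suffix k \<gamma> \<in> inf_paths G"
  by (simp add: inf_paths_def)

lemma build_in_inf_paths_iff:
  "e ## \<gamma> \<in> inf_paths G \<longleftrightarrow> e \<in> arcs G \<and> \<gamma> \<in> inf_paths G \<and> head G e = tail G (\<gamma> 0)"
proof -
  have "(\<forall>i. P i) \<longleftrightarrow> P 0 \<and> (\<forall>i. P (Suc i))" for P :: "nat \<Rightarrow> bool"
    by (metis not0_implies_Suc)
  from this[of "\<lambda>i. (e ## \<gamma>) i \<in> arcs G \<and> head G ((e ## \<gamma>) i) = tail G ((e ## \<gamma>) (Suc i))"]
  show ?thesis by (auto simp: inf_paths_def)
qed

lemma (in wf_digraph) conc_in_cylinder_iff: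
  assumes "(v, es) \<in> paths G"
  shows "es \<frown> \<gamma> \<in> cylinder G (v, es) \<longleftrightarrow> \<gamma> \<in> inf_paths G \<and> tail G (\<gamma> 0) = prng G (v, es)"
proof -
  have "es \<frown> \<gamma> \<in> inf_paths G \<and> tail G ((es \<frown> \<gamma>) 0) = v
      \<longleftrightarrow> \<gamma> \<in> inf_paths G \<and> tail G (\<gamma> 0) = prng G (v, es)"
    using assms
  proof (induction es arbitrary: v)
    case (Cons e es)
    have "(e # es) \<frown> \<gamma> \<in> inf_paths G \<and> tail G (((e # es) \<frown> \<gamma>) 0) = v
        \<longleftrightarrow> es \<frown> \<gamma> \<in> inf_paths G \<and> tail G ((es \<frown> \<gamma>) 0) = head G e"
      using Cons(2) by (auto simp: build_in_inf_paths_iff)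
    with Cons show ?case by simp
  qed simp
  then show ?thesis by (auto simp: cylinder_def psrc_def plen_def)
qed

lemma cylinder_conc_suffix:
  assumes "\<gamma> \<in> cylinder G (v, es)"
  shows "\<gamma> = es \<frown> suffix (length es) \<gamma>"
  using assms by (auto simp: cylinder_def psrc_def plen_def conc_def fun_eq_iff)

lemma (in wf_digraph) cylinder_suffix:
  assumes "(v, es) \<in> paths G" "\<gamma> \<in> cylinder G (v, es)"
  shows "suffix (length es) \<gamma> \<in> inf_paths G" "tail G (\<gamma> (length es)) = prng G (v, es)"
  using conc_in_cylinder_iff[OF assms(1), of "suffix (length es) \<gamma>"] assms(2)
  by (auto simp flip: cylinder_conc_suffix)

lemma (in wf_digraph) cylinder_Cons_iff:
  assumes "(v, e # es) \<in> paths G"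
  shows "\<gamma> \<in> cylinder G (v, e # es)
    \<longleftrightarrow> \<gamma> \<in> inf_paths G \<and> \<gamma> 0 = e \<and> suffix 1 \<gamma> \<in> cylinder G (head G e, es)"
  using assms inf_paths_head[of \<gamma> G 0] suffix_in_inf_paths[of \<gamma> G 1]
  by (auto simp: cylinder_def psrc_def plen_def All_less_Suc2)

text \<open>Follow a chosen outgoing edge at every vertex. This puts a point into every cylinder, so
  that statements about infinite paths yield statements about finite ones.\<close>

lemma (in wf_digraph) inf_path_from_vertex:
  assumes "no_sinks G" "v \<in> verts G"
  shows "\<exists>\<gamma> \<in> inf_paths G. tail G (\<gamma> 0) = v"
proof -
  obtain nxt where nxt: "\<And>v. v \<in> verts G \<Longrightarrow> nxt v \<in> arcs G \<and> tail G (nxt v) = v"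
    using assms(1) unfolding no_sinks_def by metis
  define w where "w i = ((\<lambda>v. head G (nxt v)) ^^ i) v" for i
  have w: "w i \<in> verts G" for i by (induction i) (auto simp: w_def nxt assms(2))
  have "(\<lambda>i. nxt (w i)) \<in> inf_paths G"
    using nxt w by (auto simp: inf_paths_def w_def)
  moreover have "tail G (nxt (w 0)) = v" using nxt[OF assms(2)] by (simp add: w_def)
  ultimately show ?thesis by (intro bexI[of _ "\<lambda>i. nxt (w i)"])
qed

section \<open>The Leavitt path ring acting on graded infinite paths\<close>

text \<open>
  Terms act on integer functions on \<open>E\<^sup>\<infinity> \<times> \<int>\<close>; the second coordinate keeps track of the
  degree, so that elements of different degree are told apart.
\<close>

primrec lpa_act :: "('v, 'e) pre_digraph \<Rightarrow> ('v, 'e) lpa_term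
    \<Rightarrow> ((nat \<Rightarrow> 'e) \<Rightarrow> int \<Rightarrow> int) \<Rightarrow> (nat \<Rightarrow> 'e) \<Rightarrow> int \<Rightarrow> int" where
  "lpa_act G Null f = (\<lambda>\<gamma> n. 0)"
| "lpa_act G (Vtx v) f = (\<lambda>\<gamma> n. if \<gamma> \<in> inf_paths G \<and> tail G (\<gamma> 0) = v then f \<gamma> n else 0)"
| "lpa_act G (Edge e) f = (\<lambda>\<gamma> n. if \<gamma> \<in> inf_paths G \<and> \<gamma> 0 = e then f (suffix 1 \<gamma>) (n - 1) else 0)"
| "lpa_act G (Ghost e) f = (\<lambda>\<gamma> n. if e ## \<gamma> \<in> inf_paths G then f (e ## \<gamma>) (n + 1) else 0)"
| "lpa_act G (Neg s) f = (\<lambda>\<gamma> n. - lpa_act G s f \<gamma> n)"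
| "lpa_act G (Plus s t) f = (\<lambda>\<gamma> n. lpa_act G s f \<gamma> n + lpa_act G t f \<gamma> n)"
| "lpa_act G (Times s t) f = lpa_act G s (lpa_act G t f)"

text \<open>Additivity in the function is what left distributivity demands of the action.\<close>

lemma lpa_act_add:
  "lpa_act G t (\<lambda>\<gamma> n. f \<gamma> n + g \<gamma> n) = (\<lambda>\<gamma> n. lpa_act G t f \<gamma> n + lpa_act G t g \<gamma> n)"
proof (induction t arbitrary: f g)
  case (Times s t)
  then show ?case by simp
qed (auto simp: fun_eq_iff)

lemma lpa_act_foldr:
  "lpa_act G (foldr (\<lambda>x. Plus (h x)) xs Null) f \<gamma> n = (\<Sum>x\<leftarrow>xs. lpa_act G (h x) f \<gamma> n)"
  by (induction xs) auto

lemma suffix_build [simp]: "suffix (Suc 0) (e ## \<gamma>) = \<gamma>"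
  by (simp add: fun_eq_iff)

text \<open>Each ring axiom and each defining relation holds for the operators, so the action
  descends to the ring. This is how two terms are shown to be different.\<close>

lemma (in wf_digraph) lpa_eq_imp_act_eq:
  "lpa_eq G s t \<Longrightarrow> lpa_act G s = lpa_act G t"
proof (induction rule: lpa_eq.induct)
  case (Vtx_sum v es)
  show ?case
  proof (intro ext)
    fix f \<gamma> n
    have "lpa_act G (foldr (\<lambda>e. Plus (Times (Edge e) (Ghost e))) es Null) f \<gamma> n
      = (\<Sum>e\<leftarrow>es. if \<gamma> \<in> inf_paths G \<and> \<gamma> 0 = e then f \<gamma> n else 0)"
      unfolding lpa_act_foldr
      by (rule arg_cong[of _ _ sum_list], rule map_cong) auto
    also have "\<dots> = (\<Sum>e\<in>set es. if \<gamma> \<in> inf_paths G \<and> \<gamma> 0 = e then f \<gamma> n else 0)"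
      using Vtx_sum by (simp add: sum_list_distinct_conv_sum_set)
    \<comment> \<open>An infinite path starting at \<open>v\<close> has exactly one first edge, so
      exactly one summand survives.\<close>
    also have "\<dots> = lpa_act G (Vtx v) f \<gamma> n"
    proof (cases "\<gamma> \<in> inf_paths G")
      case True
      then have "(\<Sum>e\<in>set es. if \<gamma> \<in> inf_paths G \<and> \<gamma> 0 = e then f \<gamma> n else 0)
        = (if \<gamma> 0 \<in> set es then f \<gamma> n else 0)" by simp
      also have "\<gamma> 0 \<in> set es \<longleftrightarrow> tail G (\<gamma> 0) = v" 
        unfolding Vtx_sum(3) using inf_paths_arc[OF True] by simp
      finally show ?thesis using True by simp
    qed simp
    finally show "lpa_act G (Vtx v) f \<gamma> n
      = lpa_act G (foldr (\<lambda>e. Plus (Times (Edge e) (Ghost e))) es Null) f \<gamma> n" by simp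
  qed
next
  case (distrib_left u s t)
  then show ?case by (simp only: lpa_act.simps lpa_act_add)
next
  case (cong_Times s s' t t')
  then show ?case by simp
qed (auto simp: fun_eq_iff build_in_inf_paths_iff inf_paths_arc suffix_in_inf_paths inf_paths_head)

lemma lpa_star_foldr:
  "lpa_star (foldr (\<lambda>x. Plus (h x)) xs Null) = foldr (\<lambda>x. Plus (lpa_star (h x))) xs Null"
  by (induction xs) auto

text \<open>The involution permutes the defining relations, reversing the direction of
  associativity. Hence the adjoint of a class does not depend on the representative.\<close>

lemma lpa_eq_star: "lpa_eq G s t \<Longrightarrow> lpa_eq G (lpa_star s) (lpa_star t)"
proof (induction rule: lpa_eq.induct)
  case (Vtx_sum v es)
  then show ?case by (simp add: lpa_star_foldr lpa_eq.Vtx_sum)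
next
  case (sym s t)
  from sym.IH show ?case by (rule lpa_eq.sym)
next
  case (trans s t u)
  then show ?case by (blast intro: lpa_eq.trans)
next
  case (Times_assoc s t u)
  then show ?case by (simp add: lpa_eq.sym[OF lpa_eq.Times_assoc])
qed (simp_all add: lpa_eq.refl lpa_eq.cong_Neg lpa_eq.cong_Plus lpa_eq.cong_Times lpa_eq.Plus_assoc
  lpa_eq.Plus_comm lpa_eq.Plus_Null lpa_eq.Plus_Neg lpa_eq.distrib_right lpa_eq.distrib_left
  lpa_eq.Vtx_idem lpa_eq.Vtx_orth lpa_eq.Ghost_Edge_orth lpa_eq.Ghost_Edge lpa_eq.Vtx_Edge
  lpa_eq.Edge_Vtx lpa_eq.Ghost_Vtx lpa_eq.Vtx_Ghost lpa_eq.foreign_Vtx lpa_eq.foreign_Edge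
  lpa_eq.foreign_Ghost)

section \<open>The ring operations on classes of terms\<close>

lemma lpa_class_eq_iff: "lpa_class G s = lpa_class G t \<longleftrightarrow> lpa_eq G s t"
proof
  assume "lpa_class G s = lpa_class G t"
  moreover have "t \<in> lpa_class G t" by (simp add: lpa_class_def lpa_eq.refl)
  ultimately have "t \<in> lpa_class G s" by simp
  then show "lpa_eq G s t" by (simp add: lpa_class_def)
next
  assume st: "lpa_eq G s t"
  have "lpa_eq G s u \<longleftrightarrow> lpa_eq G t u" for u
    using lpa_eq.trans[OF st, of u] lpa_eq.trans[OF lpa_eq.sym[OF st], of u] by blast
  then show "lpa_class G s = lpa_class G t" by (simp add: lpa_class_def)
qed

text \<open>The operations of \<open>leavitt\<close> are unions over all representatives; they
  collapse to one class as soon as the result does not depend on the choice.\<close>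

lemma UN_UN_constant:
  assumes "x \<in> X" "y \<in> Y" "\<And>x y. \<lbrakk>x \<in> X; y \<in> Y\<rbrakk> \<Longrightarrow> F x y = C"
  shows "(\<Union>x\<in>X. \<Union>y\<in>Y. F x y) = C"
  using assms by blast

lemma leavitt_mult:
  "lpa_class G s \<otimes>\<^bsub>leavitt G\<^esub> lpa_class G t = lpa_class G (Times s t)"
proof -
  have "lpa_class G (Times s' t') = lpa_class G (Times s t)" if "s' \<in> lpa_class G s" "t' \<in> lpa_class G t" for s' t'
    unfolding lpa_class_eq_iff
    by (intro lpa_eq.cong_Times lpa_eq.sym[of G s s'] lpa_eq.sym[of G t t'])
      (use that in \<open>simp_all add: lpa_class_def\<close>)
  moreover have "s \<in> lpa_class G s" "t \<in> lpa_class G t" by (auto simp: lpa_class_def lpa_eq.refl)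
  ultimately have "(\<Union>s'\<in>lpa_class G s. \<Union>t'\<in>lpa_class G t. lpa_class G (Times s' t')) = lpa_class G (Times s t)"
    by (intro UN_UN_constant[of s _ t])
  then show ?thesis by (simp add: leavitt_def)
qed

lemma leavitt_add:
  "lpa_class G s \<oplus>\<^bsub>leavitt G\<^esub> lpa_class G t = lpa_class G (Plus s t)"
proof -
  have "lpa_class G (Plus s' t') = lpa_class G (Plus s t)" if "s' \<in> lpa_class G s" "t' \<in> lpa_class G t" for s' t'
    unfolding lpa_class_eq_iff
    by (intro lpa_eq.cong_Plus lpa_eq.sym[of G s s'] lpa_eq.sym[of G t t'])
      (use that in \<open>simp_all add: lpa_class_def\<close>)
  moreover have "s \<in> lpa_class G s" "t \<in> lpa_class G t" by (auto simp: lpa_class_def lpa_eq.refl)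
  ultimately have "(\<Union>s'\<in>lpa_class G s. \<Union>t'\<in>lpa_class G t. lpa_class G (Plus s' t')) = lpa_class G (Plus s t)"
    by (intro UN_UN_constant[of s _ t])
  then show ?thesis by (simp add: leavitt_def)
qed

lemma leavitt_adj: "adj (leavitt G) (lpa_class G s) = lpa_class G (lpa_star s)"
proof -
  have "lpa_class G (lpa_star s') = lpa_class G (lpa_star s)" if "s' \<in> lpa_class G s" for s'
    unfolding lpa_class_eq_iff
    by (intro lpa_eq_star lpa_eq.sym[of G s s']) (use that in \<open>simp_all add: lpa_class_def\<close>)
  moreover have "s \<in> lpa_class G s" by (auto simp: lpa_class_def lpa_eq.refl)
  ultimately have "(\<Union>s'\<in>lpa_class G s. lpa_class G (lpa_star s')) = lpa_class G (lpa_star s)"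
    by blast
  then show ?thesis by (simp add: leavitt_def)
qed

lemma leavitt_zero: "\<zero>\<^bsub>leavitt G\<^esub> = lpa_class G Null"
  by (simp add: leavitt_def)

lemma leavitt_carrier: "carrier (leavitt G) = range (lpa_class G)"
  by (simp add: leavitt_def)

text \<open>The unit is a union over all enumerations of the vertices. Any two enumerations give
  equivalent sums, because an entry can be moved to the front.\<close>

lemma (in fin_digraph) leavitt_one:
  obtains vs where "distinct vs" "set vs = verts G"
    "\<one>\<^bsub>leavitt G\<^esub> = lpa_class G (foldr (\<lambda>v. Plus (Vtx v)) vs Null)"
proof -
  obtain vs where vs: "distinct vs" "set vs = verts G" using finite_distinct_list[OF finite_verts] by metis
  have swap: "lpa_eq G (Plus s (Plus t u)) (Plus t (Plus s u))" for s t u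
    by (rule lpa_eq.trans[OF lpa_eq.sym[OF lpa_eq.Plus_assoc]
        lpa_eq.trans[OF lpa_eq.cong_Plus[OF lpa_eq.Plus_comm lpa_eq.refl] lpa_eq.Plus_assoc]])
  have move: "lpa_eq G (foldr (\<lambda>v. Plus (Vtx v)) (xs @ x # ys) Null)
      (foldr (\<lambda>v. Plus (Vtx v)) (x # xs @ ys) Null)" for xs x ys
  proof (induction xs)
    case (Cons y xs)
    then have "lpa_eq G (foldr (\<lambda>v. Plus (Vtx v)) ((y # xs) @ x # ys) Null)
       (Plus (Vtx y) (foldr (\<lambda>v. Plus (Vtx v)) (x # xs @ ys) Null))"
      by (simp add: lpa_eq.cong_Plus lpa_eq.refl)
    with swap show ?case by (simp add: lpa_eq.trans)
  qed (simp add: lpa_eq.refl)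
  have "lpa_eq G (foldr (\<lambda>v. Plus (Vtx v)) xs Null) (foldr (\<lambda>v. Plus (Vtx v)) ys Null)"
    if "distinct xs" "distinct ys" "set xs = set ys" for xs ys
    using that
  proof (induction xs arbitrary: ys)
    case (Cons x xs)
    then obtain as bs where ys: "ys = as @ x # bs" by (metis list.set_intros(1) split_list)
    have "set xs = set ys - {x}"
      using Cons.prems by (metis Diff_insert_absorb distinct.simps(2) list.simps(15))
    then have "set xs = set (as @ bs)" using Cons.prems ys by auto
    with Cons.prems ys have "lpa_eq G (foldr (\<lambda>v. Plus (Vtx v)) xs Null) (foldr (\<lambda>v. Plus (Vtx v)) (as @ bs) Null)"
      by (intro Cons.IH) auto
    then have "lpa_eq G (foldr (\<lambda>v. Plus (Vtx v)) (x # xs) Null) (foldr (\<lambda>v. Plus (Vtx v)) (x # as @ bs) Null)"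
      by (simp add: lpa_eq.cong_Plus lpa_eq.refl)
    then show ?case unfolding ys by (rule lpa_eq.trans) (rule lpa_eq.sym[OF move])
  qed (simp add: lpa_eq.refl)
  then have "lpa_class G (foldr (\<lambda>v. Plus (Vtx v)) xs Null) = lpa_class G (foldr (\<lambda>v. Plus (Vtx v)) vs Null)"
    if "distinct xs \<and> set xs = verts G" for xs
    using that vs by (simp add: lpa_class_eq_iff)
  then have "(\<Union>xs\<in>{xs. distinct xs \<and> set xs = verts G}. lpa_class G (foldr (\<lambda>v. Plus (Vtx v)) xs Null))
    = lpa_class G (foldr (\<lambda>v. Plus (Vtx v)) vs Null)"
    using vs by blast
  then have "\<one>\<^bsub>leavitt G\<^esub> = lpa_class G (foldr (\<lambda>v. Plus (Vtx v)) vs Null)"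
    by (simp add: leavitt_def)
  with vs that show thesis by blast
qed

lemma leavitt_abelian_monoid: "abelian_monoid (leavitt G)"
proof (rule abelian_monoidI)
  fix x y z
  assume "x \<in> carrier (leavitt G)" "y \<in> carrier (leavitt G)"
  then obtain s t where st: "x = lpa_class G s" "y = lpa_class G t"
    by (auto simp: leavitt_carrier)
  show "x \<oplus>\<^bsub>leavitt G\<^esub> y \<in> carrier (leavitt G)" by (simp add: st leavitt_add leavitt_carrier)
  show "x \<oplus>\<^bsub>leavitt G\<^esub> y = y \<oplus>\<^bsub>leavitt G\<^esub> x"
    by (simp add: st leavitt_add lpa_class_eq_iff lpa_eq.Plus_comm)
  assume "z \<in> carrier (leavitt G)"
  then obtain u where "z = lpa_class G u" by (auto simp: leavitt_carrier)
  then show "x \<oplus>\<^bsub>leavitt G\<^esub> y \<oplus>\<^bsub>leavitt G\<^esub> z = x \<oplus>\<^bsub>leavitt G\<^esub> (y \<oplus>\<^bsub>leavitt G\<^esub> z)"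
    by (simp add: st leavitt_add lpa_class_eq_iff lpa_eq.Plus_assoc)
next
  fix x assume "x \<in> carrier (leavitt G)"
  then obtain s where s: "x = lpa_class G s" by (auto simp: leavitt_carrier)
  then show "\<zero>\<^bsub>leavitt G\<^esub> \<oplus>\<^bsub>leavitt G\<^esub> x = x"
    by (simp add: leavitt_add leavitt_zero lpa_class_eq_iff lpa_eq.Plus_Null)
qed (simp add: leavitt_zero leavitt_carrier)

lemma leavitt_finsum:
  assumes "distinct xs"
  shows "(\<Oplus>\<^bsub>leavitt G\<^esub>x\<in>set xs. lpa_class G (h x)) = lpa_class G (foldr (\<lambda>x. Plus (h x)) xs Null)"
proof -
  interpret L: abelian_monoid "leavitt G" by (rule leavitt_abelian_monoid)
  show ?thesis using assms
    by (induction xs) (auto simp: leavitt_zero leavitt_carrier leavitt_add Pi_iff)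
qed

fun path_term :: "'v \<Rightarrow> 'e list \<Rightarrow> ('v, 'e) lpa_term" where
  "path_term v [] = Vtx v"
| "path_term v [e] = Edge e"
| "path_term v (e # f # es) = Times (Edge e) (path_term v (f # es))"

text \<open>The vertex argument is read only for the empty list, so \<open>w\<close> is arbitrary;
  later it is taken to be \<open>head G e\<close>.\<close>

lemma path_term_Cons:
  fixes v w :: 'v and es :: "'e list"
  assumes "es \<noteq> []"
  shows "path_term v (e # es) = Times (Edge e) (path_term w es)"
proof -
  have "path_term v (f # fs) = path_term w (f # fs)" for f and fs :: "'e list"
    by (induction fs arbitrary: f) auto
  then show ?thesis using assms by (cases es) auto
qed

lemma lpa_path_eq: "lpa_path G (v, es) = lpa_class G (path_term v es)"
proof -
  have "path_elt (leavitt G) (lpa_P G) (lpa_S G) v es = lpa_class G (path_term v es)"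
    by (induction v es rule: path_term.induct) (auto simp: lpa_P_def lpa_S_def leavitt_mult)
  then show ?thesis by (simp add: S_path_def)
qed

context wf_digraph
begin

text \<open>On point masses, the element of a path prepends that path and raises the degree by its
  length. Its adjoint, treated next, does the reverse.\<close>

lemma lpa_act_path_term:
  assumes "(v, es) \<in> paths G"
  shows "lpa_act G (path_term v es) f \<gamma> n
    = (if \<gamma> \<in> cylinder G (v, es) then f (suffix (length es) \<gamma>) (n - int (length es)) else 0)"
  using assms
proof (induction es arbitrary: v f \<gamma> n)
  case Nil
  then show ?case by (simp add: cylinder_def psrc_def plen_def)
next
  case (Cons e es)
  show ?case
  proof (cases "es = []")
    case True
    then show ?thesis using Cons(2) inf_paths_head[of \<gamma> G 0] suffix_in_inf_paths[of \<gamma> G 1]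
      by (auto simp: cylinder_Cons_iff) (auto simp: cylinder_def psrc_def plen_def suffix_def)
  next
    case False
    with Cons show ?thesis
      by (simp add: path_term_Cons[where w = "head G e"] cylinder_Cons_iff suffix_def algebra_simps)
  qed
qed

lemma lpa_act_path_term_star:
  assumes "(v, es) \<in> paths G"
  shows "lpa_act G (lpa_star (path_term v es)) f \<gamma> n
    = (if es \<frown> \<gamma> \<in> cylinder G (v, es) then f (es \<frown> \<gamma>) (n + int (length es)) else 0)"
  using assms
proof (induction es arbitrary: v f \<gamma> n)
  case Nil
  then show ?case by (simp add: cylinder_def psrc_def plen_def)
next
  case (Cons e es)
  show ?case
  proof (cases "es = []")
    case True
    then show ?thesis using Cons(2) by (auto simp: cylinder_def psrc_def plen_def build_in_inf_paths_iff)
  next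
    case False
    have p: "(head G e, es) \<in> paths G" using Cons(2) by simp
    have eq: "(e # es) \<frown> \<gamma> \<in> cylinder G (v, e # es) \<longleftrightarrow> es \<frown> \<gamma> \<in> cylinder G (head G e, es)"
      using conc_in_cylinder_iff[OF Cons(2)] conc_in_cylinder_iff[OF p] by simp
    have inf: "e ## es \<frown> \<gamma> \<in> inf_paths G" if "es \<frown> \<gamma> \<in> cylinder G (head G e, es)"
      using that Cons(2) unfolding build_in_inf_paths_iff by (simp add: cylinder_def psrc_def)
    show ?thesis
      using Cons.IH[OF p] False inf eq
      by (simp add: path_term_Cons[where w = "head G e"] algebra_simps)
  qed
qed

text \<open>Derived from the relations and not from the action: an edge label must equal a vertex
  idempotent in the ring itself, and the action is not shown to be faithful.\<close>

lemma path_term_star_self: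
  assumes "(v, es) \<in> paths G"
  shows "lpa_eq G (Times (lpa_star (path_term v es)) (path_term v es)) (Vtx (prng G (v, es)))"
  using assms
proof (induction es arbitrary: v)
  case Nil
  then show ?case by (simp add: lpa_eq.Vtx_idem)
next
  case (Cons e es)
  show ?case
  proof (cases es)
    case Nil
    then show ?thesis using Cons(2) by (simp add: lpa_eq.Ghost_Edge)
  next
    case (Cons f fs)
    let ?t = "path_term (head G e) es"
    have p: "(head G e, es) \<in> paths G" "e \<in> arcs G" using Cons.prems by auto
    have src: "lpa_eq G (Times (Vtx (head G e)) ?t) ?t"
    proof (cases fs)
      case Nil
      then show ?thesis using p Cons lpa_eq.Vtx_Edge[of f G] by auto
    next
      case (Cons g gs)
      have "lpa_eq G (Times (Vtx (tail G f)) (Times (Edge f) u)) (Times (Edge f) u)" for u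
        using p \<open>es = f # fs\<close>
        by (intro lpa_eq.trans[OF lpa_eq.sym[OF lpa_eq.Times_assoc]] lpa_eq.cong_Times
            lpa_eq.Vtx_Edge lpa_eq.refl) simp
      then show ?thesis using p Cons \<open>es = f # fs\<close> by auto
    qed
    note [trans] = lpa_eq.trans
    have "path_term v (e # es) = Times (Edge e) ?t" using Cons by (intro path_term_Cons) auto
    then have "lpa_eq G (Times (lpa_star (path_term v (e # es))) (path_term v (e # es)))
        (Times (lpa_star ?t) (Times (Ghost e) (Times (Edge e) ?t)))"
      by (simp add: lpa_eq.Times_assoc)
    also have "lpa_eq G \<dots> (Times (lpa_star ?t) (Times (Times (Ghost e) (Edge e)) ?t))"
      by (intro lpa_eq.cong_Times lpa_eq.refl lpa_eq.sym[OF lpa_eq.Times_assoc])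
    also have "lpa_eq G \<dots> (Times (lpa_star ?t) (Times (Vtx (head G e)) ?t))"
      using p by (intro lpa_eq.cong_Times lpa_eq.refl lpa_eq.Ghost_Edge)
    also have "lpa_eq G \<dots> (Times (lpa_star ?t) ?t)"
      by (intro lpa_eq.cong_Times lpa_eq.refl src)
    also have "lpa_eq G \<dots> (Vtx (prng G (v, e # es)))"
      using Cons.IH[OF p(1)] by simp
    finally show ?thesis .
  qed
qed

end

section \<open>Admissible sets and coding graphs in terms of infinite paths\<close>

lemma admissible_paths:
  assumes "admissible G J" "x \<in> J"
  shows "fst x \<in> paths G" "snd x \<in> paths G" "psrc (fst x) = psrc (snd x)"
    "prng G (fst x) = prng G (snd x)" "plen (snd x) \<ge> 1"
proof -
  have "x \<in> paths G \<times> paths G" using assms unfolding admissible_def by blast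
  then show "fst x \<in> paths G" "snd x \<in> paths G" by auto
  show "psrc (fst x) = psrc (snd x)" "prng G (fst x) = prng G (snd x)" "plen (snd x) \<ge> 1"
    using assms unfolding admissible_def by (auto simp: case_prod_beta)
qed

lemma admissible_finite: "admissible G J \<Longrightarrow> finite J"
  by (simp add: admissible_def)

text \<open>
  Applied to the constant function \<open>1\<close>, the relation \<open>u\<^sup>* u = 1\<close> counts, with positive
  multiplicities, the second components that are initial segments of a given infinite path.
\<close>

lemma (in fin_digraph) admissible_unique:
  assumes "admissible G J" "\<gamma> \<in> inf_paths G"
  shows "\<exists>!x. x \<in> J \<and> \<gamma> \<in> cylinder G (snd x)"
proof -
  have fin: "finite J" using assms admissible_finite by blast
  obtain xs where xs: "distinct xs" "set xs = J" using finite_distinct_list[OF fin] by metis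
  define h :: "('a, 'b) jpair \<Rightarrow> _" where "h x = Times (path_term (fst (fst x)) (snd (fst x)))
    (lpa_star (path_term (fst (snd x)) (snd (snd x))))" for x
  define ut where "ut = foldr (\<lambda>x. Plus (h x)) xs Null"
  have h: "lpa_path G (fst x) \<otimes>\<^bsub>leavitt G\<^esub> adj (leavitt G) (lpa_path G (snd x)) = lpa_class G (h x)" for x
    using lpa_path_eq[of G "fst (fst x)" "snd (fst x)"] lpa_path_eq[of G "fst (snd x)" "snd (snd x)"]
    by (simp add: leavitt_adj leavitt_mult h_def)
  have u: "u_elt (leavitt G) (lpa_P G) (lpa_S G) J = lpa_class G ut"
    unfolding u_elt_def h ut_def leavitt_finsum[OF xs(1), symmetric] xs(2) ..
  obtain vs where vs: "distinct vs" "set vs = verts G"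
    "\<one>\<^bsub>leavitt G\<^esub> = lpa_class G (foldr (\<lambda>v. Plus (Vtx v)) vs Null)"
    by (rule leavitt_one)
  have "unitary_elt (leavitt G) (lpa_class G ut)"
    using assms(1) by (simp add: admissible_def u)
  then have "lpa_eq G (Times (lpa_star ut) ut) (foldr (\<lambda>v. Plus (Vtx v)) vs Null)"
    by (simp add: unitary_elt_def leavitt_adj leavitt_mult vs lpa_class_eq_iff)
  note act = lpa_eq_imp_act_eq[OF this]
  let ?one = "\<lambda>(_ :: nat \<Rightarrow> 'b) (_ :: int). 1 :: int"
  define m where "m = lpa_act G ut ?one"
  have act_h: "lpa_act G (h x) ?one \<gamma> n = of_bool (\<gamma> \<in> cylinder G (fst x))" if "x \<in> J" for x \<gamma> n
  proof -
    obtain v es w fs where x: "x = ((v, es), (w, fs))" by (metis surj_pair)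
    note p = admissible_paths[OF assms(1) that, unfolded x fst_conv snd_conv]
    have "fs \<frown> suffix (length es) \<gamma> \<in> cylinder G (w, fs)" if "\<gamma> \<in> cylinder G (v, es)"
      using conc_in_cylinder_iff[OF p(2)] cylinder_suffix[OF p(1) that] p(4) by simp
    then show ?thesis
      by (simp add: h_def x lpa_act_path_term[OF p(1)] lpa_act_path_term_star[OF p(2)])
  qed
  \<comment> \<open>Here the function stays general because the adjoint of \<open>u\<close> is
    applied to \<open>m\<close>, not to the constant function.\<close>
  have act_hs: "lpa_act G (lpa_star (h x)) f \<gamma> n = (if \<gamma> \<in> cylinder G (snd x) then
      f (snd (fst x) \<frown> suffix (plen (snd x)) \<gamma>) (n - plen (snd x) + plen (fst x)) else 0)"
    if "x \<in> J" for x f \<gamma> n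
  proof -
    obtain v es w fs where x: "x = ((v, es), (w, fs))" by (metis surj_pair)
    note p = admissible_paths[OF assms(1) that, unfolded x fst_conv snd_conv]
    have star: "lpa_star (lpa_star t) = t" for t :: "('a, 'b) lpa_term" by (induction t) auto
    have "es \<frown> suffix (length fs) \<gamma> \<in> cylinder G (v, es)" if "\<gamma> \<in> cylinder G (w, fs)"
      using conc_in_cylinder_iff[OF p(1)] cylinder_suffix[OF p(2) that] p(4) by simp
    then show ?thesis
      by (simp add: h_def x star lpa_act_path_term[OF p(2)] lpa_act_path_term_star[OF p(1)] plen_def)
  qed
  have m: "m \<gamma> n = (\<Sum>x\<in>J. of_bool (\<gamma> \<in> cylinder G (fst x)))" for \<gamma> n
    unfolding m_def ut_def lpa_act_foldr sum_list_distinct_conv_sum_set[OF xs(1)] xs(2)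
    by (rule sum.cong) (auto simp: act_h)
  \<comment> \<open>Exchanging the second component for the first leads into the cylinder of
    \<open>fst x\<close>, so \<open>x\<close> itself is counted by \<open>m\<close> there.\<close>
  have m1: "m (snd (fst x) \<frown> suffix (plen (snd x)) \<gamma>) n \<ge> 1"
    if "x \<in> J" "\<gamma> \<in> cylinder G (snd x)" for x \<gamma> n
  proof -
    obtain v es w fs where x: "x = ((v, es), (w, fs))" by (metis surj_pair)
    note p = admissible_paths[OF assms(1) that(1), unfolded x fst_conv snd_conv]
    have "es \<frown> suffix (length fs) \<gamma> \<in> cylinder G (v, es)"
      using conc_in_cylinder_iff[OF p(1)] cylinder_suffix[OF p(2)] p(4) that(2) x by simp
    then have "(1::int) = of_bool (snd (fst x) \<frown> suffix (plen (snd x)) \<gamma> \<in> cylinder G (fst x))"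
      by (simp add: x plen_def)
    also have "\<dots> \<le> m (snd (fst x) \<frown> suffix (plen (snd x)) \<gamma>) n"
      unfolding m by (rule member_le_sum) (use fin that in auto)
    finally show ?thesis .
  qed
  let ?N = "{x \<in> J. \<gamma> \<in> cylinder G (snd x)}"
  have "lpa_act G (Times (lpa_star ut) ut) ?one \<gamma> 0 = (\<Sum>x\<in>J. lpa_act G (lpa_star (h x)) m \<gamma> 0)"
    unfolding ut_def lpa_star_foldr lpa_act.simps lpa_act_foldr[of _ "\<lambda>x. lpa_star (h x)"]
    unfolding sum_list_distinct_conv_sum_set[OF xs(1)] xs(2) m_def ut_def ..
  also have "\<dots> = (\<Sum>x\<in>?N. m (snd (fst x) \<frown> suffix (plen (snd x)) \<gamma>) (int (plen (fst x)) - int (plen (snd x))))"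
    using fin by (simp add: act_hs sum.If_cases Int_def)
  finally have sum_N: "\<dots> = lpa_act G (foldr (\<lambda>v. Plus (Vtx v)) vs Null) ?one \<gamma> 0"
    by (simp only: act)
  also have "\<dots> = (\<Sum>v\<in>verts G. of_bool (tail G (\<gamma> 0) = v))"
    unfolding lpa_act_foldr sum_list_distinct_conv_sum_set[OF vs(1)] vs(2)
    by (rule sum.cong) (auto simp: assms)
  also have "\<dots> = 1"
    using inf_paths_arc[OF assms(2), of 0] sum.delta[of "verts G" "tail G (\<gamma> 0)" "\<lambda>_. 1 :: int"]
    by (simp add: of_bool_def)
  finally have one: "(\<Sum>x\<in>?N. m (snd (fst x) \<frown> suffix (plen (snd x)) \<gamma>)
      (int (plen (fst x)) - int (plen (snd x)))) = 1" .
  \<comment> \<open>Integers that are all at least 1 add up to 1, so there is exactly one of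
    them.\<close>
  have "(\<Sum>x\<in>?N. 1) \<le> (\<Sum>x\<in>?N. m (snd (fst x) \<frown> suffix (plen (snd x)) \<gamma>)
      (int (plen (fst x)) - int (plen (snd x))))"
    by (rule sum_mono) (use m1 in auto)
  then have "card ?N \<le> 1" using one by simp
  moreover have "?N \<noteq> {}"
  proof
    assume "?N = {}"
    from one[unfolded this] show False by simp
  qed
  moreover have "card ?N = 0 \<longleftrightarrow> ?N = {}" using fin by (intro card_0_eq) simp
  ultimately have "card ?N = 1" by linarith
  then obtain x where "?N = {x}" by (auto simp: card_1_singleton_iff)
  then show ?thesis by (intro ex1I[of _ x]) auto
qed

section \<open>Labels and degrees of edges of the coding graph\<close>

context wf_digraph
begin

lemma edge_label_eq:
  "edge_label G (x, y) = lpa_class G (Times (lpa_star (path_term (fst (rest_path G x)) (snd (rest_path G x))))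
    (path_term (fst (fst y)) (snd (fst y))))"
  using lpa_path_eq[of G "fst (rest_path G x)" "snd (rest_path G x)"]
    lpa_path_eq[of G "fst (fst y)" "snd (fst y)"]
  by (simp add: edge_label_def leavitt_adj leavitt_mult)

text \<open>Prepending the rest path to \<eta> gives a path that also begins with the first
  component of \<open>y\<close>, so at \<eta> the label evaluates at one point, shifted in degree.
  Allowing any representative \<open>t\<close> permits comparison with other expressions for the
  same label.\<close>

lemma edge_label_act:
  assumes "rest_path G x \<in> paths G" "fst y \<in> paths G"
    and "snd (rest_path G x) \<frown> \<eta> \<in> cylinder G (rest_path G x)"
    and "snd (rest_path G x) \<frown> \<eta> \<in> cylinder G (fst y)"
    and "edge_label G (x, y) = lpa_class G t"
  shows "\<exists>\<xi>. \<forall>f n. lpa_act G t f \<eta> n = f \<xi> (n + int (plen (rest_path G x)) - int (plen (fst y)))"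
proof -
  obtain v es w fs where xy: "rest_path G x = (v, es)" "fst y = (w, fs)" by (metis surj_pair)
  have "lpa_act G t = lpa_act G (Times (lpa_star (path_term v es)) (path_term w fs))"
    using assms(5) unfolding edge_label_eq lpa_class_eq_iff by (simp add: xy lpa_eq_imp_act_eq)
  then show ?thesis
    using assms by (auto simp: xy lpa_act_path_term_star lpa_act_path_term plen_def)
qed

lemma edge_label_nonzero:
  assumes "rest_path G x \<in> paths G" "fst y \<in> paths G"
    and "snd (rest_path G x) \<frown> \<eta> \<in> cylinder G (rest_path G x)"
    and "snd (rest_path G x) \<frown> \<eta> \<in> cylinder G (fst y)"
  shows "edge_label G (x, y) \<noteq> \<zero>\<^bsub>leavitt G\<^esub>"
proof
  assume "edge_label G (x, y) = \<zero>\<^bsub>leavitt G\<^esub>"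
  from edge_label_act[OF assms this[unfolded leavitt_zero]] obtain \<xi> where
    "\<forall>f n. (0::int) = f \<xi> (n + int (plen (rest_path G x)) - int (plen (fst y)))" by auto
  from this[rule_format, of "\<lambda>_ _. 1"] show False by simp
qed

text \<open>\<open>edge_degree\<close> is only a relation, since a label might have several forms.
  The grading of the action shows that any form has the expected degree.\<close>

lemma edge_degree_eq:
  assumes "rest_path G x \<in> paths G" "fst y \<in> paths G"
    and "snd (rest_path G x) \<frown> \<eta> \<in> cylinder G (rest_path G x)"
    and "snd (rest_path G x) \<frown> \<eta> \<in> cylinder G (fst y)"
    and "edge_degree G (x, y) d"
  shows "d = int (plen (fst y)) - int (plen (rest_path G x))"
proof -
  define n where "n = int (plen (fst y)) - int (plen (rest_path G x))"
  note act = edge_label_act[OF assms(1-4)]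
  \<comment> \<open>The test function lives in degree 0 only, so a label of degree \<open>d\<close>
    can have a nonzero value at \<open>n\<close> only if \<open>n = d\<close>.\<close>
  have one: "lpa_act G t (\<lambda>_ k. of_bool (k = 0)) \<eta> n = 1" if "edge_label G (x, y) = lpa_class G t" for t
    using act[OF that] by (auto simp: n_def)
  from assms(5) consider
      (pos) v es where "(v, es) \<in> paths G" "edge_label G (x, y) = lpa_path G (v, es)" "d = length es"
    | (zero) v where "edge_label G (x, y) = lpa_P G v" "d = 0"
    | (neg) v es where "(v, es) \<in> paths G" "edge_label G (x, y) = adj (leavitt G) (lpa_path G (v, es))"
        "d = - length es"
    unfolding edge_degree_def by (fastforce simp: plen_def)
  then have "d = n"
  proof cases
    case pos
    then show ?thesis using one[OF pos(2)[unfolded lpa_path_eq]]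
      by (auto simp: lpa_act_path_term split: if_splits)
  next
    case zero
    then show ?thesis using one[OF zero(1)[unfolded lpa_P_def]] by (auto split: if_splits)
  next
    case neg
    then show ?thesis using one[OF neg(2)[unfolded lpa_path_eq leavitt_adj]]
      by (auto simp: lpa_act_path_term_star split: if_splits)
  qed
  then show ?thesis by (simp add: n_def)
qed

lemma edge_degree_zero:
  assumes "rest_path G x \<in> paths G" "rest_path G x = fst y"
  shows "edge_degree G (x, y) 0"
proof -
  obtain v es where x: "rest_path G x = (v, es)" by (metis surj_pair)
  have "edge_label G (x, y) = lpa_P G (prng G (v, es))"
    unfolding edge_label_eq lpa_P_def lpa_class_eq_iff
    using path_term_star_self[of v es] assms by (simp add: x flip: assms(2))
  moreover have "prng G (v, es) \<in> verts G" using assms(1) unfolding x by (rule prng_in_verts)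
  ultimately show ?thesis by (auto simp: edge_degree_def)
qed

end

section \<open>Cuntz-Krieger families\<close>

lemma path_elt_Cons:
  assumes "es \<noteq> []"
  shows "path_elt R p s v (e # es) = s e \<otimes>\<^bsub>R\<^esub> path_elt R p s w es"
proof -
  have "path_elt R p s v (f # fs) = path_elt R p s w (f # fs)" for f fs
    by (induction fs arbitrary: f) auto
  then show ?thesis using assms by (cases es) auto
qed

locale ck_algebra = unital_cstar_algebra A + fin_digraph G
  for A :: "'a cstar" (structure) and G :: "('v, 'e) pre_digraph" +
  fixes p :: "'v \<Rightarrow> 'a" and s :: "'e \<Rightarrow> 'a"
  assumes ck: "ck_family G A p s"
begin

lemma vertex_projection: "v \<in> verts G \<Longrightarrow> projection (p v)"
  using ck by (auto simp: ck_family_def projection_def)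

lemma vertex_orthogonal: "\<lbrakk>v \<in> verts G; w \<in> verts G; v \<noteq> w\<rbrakk> \<Longrightarrow> p v \<otimes> p w = \<zero>"
  using ck by (auto simp: ck_family_def)

lemma arc_closed: "e \<in> arcs G \<Longrightarrow> s e \<in> carrier A"
  using ck by (auto simp: ck_family_def)

lemma arc_partial_isometry: "e \<in> arcs G \<Longrightarrow> s e \<otimes> adj A (s e) \<otimes> s e = s e"
  using ck by (auto simp: ck_family_def)

lemma arc_star_self: "e \<in> arcs G \<Longrightarrow> adj A (s e) \<otimes> s e = p (head G e)"
  using ck by (auto simp: ck_family_def)

lemma vertex_sum: "v \<in> verts G \<Longrightarrow> p v = (\<Oplus>e\<in>{e \<in> arcs G. tail G e = v}. s e \<otimes> adj A (s e))"
  using ck by (auto simp: ck_family_def)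

lemma arc_projection: "e \<in> arcs G \<Longrightarrow> projection (s e \<otimes> adj A (s e))"
  using arc_closed[of e] arc_partial_isometry[of e]
  by (simp add: projection_def adj_closed adj_mult adj_adj m_assoc[symmetric])

text \<open>As \<open>p v\<close> is the sum of the range projections at \<open>v\<close>, the
  complement of \<open>p v\<close> and the ranges of the other edges add up to
  \<open>\<one> \<ominus> q e\<close>. Compression by \<open>q e\<close> kills this sum, hence
  \<open>q e\<close> is orthogonal to each summand.\<close>

lemma arc_projections_orthogonal:
  assumes e: "e \<in> arcs G"
  shows "(\<one> \<ominus> p (tail G e)) \<otimes> (s e \<otimes> adj A (s e)) = \<zero>"
    and "\<lbrakk>f \<in> arcs G; tail G f = tail G e; f \<noteq> e\<rbrakk>
      \<Longrightarrow> (s f \<otimes> adj A (s f)) \<otimes> (s e \<otimes> adj A (s e)) = \<zero>"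
proof -
  define q where "q f = s f \<otimes> adj A (s f)" for f
  define v where "v = tail G e"
  define F where "F = {f \<in> arcs G. tail G f = v} - {e}"
  \<comment> \<open>The index \<open>None\<close> accommodates the complement of the vertex
    projection beside the edges.\<close>
  define g where "g i = (case i of None \<Rightarrow> \<one> \<ominus> p v | Some f \<Rightarrow> q f)" for i
  define I where "I = insert None (Some ` F)"
  have v: "v \<in> verts G" using e by (simp add: v_def)
  note pv = projectionD[OF vertex_projection[OF v]]
  have F: "finite F" "e \<notin> F" "{f \<in> arcs G. tail G f = v} = insert e F"
    using e by (auto simp: F_def v_def)
  have q: "projection (q f)" if "f \<in> arcs G" for f using arc_projection[OF that] by (simp add: q_def)
  have qF: "q \<in> F \<rightarrow> carrier A" using q projectionD(1) by (auto simp: F_def)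
  note qe = projectionD[OF q[OF e]]
  have g: "projection (g i)" if "i \<in> I" for i
    using that vertex_projection[OF v] q by (auto simp: I_def g_def F_def intro!: projection_complement)
  have gI: "g \<in> I \<rightarrow> carrier A" using g projectionD(1) by auto
  have pv_sum: "p v = q e \<oplus> (\<Oplus>f\<in>F. q f)"
    using vertex_sum[OF v] qF qe F by (simp add: q_def[symmetric])
  have fF: "(\<Oplus>f\<in>F. q f) \<in> carrier A" using qF by (rule finsum_closed)
  have "(\<Oplus>i\<in>Some ` F. g i) = (\<Oplus>f\<in>F. q f)"
    using gI by (subst finsum_reindex) (auto simp: I_def g_def)
  moreover have "g None = \<one> \<ominus> p v" by (simp add: g_def)
  ultimately have "(\<Oplus>i\<in>I. g i) = (\<one> \<ominus> p v) \<oplus> (\<Oplus>f\<in>F. q f)"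
    unfolding I_def using gI F by (subst finsum_insert) (auto simp: I_def)
  then have "(\<Oplus>i\<in>I. g i) = \<one> \<ominus> q e"
    using qe fF unfolding pv_sum by (simp add: minus_eq minus_add a_assoc l_neg)
  then have "q e \<otimes> (\<Oplus>i\<in>I. g i) \<otimes> q e = \<zero>"
    using qe by (simp add: minus_eq r_distr l_distr r_minus l_minus r_neg)
  then have orth: "g i \<otimes> q e = \<zero>" if "i \<in> I" for i
    using orthogonal_if_sum_orthogonal[of I g "q e" i] g q[OF e] that F(1) by (simp add: I_def)
  show "(\<one> \<ominus> p (tail G e)) \<otimes> (s e \<otimes> adj A (s e)) = \<zero>"
    using orth[of None] by (simp add: I_def g_def q_def v_def)
  show "(s f \<otimes> adj A (s f)) \<otimes> (s e \<otimes> adj A (s e)) = \<zero>"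
    if "f \<in> arcs G" "tail G f = tail G e" "f \<noteq> e"
    using orth[of "Some f"] that by (simp add: I_def g_def q_def F_def v_def)
qed

lemma tail_arc: "e \<in> arcs G \<Longrightarrow> p (tail G e) \<otimes> s e = s e"
proof -
  assume e: "e \<in> arcs G"
  have p: "p (tail G e) \<in> carrier A" using e by (simp add: projectionD vertex_projection)
  have q: "s e \<otimes> adj A (s e) \<in> carrier A" using e by (simp add: arc_closed adj_closed)
  have "(s e \<otimes> adj A (s e)) \<ominus> p (tail G e) \<otimes> (s e \<otimes> adj A (s e)) = \<zero>"
    using arc_projections_orthogonal(1)[OF e] p q by (simp add: minus_eq l_distr l_minus)
  then have "p (tail G e) \<otimes> (s e \<otimes> adj A (s e)) = s e \<otimes> adj A (s e)"
    using p q minus_equality[of "s e \<otimes> adj A (s e)" "\<ominus> (p (tail G e) \<otimes> (s e \<otimes> adj A (s e)))"]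
    by (simp add: minus_eq)
  then have "p (tail G e) \<otimes> (s e \<otimes> adj A (s e) \<otimes> s e) = s e \<otimes> adj A (s e) \<otimes> s e"
    using p q e by (simp add: arc_closed adj_closed m_assoc[symmetric])
  then show ?thesis using e by (simp add: arc_partial_isometry)
qed

lemma arc_head: "e \<in> arcs G \<Longrightarrow> s e \<otimes> p (head G e) = s e"
  using arc_partial_isometry[of e]
  by (simp add: arc_star_self[symmetric] arc_closed adj_closed m_assoc)

text \<open>In the Leavitt ring this is a defining relation, but \<open>ck_family\<close> does not
  contain it. Insert the range projections if the sources agree, and the source projections
  otherwise.\<close>

lemma arc_orthogonal:
  assumes "e \<in> arcs G" "f \<in> arcs G" "e \<noteq> f"
  shows "adj A (s e) \<otimes> s f = \<zero>"
proof (cases "tail G e = tail G f")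
  case True
  have c: "s e \<in> carrier A" "s f \<in> carrier A" "adj A (s e) \<in> carrier A" "adj A (s f) \<in> carrier A"
    using assms by (auto simp: arc_closed adj_closed)
  have e': "adj A (s e) = adj A (s e) \<otimes> (s e \<otimes> adj A (s e))"
    using arg_cong[OF arc_partial_isometry[OF assms(1)], of "adj A"] c
    by (simp add: adj_mult adj_adj)
  have f': "s f = (s f \<otimes> adj A (s f)) \<otimes> s f" using arc_partial_isometry assms by simp
  have "adj A (s e) \<otimes> s f
    = adj A (s e) \<otimes> ((s e \<otimes> adj A (s e)) \<otimes> (s f \<otimes> adj A (s f))) \<otimes> s f"
    by (subst e', subst f') (use c in \<open>simp add: m_assoc\<close>)
  then show ?thesis using c arc_projections_orthogonal(2)[OF assms(2,1) True assms(3)] by simp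
next
  case False
  have c: "s e \<in> carrier A" "s f \<in> carrier A" "adj A (s e) \<in> carrier A"
    "p (tail G e) \<in> carrier A" "p (tail G f) \<in> carrier A"
    using assms by (auto simp: arc_closed adj_closed projectionD vertex_projection)
  have e': "adj A (s e) = adj A (s e) \<otimes> p (tail G e)"
    using arg_cong[OF tail_arc[OF assms(1)], of "adj A"] c assms
    by (simp add: adj_mult projectionD vertex_projection)
  have f': "s f = p (tail G f) \<otimes> s f" using tail_arc assms by simp
  have "adj A (s e) \<otimes> s f = adj A (s e) \<otimes> (p (tail G e) \<otimes> p (tail G f)) \<otimes> s f"
    by (subst e', subst f') (use c in \<open>simp add: m_assoc\<close>)
  then show ?thesis using c assms False by (simp add: vertex_orthogonal)
qed

section \<open>Partial isometries and projections of paths\<close>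

abbreviation S :: "('v, 'e) gpath \<Rightarrow> 'a" where
  "S \<equiv> S_path A p s"

abbreviation P :: "('v, 'e) gpath \<Rightarrow> 'a" where
  "P \<equiv> proj_path A p s"

lemma vertex_closed: "v \<in> verts G \<Longrightarrow> p v \<in> carrier A"
  by (simp add: projectionD vertex_projection)

lemma S_Nil [simp]: "S (v, []) = p v"
  by (simp add: S_path_def)

lemma S_Cons: "(v, e # es) \<in> paths G \<Longrightarrow> S (v, e # es) = s e \<otimes> S (head G e, es)"
  by (cases "es = []") (auto simp: S_path_def arc_head path_elt_Cons[of es A p s v e "head G e"])

lemma S_closed: "(v, es) \<in> paths G \<Longrightarrow> S (v, es) \<in> carrier A"
  by (induction es arbitrary: v) (auto simp: S_Cons vertex_closed arc_closed)

lemma S_adj_closed: "(v, es) \<in> paths G \<Longrightarrow> adj A (S (v, es)) \<in> carrier A"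
  by (simp add: S_closed adj_closed)

lemma source_S: "(v, es) \<in> paths G \<Longrightarrow> p v \<otimes> S (v, es) = S (v, es)"
proof (cases es)
  case Nil
  assume "(v, es) \<in> paths G"
  then show ?thesis using Nil by (simp add: projectionD vertex_projection)
next
  case (Cons e fs)
  assume "(v, es) \<in> paths G"
  then show ?thesis using Cons tail_arc[of e]
    by (auto simp: S_Cons S_closed vertex_closed arc_closed m_assoc[symmetric])
qed

lemma S_star_self: "(v, es) \<in> paths G \<Longrightarrow> adj A (S (v, es)) \<otimes> S (v, es) = p (prng G (v, es))"
proof (induction es arbitrary: v)
  case Nil
  then show ?case by (simp add: projectionD vertex_projection)
next
  case (Cons e es)
  then have e: "e \<in> arcs G" "(head G e, es) \<in> paths G" by auto
  let ?t = "S (head G e, es)"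
  have c: "s e \<in> carrier A" "adj A (s e) \<in> carrier A" "?t \<in> carrier A" "adj A ?t \<in> carrier A"
    using e by (auto simp: arc_closed adj_closed S_closed)
  have "adj A (S (v, e # es)) \<otimes> S (v, e # es) = adj A ?t \<otimes> (adj A (s e) \<otimes> s e \<otimes> ?t)"
    using Cons(2) c by (simp add: S_Cons adj_mult m_assoc)
  also have "\<dots> = adj A ?t \<otimes> ?t" using e by (simp add: arc_star_self source_S)
  finally show ?case using Cons.IH[OF e(2)] by simp
qed

lemma S_range: "(v, es) \<in> paths G \<Longrightarrow> S (v, es) \<otimes> p (prng G (v, es)) = S (v, es)"
proof (induction es arbitrary: v)
  case Nil
  then show ?case by (simp add: projectionD vertex_projection)
next
  case (Cons e es)
  then have e: "e \<in> arcs G" "(head G e, es) \<in> paths G" by auto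
  then show ?case using Cons prng_in_verts[OF e(2)]
    by (simp add: S_Cons m_assoc arc_closed S_closed vertex_closed del: Cons_in_paths_iff)
qed

lemma S_append:
  "(v, es @ fs) \<in> paths G \<Longrightarrow> S (v, es @ fs) = S (v, es) \<otimes> S (prng G (v, es), fs)"
proof (induction es arbitrary: v)
  case Nil
  then show ?case by (simp add: source_S)
next
  case (Cons e es)
  then have e: "e \<in> arcs G" "(head G e, es @ fs) \<in> paths G" "(v, e # es) \<in> paths G" "(head G e, es) \<in> paths G"
      "(prng G (head G e, es), fs) \<in> paths G"
    by (auto simp: append_in_paths_iff)
  have "S (v, (e # es) @ fs) = s e \<otimes> S (head G e, es @ fs)" using Cons(2) by (simp add: S_Cons)
  also have "\<dots> = s e \<otimes> (S (head G e, es) \<otimes> S (prng G (head G e, es), fs))"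
    using Cons.IH[OF e(2)] by simp
  also have "\<dots> = S (v, e # es) \<otimes> S (prng G (head G e, es), fs)"
    using e by (simp add: S_Cons[OF e(3)] arc_closed S_closed m_assoc)
  finally show ?case by simp
qed

lemma S_orthogonal:
  assumes "(v, es) \<in> paths G" "(w, fs) \<in> paths G"
    and "\<And>zs. \<lbrakk>v = w; fs = es @ zs\<rbrakk> \<Longrightarrow> False" "\<And>zs. \<lbrakk>v = w; es = fs @ zs\<rbrakk> \<Longrightarrow> False"
  shows "adj A (S (v, es)) \<otimes> S (w, fs) = \<zero>"
  using assms
proof (induction es arbitrary: v w fs)
  case Nil
  then have w: "w \<in> verts G" "v \<noteq> w" by (cases fs; auto)+
  have "p v \<otimes> S (w, fs) = p v \<otimes> p w \<otimes> S (w, fs)"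
    using Nil w by (simp add: m_assoc vertex_closed S_closed source_S)
  then show ?case using Nil w
    by (simp add: vertex_orthogonal S_closed projectionD vertex_projection)
next
  case (Cons e es)
  then have e: "e \<in> arcs G" "(head G e, es) \<in> paths G" "tail G e = v" by auto
  let ?t = "S (head G e, es)"
  have c: "s e \<in> carrier A" "adj A (s e) \<in> carrier A" "?t \<in> carrier A" "adj A ?t \<in> carrier A"
    using e by (auto simp: arc_closed adj_closed S_closed)
  show ?case
  proof (cases fs)
    case Nil
    then have w: "v \<noteq> w" "w \<in> verts G" "v \<in> verts G" using Cons e by auto
    have cv: "p v \<in> carrier A" "p w \<in> carrier A" "S (v, e # es) \<in> carrier A" "adj A (S (v, e # es)) \<in> carrier A"
      using w Cons(2) by (auto simp del: Cons_in_paths_iff simp: vertex_closed S_closed adj_closed)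
    have "adj A (S (v, e # es)) = adj A (S (v, e # es)) \<otimes> p v"
      using arg_cong[OF source_S[OF Cons(2)], of "adj A"] cv w
      by (simp add: adj_mult projectionD vertex_projection)
    then have "adj A (S (v, e # es)) \<otimes> p w = adj A (S (v, e # es)) \<otimes> (p v \<otimes> p w)"
      using cv by (metis m_assoc)
    then show ?thesis using Nil w cv by (simp add: vertex_orthogonal)
  next
    case (Cons f gs)
    then have f: "f \<in> arcs G" "(head G f, gs) \<in> paths G" "tail G f = w" "(w, f # gs) \<in> paths G"
      using Cons.prems by auto
    have cf: "s f \<in> carrier A" "S (head G f, gs) \<in> carrier A"
      using f by (auto simp: arc_closed S_closed)
    have eq: "adj A (S (v, e # es)) \<otimes> S (w, f # gs)
      = adj A ?t \<otimes> (adj A (s e) \<otimes> s f) \<otimes> S (head G f, gs)"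
      using S_Cons[OF Cons.prems(1)] S_Cons[OF f(4)] c cf by (simp add: adj_mult m_assoc)
    show ?thesis
    proof (cases "e = f")
      case True
      have "adj A ?t \<otimes> S (head G f, gs) = \<zero>"
        using Cons.prems(3,4) Cons e f True by (intro Cons.IH) auto
      moreover have "p (head G e) \<otimes> S (head G f, gs) = S (head G f, gs)"
        using source_S[OF f(2)] True by simp
      ultimately show ?thesis
        using eq Cons c cf e True vertex_closed[of "head G e"] by (simp add: arc_star_self m_assoc)
    next
      case False
      then show ?thesis using eq Cons c cf e f by (simp add: arc_orthogonal)
    qed
  qed
qed

lemma P_closed: "\<tau> \<in> paths G \<Longrightarrow> P \<tau> \<in> carrier A"
  by (cases \<tau>) (simp add: proj_path_def S_closed S_adj_closed)

lemma P_mult_S_append: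
  assumes "(v, es @ fs) \<in> paths G"
  shows "P (v, es) \<otimes> S (v, es @ fs) = S (v, es @ fs)"
proof -
  have path: "(v, es) \<in> paths G" "(prng G (v, es), fs) \<in> paths G"
    using assms by (auto simp: append_in_paths_iff)
  note c = S_closed[OF path(1)] S_adj_closed[OF path(1)] S_closed[OF path(2)]
  have "P (v, es) \<otimes> S (v, es @ fs)
    = S (v, es) \<otimes> ((adj A (S (v, es)) \<otimes> S (v, es)) \<otimes> S (prng G (v, es), fs))"
    using c by (simp add: proj_path_def S_append[OF assms] m_assoc)
  also have "\<dots> = S (v, es @ fs)" using path by (simp add: S_star_self source_S S_append[OF assms])
  finally show ?thesis .
qed

lemma P_projection: "\<tau> \<in> paths G \<Longrightarrow> projection (P \<tau>)"
proof (cases \<tau>)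
  case (Pair v es)
  assume \<tau>: "\<tau> \<in> paths G"
  then have c: "S \<tau> \<in> carrier A" "adj A (S \<tau>) \<in> carrier A" by (auto simp: Pair S_closed adj_closed)
  have "P \<tau> \<otimes> P \<tau> = P \<tau> \<otimes> S \<tau> \<otimes> adj A (S \<tau>)"
    using c by (simp add: proj_path_def m_assoc)
  also have "P \<tau> \<otimes> S \<tau> = S \<tau>" using P_mult_S_append[of v es "[]"] \<tau> Pair by simp
  finally have "P \<tau> \<otimes> P \<tau> = P \<tau>" by (simp add: proj_path_def)
  moreover have "adj A (P \<tau>) = P \<tau>" using c by (simp add: proj_path_def adj_mult adj_adj)
  ultimately show ?thesis using P_closed[OF \<tau>] by (simp add: projection_def)
qed

text \<open>Two cylinders are nested or disjoint. This makes the span of the path projections stable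
  under multiplication by each of them.\<close>

lemma P_mult_P:
  assumes "\<tau> \<in> paths G" "\<nu> \<in> paths G"
  shows "P \<tau> \<otimes> P \<nu> \<in> {P \<tau>, P \<nu>, \<zero>}"
proof -
  obtain v es w fs where \<tau>\<nu>: "\<tau> = (v, es)" "\<nu> = (w, fs)" by (metis surj_pair)
  have ext: "P (v, es) \<otimes> P (v, es @ fs) = P (v, es @ fs)" if "(v, es @ fs) \<in> paths G" for v es fs
  proof -
    have "P (v, es) \<in> carrier A" using that by (simp add: append_in_paths_iff P_closed)
    then have "P (v, es) \<otimes> P (v, es @ fs) = (P (v, es) \<otimes> S (v, es @ fs)) \<otimes> adj A (S (v, es @ fs))"
      using that S_closed[OF that] S_adj_closed[OF that] by (simp add: proj_path_def[of A p s "(v, es @ fs)"] m_assoc)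
    then show ?thesis using that by (simp only: P_mult_S_append) (simp add: proj_path_def)
  qed
  consider (left) zs where "v = w" "fs = es @ zs" | (right) zs where "v = w" "es = fs @ zs"
    | (none) "\<And>zs. \<lbrakk>v = w; fs = es @ zs\<rbrakk> \<Longrightarrow> False" "\<And>zs. \<lbrakk>v = w; es = fs @ zs\<rbrakk> \<Longrightarrow> False" by blast
  then show ?thesis
  proof cases
    case left
    then show ?thesis using ext[of v es zs] assms by (simp add: \<tau>\<nu>)
  next
    case right
    have "P \<nu> \<otimes> P \<tau> = P \<tau>" using ext[of v fs zs] right assms by (simp add: \<tau>\<nu>)
    then have "adj A (P \<nu> \<otimes> P \<tau>) = adj A (P \<tau>)" by simp
    then have "P \<tau> \<otimes> P \<nu> = P \<tau>"
      using projectionD[OF P_projection[OF assms(1)]] projectionD[OF P_projection[OF assms(2)]]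
      by (simp add: adj_mult)
    then show ?thesis by simp
  next
    case none
    note c = S_closed[OF assms(1)[unfolded \<tau>\<nu>]] S_adj_closed[OF assms(1)[unfolded \<tau>\<nu>]]
      S_closed[OF assms(2)[unfolded \<tau>\<nu>]] S_adj_closed[OF assms(2)[unfolded \<tau>\<nu>]]
    have "P \<tau> \<otimes> P \<nu> = S \<tau> \<otimes> (adj A (S \<tau>) \<otimes> S \<nu>) \<otimes> adj A (S \<nu>)"
      using c by (simp add: proj_path_def \<tau>\<nu> m_assoc)
    also have "adj A (S \<tau>) \<otimes> S \<nu> = \<zero>"
      unfolding \<tau>\<nu> using assms none by (intro S_orthogonal) (auto simp: \<tau>\<nu>)
    finally show ?thesis using c by (simp add: \<tau>\<nu>)
  qed
qed

lemma lin_span_closed: "x \<in> lin_span A (P ` paths G) \<Longrightarrow> x \<in> carrier A"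
  by (induction rule: lin_span.induct) (auto simp: scale_closed P_closed)

lemma P_mult_lin_span:
  assumes "\<tau> \<in> paths G" "x \<in> lin_span A (P ` paths G)"
  shows "P \<tau> \<otimes> x \<in> lin_span A (P ` paths G)"
  using assms(2)
proof (induction rule: lin_span.induct)
  case lin_span_zero
  then show ?case using assms by (simp add: P_closed lin_span.lin_span_zero)
next
  case (lin_span_step x y a)
  then obtain \<nu> where \<nu>: "\<nu> \<in> paths G" "x = P \<nu>" by auto
  have c: "P \<tau> \<in> carrier A" "P \<nu> \<in> carrier A" "y \<in> carrier A" "P \<tau> \<otimes> y \<in> carrier A"
    using assms(1) \<nu>(1) lin_span_step(2) by (auto simp: P_closed lin_span_closed)
  have eq: "P \<tau> \<otimes> (cscale A a x \<oplus> y) = cscale A a (P \<tau> \<otimes> P \<nu>) \<oplus> P \<tau> \<otimes> y"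
    using c \<nu> by (simp add: r_distr scale_closed scale_mult_right)
  show ?case
  proof (cases "P \<tau> \<otimes> P \<nu> = \<zero>")
    case True
    then show ?thesis using eq c lin_span_step by (simp add: scale_zero_right)
  next
    case False
    then have "P \<tau> \<otimes> P \<nu> \<in> P ` paths G" using P_mult_P[OF assms(1) \<nu>(1)] assms(1) \<nu>(1) by auto
    then show ?thesis unfolding eq using lin_span_step by (intro lin_span.lin_span_step)
  qed
qed

section \<open>The diagonal subalgebra\<close>

abbreviation D :: "'a set" where
  "D \<equiv> carrier (diagonal G A p s)"

lemma D_eq: "D = norm_closure A (lin_span A (P ` paths G))"
  by (simp add: diagonal_def)

lemma D_closed: "x \<in> D \<Longrightarrow> x \<in> carrier A"
  by (simp add: D_eq norm_closure_def)

lemma P_in_D: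
  assumes "\<tau> \<in> paths G"
  shows "P \<tau> \<in> D"
proof -
  have "cscale A 1 (P \<tau>) \<oplus> \<zero> \<in> lin_span A (P ` paths G)"
    using assms by (intro lin_span.intros) auto
  then have "P \<tau> \<in> lin_span A (P ` paths G)" using P_closed[OF assms] by (simp add: scale_one)
  moreover have "cnorm A (P \<tau> \<ominus> P \<tau>) = 0" using P_closed[OF assms] by (simp add: r_neg minus_eq norm_zero)
  ultimately show ?thesis using P_closed[OF assms] unfolding D_eq norm_closure_def by force
qed

lemma P_mult_D:
  assumes "\<tau> \<in> paths G" "x \<in> D"
  shows "P \<tau> \<otimes> x \<in> D"
proof -
  have c: "P \<tau> \<in> carrier A" "x \<in> carrier A" using assms by (auto simp: P_closed D_closed)
  have "\<exists>y \<in> lin_span A (P ` paths G). cnorm A (P \<tau> \<otimes> x \<ominus> y) < \<epsilon>" if "\<epsilon> > 0" for \<epsilon> :: real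
  proof -
    from assms(2) that obtain y where y: "y \<in> lin_span A (P ` paths G)" "cnorm A (x \<ominus> y) < \<epsilon>"
      unfolding D_eq norm_closure_def by auto
    have yc: "y \<in> carrier A" using y(1) by (rule lin_span_closed)
    have "P \<tau> \<otimes> x \<ominus> P \<tau> \<otimes> y = P \<tau> \<otimes> (x \<ominus> y)"
      using c yc by (simp add: minus_eq r_distr r_minus)
    then have "cnorm A (P \<tau> \<otimes> x \<ominus> P \<tau> \<otimes> y) \<le> cnorm A (P \<tau>) * cnorm A (x \<ominus> y)"
      using c yc by (simp add: norm_mult)
    also have "\<dots> \<le> 1 * cnorm A (x \<ominus> y)"
      using c yc by (intro mult_right_mono norm_projection P_projection assms(1) norm_nonneg) auto
    finally show ?thesis using y P_mult_lin_span[OF assms(1)] by force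
  qed
  then show ?thesis using c unfolding D_eq norm_closure_def by auto
qed

end

text \<open>Comparable second components would share an infinite path through the longer one,
  contradicting uniqueness.\<close>

lemma (in fin_digraph) admissible_prefix_eq:
  assumes "admissible G J" "no_sinks G" "x \<in> J" "y \<in> J" "snd x = (v, es)" "snd y = (v, es @ fs)"
  shows "x = y"
proof -
  have y: "(v, es @ fs) \<in> paths G" using admissible_paths(2)[OF assms(1,4)] assms(6) by simp
  obtain \<eta> where \<eta>: "\<eta> \<in> inf_paths G" "tail G (\<eta> 0) = prng G (v, es @ fs)"
    using inf_path_from_vertex[OF assms(2) prng_in_verts[OF y]] by blast
  define \<gamma> where "\<gamma> = (es @ fs) \<frown> \<eta>"
  have y': "\<gamma> \<in> cylinder G (snd y)"
    unfolding assms(6) \<gamma>_def using conc_in_cylinder_iff[OF y] \<eta> by blast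
  then have "\<gamma> \<in> cylinder G (snd x)"
    unfolding assms(5,6) by (auto simp: cylinder_def psrc_def plen_def nth_append)
  moreover have "\<gamma> \<in> inf_paths G" using y' by (auto simp: cylinder_def)
  ultimately show ?thesis using admissible_unique[OF assms(1)] y' assms(3,4) by blast
qed

context ck_algebra
begin

lemma u_closed:
  assumes "admissible G J"
  shows "u_elt A p s J \<in> carrier A"
proof -
  have "S (fst x) \<otimes> adj A (S (snd x)) \<in> carrier A" if "x \<in> J" for x
    using admissible_paths(1,2)[OF assms that] S_closed[of "fst (fst x)" "snd (fst x)"]
      S_adj_closed[of "fst (snd x)" "snd (snd x)"] by simp
  then show ?thesis unfolding u_elt_def by (intro finsum_closed) auto
qed

text \<open>Different second components are incomparable, so their elements are orthogonal and only
  the summand of \<open>x\<close> survives. This carries admissibility from the Leavitt ring over to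
  \<open>A\<close>.\<close>

lemma u_mult_S:
  assumes "admissible G J" "no_sinks G" "x \<in> J"
  shows "u_elt A p s J \<otimes> S (snd x) = S (fst x)"
proof -
  have path: "fst y \<in> paths G" "snd y \<in> paths G" "prng G (fst y) = prng G (snd y)" if "y \<in> J" for y
    using admissible_paths[OF assms(1) that] by auto
  have c: "S (fst y) \<in> carrier A" "S (snd y) \<in> carrier A" "adj A (S (snd y)) \<in> carrier A" if "y \<in> J" for y
    using path[OF that] by (cases "fst y"; cases "snd y"; simp add: S_closed S_adj_closed)+
  have orth: "adj A (S (snd y)) \<otimes> S (snd x) = \<zero>" if y: "y \<in> J" "x \<noteq> y" for y
  proof -
    obtain v es w fs where xy: "snd y = (v, es)" "snd x = (w, fs)" by (metis surj_pair)
    show ?thesis unfolding xy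
    proof (rule S_orthogonal)
      show "(v, es) \<in> paths G" "(w, fs) \<in> paths G" using path(2) y(1) assms(3) by (auto simp flip: xy)
      show False if "v = w" "fs = es @ zs" for zs
        using admissible_prefix_eq[OF assms(1,2) y(1) assms(3), of v es zs] xy that y(2) by simp
      show False if "v = w" "es = fs @ zs" for zs
        using admissible_prefix_eq[OF assms(1,2) assms(3) y(1), of v fs zs] xy that y(2) by simp
    qed
  qed
  have self: "S (fst x) \<otimes> (adj A (S (snd x)) \<otimes> S (snd x)) = S (fst x)"
    using S_star_self[of "fst (snd x)" "snd (snd x)"] S_range[of "fst (fst x)" "snd (fst x)"]
      path[OF assms(3)] by simp
  have "u_elt A p s J \<otimes> S (snd x) = (\<Oplus>y\<in>J. S (fst y) \<otimes> adj A (S (snd y)) \<otimes> S (snd x))"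
    unfolding u_elt_def using c assms(3) admissible_finite[OF assms(1)]
    by (intro finsum_ldistr) auto
  also have "\<dots> = (\<Oplus>y\<in>J. if x = y then S (fst y) else \<zero>)"
    using c assms(3) orth self by (intro finsum_cong') (auto simp: m_assoc)
  also have "\<dots> = S (fst x)"
    using c assms(3) admissible_finite[OF assms(1)] by (intro finsum_singleton) auto
  finally show ?thesis .
qed

end

section \<open>The induced homeomorphism\<close>

lemma topspace_inf_path_topology [simp]: "topspace (inf_path_topology G) = inf_paths G"
  by (auto simp: inf_path_topology_def inf_paths_arc)

lemma openin_cylinder: "openin (inf_path_topology G) (cylinder G \<tau>)"
proof -
  \<comment> \<open>Coordinate 0 also records the source, which is the only condition when the path
    has length zero.\<close>
  define U where "U i = {e \<in> arcs G. (i = 0 \<longrightarrow> tail G e = psrc \<tau>) \<and> (i < plen \<tau> \<longrightarrow> e = snd \<tau> ! i)}" for i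
  have "{i. U i \<noteq> arcs G} \<subseteq> {..plen \<tau>}"
    by (auto simp: U_def)
  then have "openin (product_topology (\<lambda>_. discrete_topology (arcs G)) UNIV) (Pi\<^sub>E UNIV U)"
    by (intro product_topology_basis) (auto simp: U_def intro: finite_subset)
  moreover have "cylinder G \<tau> = Pi\<^sub>E UNIV U \<inter> inf_paths G"
    by (auto simp: cylinder_def U_def inf_paths_arc PiE_iff)
  ultimately show ?thesis unfolding inf_path_topology_def openin_subtopology by blast
qed

lemma inf_path_neighbourhood:
  assumes "openin (inf_path_topology G) W" "\<gamma> \<in> W"
  obtains n where "\<And>\<xi>. \<lbrakk>\<xi> \<in> inf_paths G; \<And>i. i < n \<Longrightarrow> \<xi> i = \<gamma> i\<rbrakk> \<Longrightarrow> \<xi> \<in> W"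
proof -
  obtain W' where W': "openin (product_topology (\<lambda>_. discrete_topology (arcs G)) UNIV) W'"
    "W = W' \<inter> inf_paths G"
    using assms(1) unfolding inf_path_topology_def openin_subtopology by blast
  then have "\<gamma> \<in> W'" using assms(2) by blast
  with W'(1) obtain U where U: "finite {i. U i \<noteq> arcs G}" "\<gamma> \<in> Pi\<^sub>E UNIV U" "Pi\<^sub>E UNIV U \<subseteq> W'"
    unfolding openin_product_topology_alt by auto
  obtain n where n: "\<forall>i \<in> {i. U i \<noteq> arcs G}. i < n"
    using U(1) finite_nat_set_iff_bounded by blast
  show thesis
  proof
    fix \<xi> assume \<xi>: "\<xi> \<in> inf_paths G" "\<And>i. i < n \<Longrightarrow> \<xi> i = \<gamma> i"
    have "\<xi> i \<in> U i" for i
    proof (cases "U i = arcs G")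
      case True
      then show ?thesis using \<xi>(1) by (simp add: inf_paths_arc)
    next
      case False
      then have "\<xi> i = \<gamma> i" using n \<xi>(2) by blast
      then show ?thesis using U(2) by auto
    qed
    then have "\<xi> \<in> W'" using U(3) by (auto simp: PiE_iff)
    then show "\<xi> \<in> W" using W'(2) \<xi>(1) by blast
  qed
qed

lemma (in wf_digraph) prefix_in_paths:
  "\<gamma> \<in> inf_paths G \<Longrightarrow> (tail G (\<gamma> 0), prefix n \<gamma>) \<in> paths G \<and> prng G (tail G (\<gamma> 0), prefix n \<gamma>) = tail G (\<gamma> n)"
proof (induction n)
  case 0
  then show ?case by (simp add: inf_paths_arc)
next
  case (Suc n)
  then show ?case using inf_paths_head[of \<gamma> G n]
    by (auto simp: append_in_paths_iff prng_append inf_paths_arc)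
qed

locale induced_dynamics = ck_algebra A G p s
  for A :: "'a cstar" (structure) and G :: "('v, 'e) pre_digraph" and p :: "'v \<Rightarrow> 'a" and s :: "'e \<Rightarrow> 'a" +
  fixes J :: "('v, 'e) jpair set"
    and \<Phi> :: "'a \<Rightarrow> (nat \<Rightarrow> 'e) \<Rightarrow> complex" and lam :: "'a \<Rightarrow> 'a" and \<psi> k :: "(nat \<Rightarrow> 'e) \<Rightarrow> nat \<Rightarrow> 'e"
  assumes no_sinks: "no_sinks G"
    and admissible: "admissible G J"
    and diagonal_identification: "diagonal_identification G A p s \<Phi>"
    and endomorphism: "cuntz_endomorphism G A p s (u_elt A p s J) lam"
    and homeomorphism: "homeomorphic_maps (inf_path_topology G) (inf_path_topology G) k \<psi>"
    and intertwining: "d \<in> carrier (diagonal G A p s) \<Longrightarrow>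
      lam d \<in> carrier (diagonal G A p s) \<and> \<Phi> (lam d) = restrict (\<Phi> d \<circ> k) (inf_paths G)"
begin

lemma \<psi>_k:
  assumes "\<gamma> \<in> inf_paths G"
  shows "\<psi> \<gamma> \<in> inf_paths G" "k \<gamma> \<in> inf_paths G" "k (\<psi> \<gamma>) = \<gamma>" "\<psi> (k \<gamma>) = \<gamma>"
  using assms homeomorphism unfolding homeomorphic_maps_def continuous_map_def by auto

lemma \<Phi>_lam: "\<lbrakk>d \<in> D; \<gamma> \<in> inf_paths G\<rbrakk> \<Longrightarrow> \<Phi> (lam d) \<gamma> = \<Phi> d (k \<gamma>)"
  using intertwining by simp

lemma \<Phi>_P: "\<lbrakk>\<tau> \<in> paths G; \<gamma> \<in> inf_paths G\<rbrakk> \<Longrightarrow> \<Phi> (P \<tau>) \<gamma> = indicator (cylinder G \<tau>) \<gamma>"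
  using diagonal_identification by (simp add: diagonal_identification_def)

lemma \<Phi>_P_mult:
  assumes "\<tau> \<in> paths G" "x \<in> D" "\<gamma> \<in> inf_paths G"
  shows "\<Phi> (P \<tau> \<otimes> x) \<gamma> = indicator (cylinder G \<tau>) \<gamma> * \<Phi> x \<gamma>"
proof -
  have "\<Phi> (P \<tau> \<otimes> x) = \<Phi> (P \<tau>) \<otimes>\<^bsub>cont_functions (inf_path_topology G)\<^esub> \<Phi> x"
    using diagonal_identification P_in_D[OF assms(1)] assms(2)
    unfolding diagonal_identification_def star_iso_def star_hom_def by (simp add: diagonal_def)
  then show ?thesis using assms(3) by (simp add: cont_functions_def \<Phi>_P[OF assms(1)])
qed

text \<open>With its converse \<open>P_mult_eqD\<close>, this expresses a support inclusion as an
  algebraic identity. Such an identity can be multiplied by \<open>u s\<^sub>e\<close>, which need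
  not lie in the diagonal.\<close>

lemma P_mult_eqI:
  assumes "\<tau> \<in> paths G" "x \<in> D"
    and "\<And>\<gamma>. \<lbrakk>\<gamma> \<in> inf_paths G; \<Phi> x \<gamma> \<noteq> 0\<rbrakk> \<Longrightarrow> \<gamma> \<in> cylinder G \<tau>"
  shows "P \<tau> \<otimes> x = x"
proof -
  have bij: "bij_betw \<Phi> D (carrier (cont_functions (inf_path_topology G)))"
    using diagonal_identification by (simp add: diagonal_identification_def star_iso_def)
  have ext: "\<Phi> y \<in> extensional (inf_paths G)" if "y \<in> D" for y
    using bij_betwE[OF bij] that by (auto simp: cont_functions_def)
  have D: "P \<tau> \<otimes> x \<in> D" using assms(1,2) by (rule P_mult_D)
  have "\<Phi> (P \<tau> \<otimes> x) = \<Phi> x"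
  proof (rule extensionalityI[OF ext[OF D] ext[OF assms(2)]])
    fix \<gamma> assume \<gamma>: "\<gamma> \<in> inf_paths G"
    show "\<Phi> (P \<tau> \<otimes> x) \<gamma> = \<Phi> x \<gamma>"
      using \<Phi>_P_mult[OF assms(1,2) \<gamma>] assms(3)[OF \<gamma>] by (cases "\<Phi> x \<gamma> = 0") auto
  qed
  then show ?thesis using bij D assms(2) by (auto simp: bij_betw_def dest: inj_onD)
qed

lemma P_mult_eqD:
  assumes "\<tau> \<in> paths G" "x \<in> D" "P \<tau> \<otimes> x = x" "\<gamma> \<in> inf_paths G" "\<Phi> x \<gamma> \<noteq> 0"
  shows "\<gamma> \<in> cylinder G \<tau>"
  using \<Phi>_P_mult[OF assms(1,2,4)] assms(3,5) by (auto simp: indicator_def split: if_splits)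

lemma lam_simps:
  "x \<in> carrier A \<Longrightarrow> lam x \<in> carrier A"
  "\<lbrakk>x \<in> carrier A; y \<in> carrier A\<rbrakk> \<Longrightarrow> lam (x \<otimes> y) = lam x \<otimes> lam y"
  "x \<in> carrier A \<Longrightarrow> lam (adj A x) = adj A (lam x)"
  "e \<in> arcs G \<Longrightarrow> lam (s e) = u_elt A p s J \<otimes> s e"
  "v \<in> verts G \<Longrightarrow> lam (p v) = p v"
  using endomorphism by (auto simp: cuntz_endomorphism_def star_hom_def)

text \<open>The endomorphism fixes the vertex projections, that is, the indicator functions of the
  sets of paths with a given source.\<close>

lemma \<psi>_source:
  assumes "\<gamma> \<in> inf_paths G"
  shows "tail G (\<psi> \<gamma> 0) = tail G (\<gamma> 0)"
proof -
  define v where "v = tail G (\<gamma> 0)"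
  have v: "v \<in> verts G" using inf_paths_arc[OF assms] by (simp add: v_def)
  have P: "P (v, []) = p v" using v by (simp add: proj_path_def projectionD vertex_projection)
  have pD: "p v \<in> D" using P_in_D[of "(v, [])"] v by (simp add: P)
  have "\<Phi> (p v) (\<psi> \<gamma>) = \<Phi> (p v) \<gamma>"
    using \<Phi>_lam[OF pD \<psi>_k(1)[OF assms]] \<psi>_k(3)[OF assms] v by (simp add: lam_simps)
  moreover have "\<Phi> (p v) \<gamma> = 1"
    using \<Phi>_P[of "(v, [])" \<gamma>] assms v by (simp add: P cylinder_def psrc_def plen_def flip: v_def)
  ultimately have "indicator (cylinder G (v, [])) (\<psi> \<gamma>) = (1 :: complex)"
    using \<Phi>_P[of "(v, [])" "\<psi> \<gamma>"] v \<psi>_k(1)[OF assms] by (simp add: P)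
  then show ?thesis by (simp add: indicator_def cylinder_def psrc_def v_def split: if_splits)
qed

text \<open>
  Continuity of \<open>\<psi>\<close> gives \<open>p\<^sub>\<sigma> \<lambda>(p\<^sub>\<pi>) = \<lambda>(p\<^sub>\<pi>)\<close> for \<open>\<sigma> = \<nu> z\<close> and some initial segment \<open>\<pi>\<close> of \<open>\<gamma>\<close>;
  conjugating with \<open>u s\<^sub>e\<close>, where \<open>u s\<^sub>e s\<^sub>\<sigma> = s\<^sub>\<mu>\<^sub>z\<close>, yields the same relation for \<open>\<mu> z\<close> and \<open>e \<pi>\<close>.
\<close>

lemma \<psi>_cylinder_step:
  assumes x: "x \<in> J" "snd x = (v, e # \<nu>)" "fst x = (w, \<mu>')"
    and zs: "(v, (e # \<nu>) @ zs) \<in> paths G"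
    and \<gamma>: "e ## \<gamma> \<in> inf_paths G" "\<psi> \<gamma> \<in> cylinder G (head G e, \<nu> @ zs)"
  shows "\<psi> (e ## \<gamma>) \<in> cylinder G (v, \<mu>' @ zs)"
proof -
  let ?u = "u_elt A p s J"
  define \<sigma> where "\<sigma> = (head G e, \<nu> @ zs)"
  have w: "w = v" and rng: "prng G (v, \<mu>') = prng G (v, e # \<nu>)" and p\<mu>: "(v, \<mu>') \<in> paths G"
    using admissible_paths[OF admissible x(1)] x(2,3) by (auto simp: psrc_def)
  have e: "e \<in> arcs G" "tail G e = v" "\<sigma> \<in> paths G" "(v, e # \<nu>) \<in> paths G"
      "(prng G (v, e # \<nu>), zs) \<in> paths G"
    using zs by (auto simp: \<sigma>_def append_in_paths_iff)
  have \<tau>: "(v, \<mu>' @ zs) \<in> paths G" using p\<mu> e(5) rng by (simp add: append_in_paths_iff)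
  have \<gamma>': "\<gamma> \<in> inf_paths G" "tail G (\<gamma> 0) = head G e" using \<gamma>(1) by (auto simp: build_in_inf_paths_iff)
  have "openin (inf_path_topology G) {\<xi> \<in> inf_paths G. \<psi> \<xi> \<in> cylinder G \<sigma>}"
    using homeomorphism openin_cylinder[of G \<sigma>]
    unfolding homeomorphic_maps_def continuous_map_def by auto
  moreover have "\<gamma> \<in> {\<xi> \<in> inf_paths G. \<psi> \<xi> \<in> cylinder G \<sigma>}" using \<gamma> \<gamma>' by (simp add: \<sigma>_def)
  ultimately obtain n where n: "\<And>\<xi>. \<lbrakk>\<xi> \<in> inf_paths G; \<And>i. i < n \<Longrightarrow> \<xi> i = \<gamma> i\<rbrakk>
      \<Longrightarrow> \<xi> \<in> {\<xi> \<in> inf_paths G. \<psi> \<xi> \<in> cylinder G \<sigma>}"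
    by (rule inf_path_neighbourhood) blast
  define es where "es = prefix n \<gamma>"
  define \<pi> where "\<pi> = (head G e, es)"
  have \<pi>: "\<pi> \<in> paths G" using prefix_in_paths[OF \<gamma>'(1), of n] \<gamma>'(2) by (simp add: \<pi>_def es_def)
  have e\<pi>: "(v, e # es) \<in> paths G" using \<pi> e by (simp add: \<pi>_def)
  define a where "a = lam (P \<pi>)"
  define b where "b = lam (P (v, e # es))"
  have D: "a \<in> D" "b \<in> D"
    using P_in_D[OF \<pi>] P_in_D[OF e\<pi>] intertwining by (auto simp: a_def b_def)
  have "P \<sigma> \<otimes> a = a"
  proof (rule P_mult_eqI[OF e(3) D(1)])
    fix \<xi> assume \<xi>: "\<xi> \<in> inf_paths G" "\<Phi> a \<xi> \<noteq> 0"
    then have "k \<xi> \<in> cylinder G \<pi>"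
      using \<Phi>_lam[OF P_in_D[OF \<pi>] \<xi>(1)] \<Phi>_P[OF \<pi> \<psi>_k(2)[OF \<xi>(1)]]
      by (auto simp: a_def indicator_def split: if_splits)
    then have "\<psi> (k \<xi>) \<in> cylinder G \<sigma>"
      using n[of "k \<xi>"] by (auto simp: cylinder_def \<pi>_def plen_def es_def)
    then show "\<xi> \<in> cylinder G \<sigma>" using \<psi>_k(4)[OF \<xi>(1)] by simp
  qed
  have cu: "?u \<in> carrier A" using admissible by (rule u_closed)
  have c: "s e \<in> carrier A" "a \<in> carrier A" "P \<sigma> \<in> carrier A" "S \<sigma> \<in> carrier A" "adj A (S \<sigma>) \<in> carrier A"
      "S (v, e # \<nu>) \<in> carrier A" "S (prng G (v, e # \<nu>), zs) \<in> carrier A"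
      "S (v, \<mu>' @ zs) \<in> carrier A" "P (v, \<mu>' @ zs) \<in> carrier A" "P \<pi> \<in> carrier A"
    using e(1) D(1) e(3) P_closed[OF e(3)] S_closed[OF e(4)] S_closed[OF e(5)] S_closed[OF \<tau>] P_closed[OF \<tau>]
      P_closed[OF \<pi>]
    by (auto simp: arc_closed D_closed \<sigma>_def S_closed adj_closed)
  define f where "f = ?u \<otimes> s e"
  have cf: "f \<in> carrier A" "adj A f \<in> carrier A" using cu c by (auto simp: f_def adj_closed)
  \<comment> \<open>The aim is \<open>f p\<^sub>\<sigma> = s\<^sub>\<mu>\<^sub>z
    s\<^sub>\<sigma>\<^sup>*\<close>, whose left factor shows that its range lies below the
    projection of the path \<mu>z.\<close>
  have "f \<otimes> P \<sigma> = ?u \<otimes> (s e \<otimes> S \<sigma>) \<otimes> adj A (S \<sigma>)"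
    using cu c by (simp add: f_def proj_path_def m_assoc)
  also have "s e \<otimes> S \<sigma> = S (v, (e # \<nu>) @ zs)"
    using zs by (simp add: S_Cons \<sigma>_def)
  also have "\<dots> = S (v, e # \<nu>) \<otimes> S (prng G (v, e # \<nu>), zs)" using zs by (rule S_append)
  also have "?u \<otimes> (S (v, e # \<nu>) \<otimes> S (prng G (v, e # \<nu>), zs))
      = (?u \<otimes> S (v, e # \<nu>)) \<otimes> S (prng G (v, e # \<nu>), zs)"
    using cu c by (simp add: m_assoc)
  also have "?u \<otimes> S (v, e # \<nu>) = S (v, \<mu>')"
    using u_mult_S[OF admissible no_sinks x(1)] by (simp add: x w)
  also have "S (v, \<mu>') \<otimes> S (prng G (v, e # \<nu>), zs) = S (v, \<mu>' @ zs)"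
    using S_append[OF \<tau>] rng by simp
  finally have fP: "f \<otimes> P \<sigma> = S (v, \<mu>' @ zs) \<otimes> adj A (S \<sigma>)" .
  have "P (v, \<mu>' @ zs) \<otimes> (f \<otimes> P \<sigma>) = (P (v, \<mu>' @ zs) \<otimes> S (v, \<mu>' @ zs)) \<otimes> adj A (S \<sigma>)"
    unfolding fP using c by (simp add: m_assoc)
  then have absorb: "P (v, \<mu>' @ zs) \<otimes> (f \<otimes> P \<sigma>) = f \<otimes> P \<sigma>"
    using P_mult_S_append[of v "\<mu>' @ zs" "[]"] \<tau> fP by simp
  have "P (v, e # es) = s e \<otimes> P \<pi> \<otimes> adj A (s e)"
    using S_Cons[OF e\<pi>] c \<pi> S_closed[of "head G e" es]
    by (simp add: proj_path_def \<pi>_def adj_mult adj_closed m_assoc)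
  \<comment> \<open>Since \<open>lam (s e) = f\<close>, applying \<open>lam\<close> turns
    conjugation by \<open>s e\<close> into conjugation by \<open>f\<close>.\<close>
  then have "b = f \<otimes> a \<otimes> adj A f"
    using c e(1) by (simp add: b_def a_def f_def lam_simps adj_closed)
  then have b: "b = (f \<otimes> P \<sigma>) \<otimes> (a \<otimes> adj A f)"
    using \<open>P \<sigma> \<otimes> a = a\<close> c cf by (metis m_assoc m_closed)
  then have "P (v, \<mu>' @ zs) \<otimes> b = b"
    using absorb c cf by (metis m_assoc m_closed)
  moreover have "\<Phi> b (\<psi> (e ## \<gamma>)) \<noteq> 0"
  proof -
    have "e ## \<gamma> \<in> cylinder G (v, e # es)"
      unfolding cylinder_Cons_iff[OF e\<pi>] using \<gamma> \<gamma>' by (simp add: cylinder_def psrc_def plen_def es_def)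
    then show ?thesis
      using \<Phi>_lam[OF P_in_D[OF e\<pi>] \<psi>_k(1)[OF \<gamma>(1)]] \<Phi>_P[OF e\<pi> \<gamma>(1)] \<psi>_k(3)[OF \<gamma>(1)]
      by (simp add: b_def)
  qed
  ultimately show ?thesis using P_mult_eqD[OF \<tau> D(2)] \<psi>_k(1)[OF \<gamma>(1)] by blast
qed

lemma \<psi>_build:
  assumes x: "x \<in> J" "snd x = (v, e # \<nu>)" "fst x = (w, \<mu>')"
    and \<gamma>: "e ## \<gamma> \<in> inf_paths G" "\<psi> \<gamma> = \<nu> \<frown> \<eta>" "\<psi> \<gamma> \<in> cylinder G (head G e, \<nu>)"
  shows "\<psi> (e ## \<gamma>) = \<mu>' \<frown> \<eta>"
proof
  fix j
  have path: "(v, e # \<nu>) \<in> paths G" "(head G e, \<nu>) \<in> paths G"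
    using admissible_paths(2)[OF admissible x(1)] x(2) by auto
  have \<eta>: "\<eta> \<in> inf_paths G" "tail G (\<eta> 0) = prng G (head G e, \<nu>)"
    using conc_in_cylinder_iff[OF path(2), of \<eta>] \<gamma>(2,3) by auto
  \<comment> \<open>Taking \<open>Suc j\<close> letters guarantees that position \<open>j\<close> is
    covered even if \<mu>' is empty.\<close>
  define zs where "zs = prefix (Suc j) \<eta>"
  have zs: "(prng G (head G e, \<nu>), zs) \<in> paths G"
    using prefix_in_paths[OF \<eta>(1), of "Suc j"] \<eta>(2) by (simp add: zs_def)
  have "\<psi> \<gamma> = (\<nu> @ zs) \<frown> suffix (Suc j) \<eta>"
    using \<gamma>(2) prefix_suffix[of \<eta> "Suc j"] by (simp add: zs_def del: subseq_to_Suc flip: conc_conc)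
  then have "\<psi> \<gamma> \<in> cylinder G (head G e, \<nu> @ zs)"
    using \<gamma>(3) by (simp add: cylinder_def plen_def psrc_def del: conc_conc)
  then have "\<psi> (e ## \<gamma>) \<in> cylinder G (v, \<mu>' @ zs)"
    using path zs by (intro \<psi>_cylinder_step[OF x _ \<gamma>(1)]) (auto simp: append_in_paths_iff)
  then have "\<psi> (e ## \<gamma>) j = (\<mu>' @ zs) ! j"
    by (simp add: cylinder_def plen_def zs_def del: subseq_to_Suc)
  also have "\<dots> = (\<mu>' \<frown> \<eta>) j"
    by (simp add: nth_append conc_def zs_def del: subseq_to_Suc)
  finally show "\<psi> (e ## \<gamma>) j = (\<mu>' \<frown> \<eta>) j" .
qed

end

section \<open>Transducers\<close>

text \<open>The natural states are words of edges; a finite state set can be renamed by natural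
  numbers without changing the output.\<close>

lemma transducer_nat_states:
  fixes T :: "('e, 'f, 'q) transducer"
  assumes "is_transducer T"
  obtains T' :: "('e, 'f, nat) transducer" where
    "is_transducer T'" "in_alph T' = in_alph T" "out_alph T' = out_alph T"
    "\<And>\<alpha> \<beta>. \<lbrakk>range \<alpha> \<subseteq> in_alph T; transduces T \<alpha> \<beta>\<rbrakk> \<Longrightarrow> transduces T' \<alpha> \<beta>"
proof -
  have T: "finite (states T)" "init T \<in> states T"
    "\<And>q a. \<lbrakk>q \<in> states T; a \<in> in_alph T\<rbrakk> \<Longrightarrow> step T q a \<in> states T \<times> lists (out_alph T)"
    using assms by (auto simp: is_transducer_def)
  obtain g :: "'q \<Rightarrow> nat" where g: "inj_on g (states T)"
    using finite_imp_inj_to_nat_seg[OF T(1)] by blast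
  define h where "h = inv_into (states T) g"
  have hg: "h (g q) = q" if "q \<in> states T" for q using that g by (simp add: h_def)
  define T' where "T' = \<lparr>in_alph = in_alph T, out_alph = out_alph T, states = g ` states T, init = g (init T),
    step = (\<lambda>q a. map_prod g id (step T (h q) a))\<rparr>"
  have "step T' q a \<in> states T' \<times> lists (out_alph T')" if "q \<in> states T'" "a \<in> in_alph T'" for q a
  proof -
    obtain r where r: "r \<in> states T" "q = g r" using \<open>q \<in> states T'\<close> by (auto simp: T'_def)
    have "step T r a \<in> states T \<times> lists (out_alph T)" using r that(2) T(3) by (simp add: T'_def)
    then show ?thesis using r hg by (cases "step T r a") (simp add: T'_def)
  qed
  then have "is_transducer T'"
    using assms T by (auto simp: is_transducer_def T'_def)
  moreover have "transduces T' \<alpha> \<beta>" if \<alpha>: "range \<alpha> \<subseteq> in_alph T" "transduces T \<alpha> \<beta>" for \<alpha> \<beta>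
  proof -
    have "run T \<alpha> i \<in> states T \<and> run T' \<alpha> i = g (run T \<alpha> i)" for i
    proof (induction i)
      case 0
      then show ?case using T by (simp add: T'_def)
    next
      case (Suc i)
      then have "step T (run T \<alpha> i) (\<alpha> i) \<in> states T \<times> lists (out_alph T)"
        using T(3) \<alpha>(1) by blast
      then show ?case using Suc hg by (auto simp: T'_def mem_Times_iff)
    qed
    then have "out_word T' \<alpha> = out_word T \<alpha>"
      using hg by (auto simp: out_word_def T'_def fun_eq_iff)
    then show ?thesis using \<alpha>(2) by (simp add: transduces_def)
  qed
  ultimately show thesis using that[of T'] by (simp add: T'_def)
qed

lemma conc_eq_conc_le:
  assumes "u \<frown> x = w \<frown> y" "length u \<le> length w"
  shows "w = u @ drop (length u) w" "x = drop (length u) w \<frown> y"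
proof -
  have "prefix (length u) (u \<frown> x) = prefix (length u) (w \<frown> y)" using assms by simp
  then have u: "u = take (length u) w" using assms(2) by simp
  then show w: "w = u @ drop (length u) w" by (metis append_take_drop_id)
  have "suffix (length u) (u \<frown> x) = suffix (length u) (u \<frown> drop (length u) w \<frown> y)"
    using assms(1) w by (metis conc_conc)
  then show "x = drop (length u) w \<frown> y" by (simp del: conc_conc)
qed

section \<open>Walks in the coding graph, using only the step relation of \<psi>\<close>

locale coding_dynamics = fin_digraph G for G :: "('v, 'e) pre_digraph" (structure) +
  fixes J :: "('v, 'e) jpair set" and \<psi> :: "(nat \<Rightarrow> 'e) \<Rightarrow> nat \<Rightarrow> 'e"
  assumes admissible: "admissible G J"
    and nonneg: "a \<in> arcs (coding_graph G J) \<Longrightarrow> nonneg_edge G a"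
    and no_nonpos_cycle: "\<not> (\<exists>\<omega>. wf_digraph.closed_w (coding_graph G J) \<omega> \<and> nonpos_path G \<omega>)"
    and synchronizing: "left_synchronizing G J"
    and \<psi>_closed: "\<alpha> \<in> inf_paths G \<Longrightarrow> \<psi> \<alpha> \<in> inf_paths G"
    and \<psi>_source: "\<alpha> \<in> inf_paths G \<Longrightarrow> tail G (\<psi> \<alpha> 0) = tail G (\<alpha> 0)"
    and \<psi>_build: "\<lbrakk>x \<in> J; snd x = (v, e # \<nu>); fst x = (w, \<mu>'); e ## \<gamma> \<in> inf_paths G;
      \<psi> \<gamma> = \<nu> \<frown> \<eta>; \<psi> \<gamma> \<in> cylinder G (head G e, \<nu>)\<rbrakk> \<Longrightarrow> \<psi> (e ## \<gamma>) = \<mu>' \<frown> \<eta>"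
begin

text \<open>To apply \<open>\<psi>_build\<close> at the letter \<open>\<alpha> n\<close>, the rest
  of the second component must begin \<psi> of the remaining path. Prepending
  \<open>\<alpha> n\<close> turns this into a cylinder condition, which has a unique solution in
  \<open>J\<close>.\<close>

definition code :: "(nat \<Rightarrow> 'e) \<Rightarrow> nat \<Rightarrow> ('v, 'e) jpair" where
  "code \<alpha> n = (THE x. x \<in> J \<and> \<alpha> n ## \<psi> (suffix (Suc n) \<alpha>) \<in> cylinder G (snd x))"

definition rest_word :: "(nat \<Rightarrow> 'e) \<Rightarrow> nat \<Rightarrow> nat \<Rightarrow> 'e" where
  "rest_word \<alpha> n = suffix (plen (rest_path G (code \<alpha> n))) (\<psi> (suffix (Suc n) \<alpha>))"

lemma code:
  assumes \<alpha>: "\<alpha> \<in> inf_paths G"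
  shows "code \<alpha> n \<in> J" "first_edge (code \<alpha> n) = \<alpha> n"
    "rest_path G (code \<alpha> n) \<in> paths G"
    "\<psi> (suffix (Suc n) \<alpha>) = snd (rest_path G (code \<alpha> n)) \<frown> rest_word \<alpha> n"
    "\<psi> (suffix (Suc n) \<alpha>) \<in> cylinder G (rest_path G (code \<alpha> n))"
    "\<psi> (suffix n \<alpha>) = snd (fst (code \<alpha> n)) \<frown> rest_word \<alpha> n"
    "\<psi> (suffix n \<alpha>) \<in> cylinder G (fst (code \<alpha> n))"
proof -
  let ?\<gamma> = "suffix (Suc n) \<alpha>" and ?x = "code \<alpha> n"
  have \<gamma>: "?\<gamma> \<in> inf_paths G" using \<alpha> by (rule suffix_in_inf_paths)
  have "\<alpha> n ## \<psi> ?\<gamma> \<in> inf_paths G"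
    using \<psi>_closed[OF \<gamma>] \<psi>_source[OF \<gamma>] inf_paths_arc[OF \<alpha>] inf_paths_head[OF \<alpha>, of n]
    by (simp add: build_in_inf_paths_iff)
  from theI'[OF admissible_unique[OF admissible this]]
  have x: "?x \<in> J" "\<alpha> n ## \<psi> ?\<gamma> \<in> cylinder G (snd ?x)" by (auto simp: code_def)
  note adm = admissible_paths[OF admissible x(1)]
  obtain v w fs \<mu>' where fs: "snd ?x = (v, fs)" "fst ?x = (w, \<mu>')" by (metis surj_pair)
  obtain e \<nu> where e\<nu>: "fs = e # \<nu>" using adm(5) fs by (cases fs) (auto simp: plen_def)
  have path: "(v, e # \<nu>) \<in> paths G" "(w, \<mu>') \<in> paths G" using adm fs e\<nu> by auto
  have cyl: "\<alpha> n = e" "\<psi> ?\<gamma> \<in> cylinder G (head G e, \<nu>)"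
    using x(2) fs e\<nu> path by (auto simp: cylinder_Cons_iff simp del: Cons_in_paths_iff)
  have rest: "rest_path G ?x = (head G e, \<nu>)" by (simp add: rest_path_def first_edge_def fs e\<nu>)
  show "?x \<in> J" by (rule x(1))
  show "first_edge ?x = \<alpha> n" by (simp add: first_edge_def fs e\<nu> cyl)
  show "rest_path G ?x \<in> paths G" using path by (simp add: rest)
  show \<gamma>_eq: "\<psi> ?\<gamma> = snd (rest_path G ?x) \<frown> rest_word \<alpha> n"
    using cylinder_conc_suffix[OF cyl(2)] by (simp add: rest rest_word_def plen_def)
  show "\<psi> ?\<gamma> \<in> cylinder G (rest_path G ?x)" using cyl by (simp add: rest)
  have build: "e ## ?\<gamma> = suffix n \<alpha>" using cyl(1)[symmetric] by simp
  have "\<psi> (e ## ?\<gamma>) = \<mu>' \<frown> rest_word \<alpha> n"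
  proof (rule \<psi>_build[OF x(1) _ fs(2)])
    show "snd ?x = (v, e # \<nu>)" by (simp add: fs e\<nu>)
    show "e ## ?\<gamma> \<in> inf_paths G" unfolding build using \<alpha> by (rule suffix_in_inf_paths)
    show "\<psi> ?\<gamma> = \<nu> \<frown> rest_word \<alpha> n" using \<gamma>_eq by (simp add: rest)
  qed (rule cyl(2))
  then show \<mu>_eq: "\<psi> (suffix n \<alpha>) = snd (fst ?x) \<frown> rest_word \<alpha> n"
    using build fs by simp
  have "rest_word \<alpha> n \<in> inf_paths G" "tail G (rest_word \<alpha> n 0) = prng G (v, e # \<nu>)"
    using cylinder_suffix[OF _ cyl(2)] path by (auto simp: rest_word_def rest plen_def)
  then show "\<psi> (suffix n \<alpha>) \<in> cylinder G (fst ?x)"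
    unfolding \<mu>_eq fs snd_conv using conc_in_cylinder_iff[OF path(2)] adm(4) fs e\<nu> by simp
qed

lemma coding_graph_simps [simp]:
  "verts (coding_graph G J) = J" "tail (coding_graph G J) = fst" "head (coding_graph G J) = snd"
  by (auto simp: coding_graph_def)

lemma coding_graph_wf: "wf_digraph (coding_graph G J)"
  by unfold_locales (auto simp: coding_graph_def)

text \<open>The path \<psi> of the suffix from \<open>Suc n\<close> begins both with the rest path
  of one vertex and with the first component of the next. This common continuation makes the label
  nonzero and determines its degree.\<close>

lemma code_edge:
  assumes \<alpha>: "\<alpha> \<in> inf_paths G"
  shows "(code \<alpha> n, code \<alpha> (Suc n)) \<in> arcs (coding_graph G J)"
    and "plen (rest_path G (code \<alpha> n)) \<le> plen (fst (code \<alpha> (Suc n)))"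
proof -
  let ?x = "code \<alpha> n" and ?y = "code \<alpha> (Suc n)"
  have y: "fst ?y \<in> paths G" using admissible_paths[OF admissible code(1)[OF \<alpha>]] by blast
  note facts = code(3)[OF \<alpha>, of n] y code(5)[OF \<alpha>, of n, unfolded code(4)[OF \<alpha>]]
    code(7)[OF \<alpha>, of "Suc n", unfolded code(4)[OF \<alpha>]]
  show arc: "(?x, ?y) \<in> arcs (coding_graph G J)"
    using edge_label_nonzero[OF facts] code(1)[OF \<alpha>] by (simp add: coding_graph_def)
  obtain d where d: "d \<ge> 0" "edge_degree G (?x, ?y) d"
    using nonneg[OF arc] unfolding nonneg_edge_def by blast
  show "plen (rest_path G ?x) \<le> plen (fst ?y)" using edge_degree_eq[OF facts d(2)] d(1) by simp
qed

definition label_word :: "('v, 'e) jpair \<Rightarrow> ('v, 'e) jpair \<Rightarrow> 'e list" where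
  "label_word x y = drop (plen (rest_path G x)) (snd (fst y))"

lemma rest_word_Suc:
  assumes \<alpha>: "\<alpha> \<in> inf_paths G"
  shows "rest_word \<alpha> n = label_word (code \<alpha> n) (code \<alpha> (Suc n)) \<frown> rest_word \<alpha> (Suc n)"
proof -
  have "snd (rest_path G (code \<alpha> n)) \<frown> rest_word \<alpha> n = snd (fst (code \<alpha> (Suc n))) \<frown> rest_word \<alpha> (Suc n)"
    using code(4)[OF \<alpha>, of n] code(6)[OF \<alpha>, of "Suc n"] by simp
  from conc_eq_conc_le(2)[OF this] code_edge(2)[OF \<alpha>, of n] show ?thesis
    by (simp add: label_word_def plen_def)
qed

lemma label_word_Nil:
  assumes \<alpha>: "\<alpha> \<in> inf_paths G" and "label_word (code \<alpha> n) (code \<alpha> (Suc n)) = []"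
  shows "rest_path G (code \<alpha> n) = fst (code \<alpha> (Suc n))"
proof -
  have "snd (rest_path G (code \<alpha> n)) \<frown> rest_word \<alpha> n = snd (fst (code \<alpha> (Suc n))) \<frown> rest_word \<alpha> (Suc n)"
    using code(4)[OF \<alpha>, of n] code(6)[OF \<alpha>, of "Suc n"] by simp
  from conc_eq_conc_le(1)[OF this] code_edge(2)[OF \<alpha>, of n] assms(2)
  have "snd (rest_path G (code \<alpha> n)) = snd (fst (code \<alpha> (Suc n)))"
    by (simp add: label_word_def plen_def)
  \<comment> \<open>Equal words are not enough: paths of length zero differ by their
    vertices.\<close>
  moreover have "fst (rest_path G (code \<alpha> n)) = fst (fst (code \<alpha> (Suc n)))"
    using code(5)[OF \<alpha>, of n] code(7)[OF \<alpha>, of "Suc n"] by (auto simp: cylinder_def psrc_def)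
  ultimately show ?thesis by (simp add: prod_eq_iff)
qed

lemma coding_awalk:
  assumes \<alpha>: "\<alpha> \<in> inf_paths G"
  shows "pre_digraph.awalk (coding_graph G J) (code \<alpha> i)
      (map (\<lambda>n. (code \<alpha> n, code \<alpha> (Suc n))) [i..<i + l]) (code \<alpha> (i + l))"
    and "pre_digraph.awalk_verts (coding_graph G J) (code \<alpha> i)
      (map (\<lambda>n. (code \<alpha> n, code \<alpha> (Suc n))) [i..<i + l]) = map (code \<alpha>) [i..<Suc (i + l)]"
proof -
  interpret H: wf_digraph "coding_graph G J" by (rule coding_graph_wf)
  have "H.cas (code \<alpha> i) (map (\<lambda>n. (code \<alpha> n, code \<alpha> (Suc n))) [i..<i + l]) (code \<alpha> (i + l))
    \<and> H.awalk_verts (code \<alpha> i) (map (\<lambda>n. (code \<alpha> n, code \<alpha> (Suc n))) [i..<i + l])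
      = map (code \<alpha>) [i..<Suc (i + l)]"
  proof (induction l arbitrary: i)
    case (Suc l)
    from Suc[of "Suc i"] show ?case by (simp add: upt_conv_Cons del: upt_Suc)
  qed simp
  moreover have "set (map (\<lambda>n. (code \<alpha> n, code \<alpha> (Suc n))) [i..<i + l]) \<subseteq> arcs (coding_graph G J)"
    using code_edge(1)[OF \<alpha>] by auto
  ultimately show "H.awalk (code \<alpha> i) (map (\<lambda>n. (code \<alpha> n, code \<alpha> (Suc n))) [i..<i + l]) (code \<alpha> (i + l))"
    "H.awalk_verts (code \<alpha> i) (map (\<lambda>n. (code \<alpha> n, code \<alpha> (Suc n))) [i..<i + l]) = map (code \<alpha>) [i..<Suc (i + l)]"
    using code(1)[OF \<alpha>] by (auto simp: H.awalk_def)
qed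

text \<open>Otherwise all edges of the walk have degree 0 from some point on. As \<open>J\<close> is
  finite, a vertex recurs there, which closes a non-positive cycle.\<close>

lemma label_word_infinitely_often:
  assumes \<alpha>: "\<alpha> \<in> inf_paths G"
  shows "\<exists>n\<ge>N. label_word (code \<alpha> n) (code \<alpha> (Suc n)) \<noteq> []"
proof (rule ccontr)
  assume "\<not> ?thesis"
  then have rest: "rest_path G (code \<alpha> n) = fst (code \<alpha> (Suc n))" if "n \<ge> N" for n
    using label_word_Nil[OF \<alpha>] that by blast
  have "finite (code \<alpha> ` {N..})"
    using code(1)[OF \<alpha>] admissible_finite[OF admissible] by (auto intro: finite_subset)
  then have "\<not> inj_on (code \<alpha>) {N..}" using finite_imageD infinite_Ici by blast
  then obtain i j where ij: "N \<le> i" "i < j" "code \<alpha> i = code \<alpha> j"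
    unfolding inj_on_def by (metis atLeast_iff linorder_neqE_nat)
  define \<omega> where "\<omega> = map (\<lambda>n. (code \<alpha> n, code \<alpha> (Suc n))) [i..<i + (j - i)]"
  have "pre_digraph.awalk (coding_graph G J) (code \<alpha> i) \<omega> (code \<alpha> i)"
    using coding_awalk(1)[OF \<alpha>, of i "j - i"] ij by (simp add: \<omega>_def)
  moreover have "0 < length \<omega>" using ij by (simp add: \<omega>_def)
  ultimately have "wf_digraph.closed_w (coding_graph G J) \<omega>"
    using wf_digraph.closed_w_def[OF coding_graph_wf] by blast
  moreover have "nonpos_path G \<omega>"
    unfolding nonpos_path_def
  proof
    fix a assume "a \<in> set \<omega>"
    then obtain n where n: "a = (code \<alpha> n, code \<alpha> (Suc n))" "n \<in> {i..<i + (j - i)}"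
      unfolding \<omega>_def set_map set_upt by (rule imageE)
    then have "n \<ge> N" using ij by simp
    with n have "edge_degree G a 0" using edge_degree_zero[OF code(3)[OF \<alpha>] rest] by simp
    then show "\<exists>d\<le>0. edge_degree G a d" by blast
  qed
  ultimately show False using no_nonpos_cycle by blast
qed

definition emitted :: "(nat \<Rightarrow> 'e) \<Rightarrow> nat \<Rightarrow> 'e list" where
  "emitted \<alpha> n = snd (fst (code \<alpha> 0))
    @ concat (map (\<lambda>i. label_word (code \<alpha> i) (code \<alpha> (Suc i))) [0..<n])"

lemma emitted_Suc: "emitted \<alpha> (Suc n) = emitted \<alpha> n @ label_word (code \<alpha> n) (code \<alpha> (Suc n))"
  by (simp add: emitted_def)

lemma \<psi>_emitted:
  assumes \<alpha>: "\<alpha> \<in> inf_paths G"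
  shows "\<psi> \<alpha> = emitted \<alpha> n \<frown> rest_word \<alpha> n"
proof (induction n)
  case 0
  then show ?case using code(6)[OF \<alpha>, of 0] by (simp add: emitted_def)
next
  case (Suc n)
  then show ?case unfolding rest_word_Suc[OF \<alpha>, of n] emitted_Suc by simp
qed

lemma emitted_unbounded:
  assumes \<alpha>: "\<alpha> \<in> inf_paths G"
  shows "\<exists>n. length (emitted \<alpha> n) \<ge> N"
proof (induction N)
  case (Suc N)
  then obtain n where n: "length (emitted \<alpha> n) \<ge> N" by blast
  obtain l where l: "l \<ge> n" "label_word (code \<alpha> l) (code \<alpha> (Suc l)) \<noteq> []"
    using label_word_infinitely_often[OF \<alpha>] by blast
  have "length (emitted \<alpha> n) \<le> length (emitted \<alpha> l)"
    using l(1) by (rule lift_Suc_mono_le[rotated]) (simp add: emitted_Suc)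
  also have "\<dots> < length (emitted \<alpha> (Suc l))" using l(2) by (simp add: emitted_Suc)
  finally show ?case using n by (intro exI[of _ "Suc l"]) simp
qed simp

lemma snd_path_subset: "\<tau> \<in> paths G \<Longrightarrow> set (snd \<tau>) \<subseteq> arcs G"
  by (auto simp: paths_def awalk_def)

text \<open>
  The state is the list of the last \<open>m + 1\<close> letters read, where \<open>m\<close> is the delay; it determines the
  vertex of the coding graph \<open>m\<close> steps back.
\<close>

lemma transducer_exists:
  "\<exists>T :: ('e, 'e, nat) transducer. is_transducer T \<and> in_alph T = arcs G \<and> out_alph T = arcs G \<and>
     (\<forall>\<alpha> \<in> inf_paths G. transduces T \<alpha> (\<psi> \<alpha>))"
proof -
  let ?H = "coding_graph G J"
  obtain m where m: "\<And>\<omega>1 \<omega>2. \<lbrakk>\<omega>1 \<in> paths ?H; \<omega>2 \<in> paths ?H; plen \<omega>1 = m; plen \<omega>2 = m;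
      code_word G J \<omega>1 = code_word G J \<omega>2\<rbrakk> \<Longrightarrow> psrc \<omega>1 = psrc \<omega>2"
    using synchronizing unfolding left_synchronizing_def by blast
  \<comment> \<open>The value is arbitrary on words that code no walk; otherwise synchronization
    makes it the unique starting vertex.\<close>
  define decode where "decode w = (SOME x. \<exists>\<omega> \<in> paths ?H. plen \<omega> = m \<and> code_word G J \<omega> = w \<and> psrc \<omega> = x)" for w
  have decode: "decode (map \<alpha> [n..<Suc (n + m)]) = code \<alpha> n" if \<alpha>: "\<alpha> \<in> inf_paths G" for \<alpha> n
  proof -
    define \<omega> where "\<omega> = (code \<alpha> n, map (\<lambda>n. (code \<alpha> n, code \<alpha> (Suc n))) [n..<n + m])"
    have "\<omega> \<in> paths ?H"
      using coding_awalk(1)[OF \<alpha>, of n m] unfolding \<omega>_def paths_def mem_Collect_eq prod.case by (rule exI)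
    then have \<omega>: "\<omega> \<in> paths ?H" "plen \<omega> = m" "psrc \<omega> = code \<alpha> n"
      by (simp_all add: \<omega>_def plen_def psrc_def)
    have w: "code_word G J \<omega> = map \<alpha> [n..<Suc (n + m)]"
      using coding_awalk(2)[OF \<alpha>, of n m] code(2)[OF \<alpha>] by (simp add: \<omega>_def code_word_def)
    have "\<exists>\<omega> \<in> paths ?H. plen \<omega> = m \<and> code_word G J \<omega> = map \<alpha> [n..<Suc (n + m)]
        \<and> psrc \<omega> = decode (map \<alpha> [n..<Suc (n + m)])"
      unfolding decode_def by (rule someI_ex) (use \<omega> w in blast)
    then show ?thesis using m \<omega> w by metis
  qed
  \<comment> \<open>Until \<open>m\<close> letters are stored no vertex is known. The next letter
    reveals the vertex at 0, whose first component is emitted; from then on the stored word and its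
    shift determine consecutive vertices.\<close>
  define out where "out b a = (if length b < m then [] else if length b = m then snd (fst (decode (b @ [a])))
      else label_word (decode b) (decode (tl b @ [a])))" for b and a :: 'e
  define T where "T = \<lparr>in_alph = arcs G, out_alph = arcs G,
      states = {b. set b \<subseteq> arcs G \<and> length b \<le> Suc m}, init = [],
      step = (\<lambda>b a. (drop (length b - m) (b @ [a]), filter (\<lambda>e. e \<in> arcs G) (out b a)))\<rparr>"
  have "step T b a \<in> states T \<times> lists (out_alph T)" if "b \<in> states T" "a \<in> in_alph T" for b a
    using that by (auto simp: T_def dest: in_set_dropD)
  then have T: "is_transducer T"
    by (auto simp: is_transducer_def) (auto simp: T_def finite_lists_length_le)
  have trans: "transduces T \<alpha> (\<psi> \<alpha>)" if \<alpha>: "\<alpha> \<in> inf_paths G" for \<alpha>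
  proof -
    \<comment> \<open>Truncated subtraction makes this the whole prefix as long as
      \<open>i \<le> Suc m\<close>.\<close>
    have run: "run T \<alpha> i = map \<alpha> [i - Suc m..<i]" for i
    proof (induction i)
      case (Suc i)
      have "run T \<alpha> (Suc i) = drop (i - (i - Suc m) - m) (map \<alpha> [i - Suc m..<Suc i])"
        using Suc by (simp add: T_def)
      also have "\<dots> = map \<alpha> [Suc i - Suc m..<Suc i]"
      proof -
        have "i - Suc m + (i - (i - Suc m) - m) = Suc i - Suc m" by arith
        then show ?thesis unfolding drop_map drop_upt by (simp only:)
      qed
      finally show ?case .
    qed (simp add: T_def)
    have sub: "set (snd (fst (code \<alpha> n))) \<subseteq> arcs G" for n
      using admissible_paths(1)[OF admissible code(1)[OF \<alpha>]] by (rule snd_path_subset)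
    have filt: "filter (\<lambda>e. e \<in> arcs G) w = w" if "set w \<subseteq> arcs G" for w
      using that by (simp add: filter_id_conv subset_iff)
    have ow: "out_word T \<alpha> i = filter (\<lambda>e. e \<in> arcs G) (out (map \<alpha> [i - Suc m..<i]) (\<alpha> i))" for i
      by (simp add: out_word_def run) (simp add: T_def)
    have out0: "out_word T \<alpha> i = []" if "i < m" for i
      using that by (simp add: ow out_def)
    have outm: "out_word T \<alpha> m = snd (fst (code \<alpha> 0))"
      using decode[OF \<alpha>, of 0] filt[OF sub] by (simp add: ow out_def)
    have outn: "out_word T \<alpha> (Suc m + n) = label_word (code \<alpha> n) (code \<alpha> (Suc n))" for n
    proof -
      have "map \<alpha> [n..<Suc m + n] = map \<alpha> [n..<Suc (n + m)]" by (simp add: add.commute)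
      moreover have "tl (map \<alpha> [n..<Suc m + n]) @ [\<alpha> (Suc m + n)] = map \<alpha> [Suc n..<Suc (Suc n + m)]"
        by (simp add: map_tl[symmetric] add.commute)
      ultimately have "out (map \<alpha> [n..<Suc m + n]) (\<alpha> (Suc m + n)) = label_word (code \<alpha> n) (code \<alpha> (Suc n))"
        using decode[OF \<alpha>, of n] decode[OF \<alpha>, of "Suc n"] by (simp add: out_def)
      moreover have "set (label_word (code \<alpha> n) (code \<alpha> (Suc n))) \<subseteq> arcs G"
        using sub[of "Suc n"] by (auto simp: label_word_def dest: in_set_dropD)
      ultimately show ?thesis using filt by (simp add: ow)
    qed
    define W where "W n = concat (map (out_word T \<alpha>) [0..<n])" for n
    have W0: "W n = []" if "n \<le> m" for n using that out0 by (auto simp: W_def)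
    \<comment> \<open>After \<open>m + 1\<close> letters only the vertex at 0 is known; the output
      therefore stays \<open>m + 1\<close> letters behind the input.\<close>
    have W: "W (Suc m + n) = emitted \<alpha> n" for n
    proof (induction n)
      case 0
      have "W (Suc m) = W m @ out_word T \<alpha> m" by (simp add: W_def)
      then show ?case by (simp add: W0 outm emitted_def)
    next
      case (Suc n)
      have "W (Suc m + Suc n) = W (Suc m + n) @ out_word T \<alpha> (Suc m + n)" by (simp add: W_def)
      then show ?case using Suc outn by (simp add: emitted_Suc)
    qed
    have pre: "emitted \<alpha> n = map (\<psi> \<alpha>) [0..<length (emitted \<alpha> n)]" for n
      using prefix_conc_length[of "emitted \<alpha> n" "rest_word \<alpha> n"]
      unfolding \<psi>_emitted[OF \<alpha>, of n, symmetric] by (simp add: subsequence_def)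
    have "W n = map (\<psi> \<alpha>) [0..<length (W n)]" for n
    proof (cases "n \<le> m")
      case True
      then show ?thesis by (simp add: W0)
    next
      case False
      then obtain i where "n = Suc m + i" by (metis less_iff_Suc_add not_less add_Suc)
      then show ?thesis using pre by (simp only: W)
    qed
    moreover have "\<exists>n. length (W n) \<ge> N" for N
      using emitted_unbounded[OF \<alpha>, of N] W by metis
    ultimately show ?thesis unfolding transduces_def W_def Let_def by blast
  qed
  obtain T' :: "('e, 'e, nat) transducer" where T': "is_transducer T'" "in_alph T' = in_alph T"
      "out_alph T' = out_alph T" "\<And>\<alpha> \<beta>. \<lbrakk>range \<alpha> \<subseteq> in_alph T; transduces T \<alpha> \<beta>\<rbrakk> \<Longrightarrow> transduces T' \<alpha> \<beta>"
    using transducer_nat_states[OF T] by blast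
  have "transduces T' \<alpha> (\<psi> \<alpha>)" if "\<alpha> \<in> inf_paths G" for \<alpha>
    using T'(4)[OF _ trans[OF that]] inf_paths_arc[OF that] by (auto simp: T_def)
  with T' show ?thesis by (intro exI[of _ T']) (simp add: T_def)
qed

end

theorem theorem6p7:
  fixes G :: "('v, 'e) pre_digraph"
    and J :: "(('v, 'e) gpath \<times> ('v, 'e) gpath) set"
    and A :: "'a cstar" and p :: "'v \<Rightarrow> 'a" and s :: "'e \<Rightarrow> 'a"
    and \<Phi> :: "'a \<Rightarrow> (nat \<Rightarrow> 'e) \<Rightarrow> complex"
    and lam :: "'a \<Rightarrow> 'a"
    and \<psi> :: "(nat \<Rightarrow> 'e) \<Rightarrow> (nat \<Rightarrow> 'e)"
  assumes "fin_digraph G" and "no_sinks G" and "no_sources G"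
    and "every_cycle_has_exit G"
    and "admissible G J"
    and "\<forall>a \<in> arcs (coding_graph G J). nonneg_edge G a"
    and "\<not> (\<exists>\<omega>. wf_digraph.closed_w (coding_graph G J) \<omega> \<and> nonpos_path G \<omega>)"
    and "left_synchronizing G J"
    and "graph_cstar G A p s"
    and "diagonal_identification G A p s \<Phi>"
    and "cuntz_endomorphism G A p s (u_elt A p s J) lam"
    and "induced_homeomorphism G A p s \<Phi> lam \<psi>"
  shows "\<exists>T :: ('e, 'e, nat) transducer.
           is_transducer T \<and> in_alph T = arcs G \<and> out_alph T = arcs G \<and>
           (\<forall>\<alpha> \<in> inf_paths G. transduces T \<alpha> (\<psi> \<alpha>))"
proof -
  obtain k where k: "homeomorphic_maps (inf_path_topology G) (inf_path_topology G) k \<psi>"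
    "\<forall>d \<in> carrier (diagonal G A p s).
       lam d \<in> carrier (diagonal G A p s) \<and> \<Phi> (lam d) = restrict (\<Phi> d \<circ> k) (inf_paths G)"
    using assms(12) unfolding induced_homeomorphism_def by blast
  interpret G: fin_digraph G by (rule assms(1))
  interpret cstar_algebra A using assms(9) by (simp add: graph_cstar_def)
  interpret induced_dynamics A G p s J \<Phi> lam \<psi> k
    using assms(2,5,9-11) k by unfold_locales (auto simp: graph_cstar_def)
  interpret coding_dynamics G J \<psi>
    by unfold_locales (use assms(5-8) \<psi>_k(1) \<psi>_source \<psi>_build in blast)+
  show ?thesis by (rule transducer_exists)
qed

end
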